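(* Let $A\Rightarrow M$ be a Lie algebroid with a bundle of ideals $\mathfrak k$ and Yang–Mills data for $\mathfrak k$, with $M$ compact. The multiplicative Yang–Mills action is invariant under the pullback by a gauge transformation $(\phi,\varphi)$, that is, $$\mathcal S(\phi^*(\mathcal C,v),\phi^*F)=\mathcal S((\mathcal C,v),F)$$ for any $((\mathcal C,v),F)\in\mathscr D(A;\mathfrak k)$. In particular, longitudinal and transversal criticality are invariant under gauge transformations, and moreover, so is adaptedness.
   Context: $A\Rightarrow M$ is a Lie algebroid with anchor $\rho$. A bundle of ideals is a vector subbundle $\mathfrak k\subset A$, $\mathfrak k\subset\ker\rho$, with $[\Gamma(A),\Gamma(\mathfrak k)]\subset\Gamma(\mathfrak k)$. A Yang–Mills data for $\mathfrak k$: a positive-definite metric $\langle\cdot,\cdot\rangle_{\mathfrak k}$ on $\mathfrak k$ with $\rho(\alpha)\langle\xi,\eta\rangle_{\mathfrak k}=\langle[\alpha,\xi],\eta\rangle_{\mathfrak k}+\langle\xi,[\alpha,\eta]\rangle_{\mathfrak k}$; and a Riemannian metric and orientation on $M$, with volume form $\mathrm{vol}_M$ and Hodge star $\star$. A gauge transformation $(\phi,\varphi)$ is a Lie algebroid automorphism $\phi\colon A\to A$ covering an orientation-preserving isometry $\varphi\colon M\to M$, restricting on $\mathfrak k$ to a Lie algebra bundle automorphism of $\mathfrak k$ which is an isometry for $\langle\cdot,\cdot\rangle_{\mathfrak k}$. Put $\phi_*(\alpha)=\phi\circ\alpha\circ\varphi^{-1}$ for sections. For $\gamma\in\Omega^q(M;\mathfrak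 k)$, $(\phi^*\gamma)(X_1,\dots,X_q)=\phi^{-1}\big(\gamma(d\varphi X_1,\dots,d\varphi X_q)\big)$; for a pair $c=(c_0,c_1)$ as below, $(\phi^*c)_0(\alpha)=\phi^*\big(c_0(\phi_*\alpha)\big)$, $(\phi^*c)_1(\beta)=\phi^*\big(c_1(\phi_*\beta)\big)$. IM forms of degree $q$: pairs $c=(c_0,c_1)$, $c_0\colon\Gamma(A)\to\Omega^q(M;\mathfrak k)$ $\mathbb R$-linear, $c_1\colon A\to\Lambda^{q-1}T^*M\otimes\mathfrak k$ a bundle map, with $c_0(f\alpha)=fc_0(\alpha)+df\wedge c_1(\alpha)$, $c_0[\alpha,\beta]=\mathcal L^A_\alpha c_0(\beta)-\mathcal L^A_\beta c_0(\alpha)$, $c_1[\alpha,\beta]=\mathcal L^A_\alpha(c_1(\beta))-\iota_{\rho(\beta)}c_0(\alpha)$, $\iota_{\rho(\alpha)}c_1(\beta)=-\iota_{\rho(\beta)}c_1(\alpha)$, where $(\mathcal L^A_\alpha\gamma)(\underline X)=[\alpha,\gamma(\underline X)]-\sum_j\gamma(\dots,[\rho(\alpha),X_j],\dots)$. For $\gamma\in\Omega^q(M;\mathfrak k)$: $(\delta^0\gamma)_0(\alpha)=\mathcal L^A_\alpha\gamma$, $(\delta^0\gamma)_1(\beta)=\iota_{\rho(\beta)}\gamma$; $\Omega^q_{\mathrm{inv}}(M;\mathfrak k)=\ker\delta^0$. An IM connection is an IM 1-form $(\mathcal C,v)$ with $v|_{\mathfrak k}=\mathrm{id}$; it induces $\nabla_X\xi=\mathcal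 C(\xi)(X)$ on $\mathfrak k$ and has curvature $\Omega^{(\mathcal C,v)}_0(\alpha)=d^\nabla(\mathcal C\alpha)$, $\Omega^{(\mathcal C,v)}_1(\alpha)=\mathcal C(\alpha-v(\alpha))$. $\mathscr D(A;\mathfrak k)$ is the set of $((\mathcal C,v),F)$ with $F\in\Omega^2(M;\mathfrak k)$ and $\delta^0F=\Omega^{(\mathcal C,v)}$. For such a triple put $G=d^\nabla F$ and, for a fixed constant $\mu\in\mathbb R\setminus\{0\}$, $\mathcal S((\mathcal C,v),F)=\int_M\langle F,F\rangle_{\mathfrak k}\mathrm{vol}_M+\mu\int_M\langle G,G\rangle_{\mathfrak k}\mathrm{vol}_M$. $((\mathcal C,v),F)$ is longitudinally critical if $\frac d{d\lambda}|_{\lambda=0}\mathcal S((\mathcal C,v)+\lambda\delta^0\gamma,\,F+\lambda d^\nabla\gamma-\frac{\lambda^2}2[\gamma,\gamma])=0$ for all $\gamma\in\Omega^1(M;\mathfrak k)$ (with $[\gamma,\gamma](X,Y)=2[\gamma(X),\gamma(Y)]$); transversally critical if $\frac d{d\lambda}|_{\lambda=0}\mathcal S((\mathcal C,v),F+\lambda\beta)=0$ for all $\beta\in\Omega^2_{\mathrm{inv}}(M;\mathfrak k)$; adapted if $\delta^0(\delta^\nabla G)=-\frac1\mu\Omega^{(\mathcal C,v)}$, where $\delta^\nabla=(-1)^k\star^{-1}d^\nabla\star$ on $k$-forms. *)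

theory Defs
  imports "HOL-Analysis.Analysis" "Jordan_Normal_Form.Determinant"
begin

hide_const (open) Determinants.det Finite_Cartesian_Product.vec

text \<open>
  Description of an object by a property that characterises it uniquely, with an
  explicit value \<open>d\<close> in case the property is not uniquely satisfied.
\<close>

definition the_or :: "'b \<Rightarrow> ('b \<Rightarrow> bool) \<Rightarrow> 'b" where
  "the_or d P = (if \<exists>!x. P x then THE x. P x else d)"


section \<open>Smooth manifolds\<close>

text \<open>
  The space \<open>\<real>\<^sup>n\<close> (for \<open>n :: nat\<close>, possibly \<open>0\<close>) is the topological product of \<open>n\<close> copies of the
  real line, indexed by \<open>{..<n}\<close>; its points are the functions in
  \<open>{..<n} \<rightarrow>\<^sub>E UNIV\<close>, and Lebesgue measure on it is the finite product of \<open>lborel\<close>.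
\<close>

abbreviation Rn :: "nat \<Rightarrow> (nat \<Rightarrow> real) topology" where
  "Rn n \<equiv> product_topology (\<lambda>_. euclideanreal) {..<n}"

definition pderiv_at :: "nat \<Rightarrow> ((nat \<Rightarrow> real) \<Rightarrow> real) \<Rightarrow> (nat \<Rightarrow> real) \<Rightarrow> real" where
  "pderiv_at i f y = deriv (\<lambda>t. f (y(i := t))) (y i)"

primrec Ck_on :: "nat \<Rightarrow> nat \<Rightarrow> (nat \<Rightarrow> real) set \<Rightarrow> ((nat \<Rightarrow> real) \<Rightarrow> real) \<Rightarrow> bool" where
  "Ck_on n 0 W f \<longleftrightarrow> continuous_map (subtopology (Rn n) W) euclideanreal f"
| "Ck_on n (Suc k) W f \<longleftrightarrow>
     continuous_map (subtopology (Rn n) W) euclideanreal f \<and>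
     (\<forall>i<n. (\<forall>y\<in>W. (\<lambda>t. f (y(i := t))) field_differentiable (at (y i))) \<and>
            Ck_on n k W (pderiv_at i f))"

definition smooth_on :: "nat \<Rightarrow> (nat \<Rightarrow> real) set \<Rightarrow> ((nat \<Rightarrow> real) \<Rightarrow> real) \<Rightarrow> bool" where
  "smooth_on n W f \<longleftrightarrow> (\<forall>k. Ck_on n k W f)"

type_synonym 'm chart = "'m set \<times> ('m \<Rightarrow> nat \<Rightarrow> real)"

definition is_chart :: "nat \<Rightarrow> 'm::topological_space chart \<Rightarrow> bool" where
  "is_chart n = (\<lambda>(U, x). open U \<and> openin (Rn n) (x ` U) \<and>
     homeomorphic_map (top_of_set U) (subtopology (Rn n) (x ` U)) x)"

definition smooth_transition :: "nat \<Rightarrow> 'm chart \<Rightarrow> 'm chart \<Rightarrow> bool" where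
  "smooth_transition n = (\<lambda>(U, x) (V, y).
     \<forall>i<n. smooth_on n (x ` (U \<inter> V)) (\<lambda>z. y (inv_into U x z) i))"

record 'm smooth_mfd =
  mdim :: nat
  atlas :: "'m chart set"

text \<open>The smooth structure is given by its maximal atlas.\<close>

definition smooth_manifold ::
    "('m::{t2_space, second_countable_topology}, 'x) smooth_mfd_scheme \<Rightarrow> bool" where
  "smooth_manifold S \<longleftrightarrow>
     (\<forall>c\<in>atlas S. is_chart (mdim S) c) \<and>
     (\<Union>c\<in>atlas S. fst c) = UNIV \<and>
     (\<forall>c\<in>atlas S. \<forall>d\<in>atlas S. smooth_transition (mdim S) c d) \<and>
     (\<forall>c. is_chart (mdim S) c \<and>
          (\<forall>d\<in>atlas S. smooth_transition (mdim S) c d \<and> smooth_transition (mdim S) d c)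
          \<longrightarrow> c \<in> atlas S)"

definition smooth_fun :: "('m, 'x) smooth_mfd_scheme \<Rightarrow> 'm set \<Rightarrow> ('m \<Rightarrow> real) \<Rightarrow> bool" where
  "smooth_fun S U f \<longleftrightarrow>
     (\<forall>(V, x)\<in>atlas S. smooth_on (mdim S) (x ` (U \<inter> V)) (\<lambda>z. f (inv_into V x z)))"

definition smooth_near ::
    "('m::topological_space, 'x) smooth_mfd_scheme \<Rightarrow> 'm \<Rightarrow> ('m \<Rightarrow> real) \<Rightarrow> bool" where
  "smooth_near S p f \<longleftrightarrow> (\<exists>U. open U \<and> p \<in> U \<and> smooth_fun S U f)"

definition diffeomorphism ::
    "('m::topological_space, 'x) smooth_mfd_scheme \<Rightarrow> ('m \<Rightarrow> 'm) \<Rightarrow> bool" where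
  "diffeomorphism S h \<longleftrightarrow>
     homeomorphism UNIV UNIV h (inv_into UNIV h) \<and>
     (\<forall>k\<in>{h, inv_into UNIV h}. \<forall>(U, x)\<in>atlas S. \<forall>(V, y)\<in>atlas S. \<forall>i<mdim S.
        smooth_on (mdim S) (x ` (U \<inter> k -` V)) (\<lambda>z. y (k (inv_into U x z)) i))"

text \<open>
  Tangent vectors at \<open>p\<close> are the derivations of germs of smooth functions at \<open>p\<close>, represented
  as functionals on all functions that depend only on the germ and vanish on functions that are
  not smooth near \<open>p\<close>.
\<close>

type_synonym 'm tan = "('m \<Rightarrow> real) \<Rightarrow> real"

definition tangent_space ::
    "('m::topological_space, 'x) smooth_mfd_scheme \<Rightarrow> 'm \<Rightarrow> 'm tan set" where
  "tangent_space S p = {v.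
     (\<forall>f. \<not> smooth_near S p f \<longrightarrow> v f = 0) \<and>
     (\<forall>f g. (\<exists>U. open U \<and> p \<in> U \<and> (\<forall>q\<in>U. f q = g q)) \<longrightarrow> v f = v g) \<and>
     (\<forall>f g. smooth_near S p f \<and> smooth_near S p g \<longrightarrow>
        v (\<lambda>q. f q + g q) = v f + v g \<and>
        (\<forall>r. v (\<lambda>q. r * f q) = r * v f) \<and>
        v (\<lambda>q. f q * g q) = f p * v g + v f * g p)}"

definition differential :: "('m \<Rightarrow> 'm) \<Rightarrow> 'm tan \<Rightarrow> 'm tan" where
  "differential h v = (\<lambda>f. v (f \<circ> h))"

definition vector_field ::
    "('m::topological_space, 'x) smooth_mfd_scheme \<Rightarrow> ('m \<Rightarrow> 'm tan) \<Rightarrow> bool" where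
  "vector_field S X \<longleftrightarrow> (\<forall>p. X p \<in> tangent_space S p) \<and>
     (\<forall>U f. open U \<and> smooth_fun S U f \<longrightarrow> smooth_fun S U (\<lambda>p. X p f))"

definition vf_bracket ::
    "('m::topological_space, 'x) smooth_mfd_scheme
     \<Rightarrow> ('m \<Rightarrow> 'm tan) \<Rightarrow> ('m \<Rightarrow> 'm tan) \<Rightarrow> 'm \<Rightarrow> 'm tan" where
  "vf_bracket S X Y = (\<lambda>p f.
     if smooth_near S p f then X p (\<lambda>q. Y q f) - Y p (\<lambda>q. X q f) else 0)"

definition coord_frame ::
    "('m::topological_space, 'x) smooth_mfd_scheme \<Rightarrow> 'm chart \<Rightarrow> 'm \<Rightarrow> 'm tan list" where
  "coord_frame S = (\<lambda>(U, x) p. map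
     (\<lambda>i f. if smooth_near S p f then pderiv_at i (\<lambda>z. f (inv_into U x z)) (x p) else 0)
     [0..<mdim S])"

definition tan_comb :: "nat \<Rightarrow> (nat \<Rightarrow> real) \<Rightarrow> 'm tan list \<Rightarrow> 'm tan" where
  "tan_comb n c e = (\<lambda>f. \<Sum>i<n. c i * (e ! i) f)"

definition tangent_basis ::
    "('m::topological_space, 'x) smooth_mfd_scheme \<Rightarrow> 'm \<Rightarrow> 'm tan list \<Rightarrow> bool" where
  "tangent_basis S p e \<longleftrightarrow> length e = mdim S \<and> set e \<subseteq> tangent_space S p \<and>
     (\<forall>v\<in>tangent_space S p. \<exists>c. v = tan_comb (mdim S) c e) \<and>
     (\<forall>c. tan_comb (mdim S) c e = (\<lambda>f. 0) \<longrightarrow> (\<forall>i<mdim S. c i = 0))"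


section \<open>Vector bundles and Lie algebroids\<close>

text \<open>
  The fibres of a vector bundle over \<open>M\<close> are linear subspaces \<open>fib p\<close> of an ambient real vector
  space \<open>'a\<close>, which carries no topology and no relation between different fibres; every abstract
  family of vector spaces is of this form (take \<open>'a\<close> to be the direct sum of the fibres). The
  smooth structure is given by an atlas of local frames with smooth transition coefficients.
\<close>

definition fibre_basis :: "'a::real_vector set \<Rightarrow> nat \<Rightarrow> (nat \<Rightarrow> 'a) \<Rightarrow> bool" where
  "fibre_basis E r b \<longleftrightarrow> inj_on b {..<r} \<and> independent (b ` {..<r}) \<and> span (b ` {..<r}) = E"

record ('m, 'a) algebroid = "'m smooth_mfd" +
  fib :: "'m \<Rightarrow> 'a set"
  fib_rank :: nat
  frames :: "('m set \<times> (nat \<Rightarrow> 'm \<Rightarrow> 'a)) set"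
  anchor :: "'m \<Rightarrow> 'a \<Rightarrow> 'm tan"
  bracket :: "('m \<Rightarrow> 'a) \<Rightarrow> ('m \<Rightarrow> 'a) \<Rightarrow> 'm \<Rightarrow> 'a"

definition section_on ::
    "('m, 'a::real_vector, 'x) algebroid_scheme \<Rightarrow> 'm set \<Rightarrow> ('m \<Rightarrow> 'a) \<Rightarrow> bool" where
  "section_on S U s \<longleftrightarrow> (\<forall>p\<in>U. s p \<in> fib S p) \<and>
     (\<forall>(V, e)\<in>frames S. \<exists>c. (\<forall>i<fib_rank S. smooth_fun S (U \<inter> V) (c i)) \<and>
        (\<forall>p\<in>U \<inter> V. s p = (\<Sum>i<fib_rank S. c i p *\<^sub>R e i p)))"

definition sections :: "('m, 'a::real_vector, 'x) algebroid_scheme \<Rightarrow> ('m \<Rightarrow> 'a) set" where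
  "sections S = {s. section_on S UNIV s}"

definition vector_bundle ::
    "('m::topological_space, 'a::real_vector, 'x) algebroid_scheme \<Rightarrow> bool" where
  "vector_bundle S \<longleftrightarrow>
     (\<Union>(V, e)\<in>frames S. V) = UNIV \<and>
     (\<forall>(V, e)\<in>frames S. open V \<and> (\<forall>p\<in>V. fibre_basis (fib S p) (fib_rank S) (\<lambda>i. e i p)) \<and>
        (\<forall>i<fib_rank S. section_on S V (e i)))"

definition lie_algebroid ::
    "('m::{t2_space, second_countable_topology}, 'a::real_vector, 'x) algebroid_scheme \<Rightarrow> bool" where
  "lie_algebroid S \<longleftrightarrow> smooth_manifold S \<and> vector_bundle S \<and>
     (\<forall>p. \<forall>a\<in>fib S p. \<forall>b\<in>fib S p. \<forall>r.
        anchor S p a \<in> tangent_space S p \<and>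
        anchor S p (a + b) = (\<lambda>f. anchor S p a f + anchor S p b f) \<and>
        anchor S p (r *\<^sub>R a) = (\<lambda>f. r * anchor S p a f)) \<and>
     (\<forall>\<alpha>\<in>sections S. vector_field S (\<lambda>p. anchor S p (\<alpha> p))) \<and>
     (\<forall>\<alpha>\<in>sections S. \<forall>\<beta>\<in>sections S. \<forall>\<gamma>\<in>sections S.
        bracket S \<alpha> \<beta> \<in> sections S \<and>
        bracket S (\<lambda>p. \<alpha> p + \<beta> p) \<gamma> = (\<lambda>p. bracket S \<alpha> \<gamma> p + bracket S \<beta> \<gamma> p) \<and>
        (\<forall>r. bracket S (\<lambda>p. r *\<^sub>R \<alpha> p) \<beta> = (\<lambda>p. r *\<^sub>R bracket S \<alpha> \<beta> p)) \<and>
        bracket S \<alpha> \<beta> = (\<lambda>p. - bracket S \<beta> \<alpha> p) \<and>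
        (\<forall>p. bracket S \<alpha> (bracket S \<beta> \<gamma>) p + bracket S \<beta> (bracket S \<gamma> \<alpha>) p
             + bracket S \<gamma> (bracket S \<alpha> \<beta>) p = 0) \<and>
        (\<forall>f. smooth_fun S UNIV f \<longrightarrow> bracket S \<alpha> (\<lambda>p. f p *\<^sub>R \<beta> p) =
           (\<lambda>p. f p *\<^sub>R bracket S \<alpha> \<beta> p + anchor S p (\<alpha> p) f *\<^sub>R \<beta> p)))"


section \<open>Bundles of ideals and Yang--Mills data\<close>

text \<open>
  \<open>ideal\<close> is the subbundle \<open>\<kk>\<close>, \<open>kmet\<close> its fibre metric, \<open>gmet\<close> the Riemannian metric of \<open>M\<close>,
  and \<open>orient p\<close> the set of positively oriented ordered bases of the tangent space at \<open>p\<close>.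
\<close>

record ('m, 'a) ym = "('m, 'a) algebroid" +
  ideal :: "'m \<Rightarrow> 'a set"
  kmet :: "'m \<Rightarrow> 'a \<Rightarrow> 'a \<Rightarrow> real"
  gmet :: "'m \<Rightarrow> 'm tan \<Rightarrow> 'm tan \<Rightarrow> real"
  orient :: "'m \<Rightarrow> 'm tan list set"

definition k_sections :: "('m, 'a::real_vector, 'x) ym_scheme \<Rightarrow> ('m \<Rightarrow> 'a) set" where
  "k_sections S = {s \<in> sections S. \<forall>p. s p \<in> ideal S p}"

definition bundle_of_ideals ::
    "('m::topological_space, 'a::real_vector, 'x) ym_scheme \<Rightarrow> bool" where
  "bundle_of_ideals S \<longleftrightarrow>
     (\<exists>r. \<forall>p. \<exists>U e. open U \<and> p \<in> U \<and> (\<forall>i<r. section_on S U (e i)) \<and>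
        (\<forall>q\<in>U. fibre_basis (ideal S q) r (\<lambda>i. e i q))) \<and>
     (\<forall>p. \<forall>\<xi>\<in>ideal S p. \<xi> \<in> fib S p \<and> anchor S p \<xi> = (\<lambda>f. 0)) \<and>
     (\<forall>\<alpha>\<in>sections S. \<forall>\<xi>\<in>k_sections S. bracket S \<alpha> \<xi> \<in> k_sections S)"

definition invariant_metric ::
    "('m::topological_space, 'a::real_vector, 'x) ym_scheme \<Rightarrow> bool" where
  "invariant_metric S \<longleftrightarrow>
     (\<forall>p. \<forall>\<xi>\<in>ideal S p. \<forall>\<eta>\<in>ideal S p. \<forall>\<zeta>\<in>ideal S p. \<forall>r.
        kmet S p \<xi> \<eta> = kmet S p \<eta> \<xi> \<and>
        kmet S p (\<xi> + \<eta>) \<zeta> = kmet S p \<xi> \<zeta> + kmet S p \<eta> \<zeta> \<and>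
        kmet S p (r *\<^sub>R \<xi>) \<eta> = r * kmet S p \<xi> \<eta> \<and>
        (\<xi> \<noteq> 0 \<longrightarrow> kmet S p \<xi> \<xi> > 0)) \<and>
     (\<forall>\<xi>\<in>k_sections S. \<forall>\<eta>\<in>k_sections S. smooth_fun S UNIV (\<lambda>p. kmet S p (\<xi> p) (\<eta> p))) \<and>
     (\<forall>\<alpha>\<in>sections S. \<forall>\<xi>\<in>k_sections S. \<forall>\<eta>\<in>k_sections S. \<forall>p.
        anchor S p (\<alpha> p) (\<lambda>q. kmet S q (\<xi> q) (\<eta> q)) =
        kmet S p (bracket S \<alpha> \<xi> p) (\<eta> p) + kmet S p (\<xi> p) (bracket S \<alpha> \<eta> p))"

definition riemannian_metric ::
    "('m::topological_space, 'a::real_vector, 'x) ym_scheme \<Rightarrow> bool" where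
  "riemannian_metric S \<longleftrightarrow>
     (\<forall>p. \<forall>u\<in>tangent_space S p. \<forall>v\<in>tangent_space S p. \<forall>w\<in>tangent_space S p. \<forall>r.
        gmet S p u v = gmet S p v u \<and>
        gmet S p (\<lambda>f. u f + v f) w = gmet S p u w + gmet S p v w \<and>
        gmet S p (\<lambda>f. r * u f) v = r * gmet S p u v \<and>
        (u \<noteq> (\<lambda>f. 0) \<longrightarrow> gmet S p u u > 0)) \<and>
     (\<forall>X Y. vector_field S X \<and> vector_field S Y \<longrightarrow>
        smooth_fun S UNIV (\<lambda>p. gmet S p (X p) (Y p)))"

definition real_det :: "nat \<Rightarrow> (nat \<Rightarrow> nat \<Rightarrow> real) \<Rightarrow> real" where
  "real_det n a = Determinant.det (Matrix.mat n n (\<lambda>(i, j). a i j))"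

definition oriented_chart ::
    "('m::topological_space, 'a::real_vector, 'x) ym_scheme \<Rightarrow> 'm chart \<Rightarrow> bool" where
  "oriented_chart S c \<longleftrightarrow> c \<in> atlas S \<and> (\<forall>q\<in>fst c. coord_frame S c q \<in> orient S q)"

definition orientation ::
    "('m::topological_space, 'a::real_vector, 'x) ym_scheme \<Rightarrow> bool" where
  "orientation S \<longleftrightarrow>
     (\<forall>p. \<forall>e\<in>orient S p. tangent_basis S p e) \<and>
     (\<forall>p e e' a. e \<in> orient S p \<and> tangent_basis S p e' \<and>
        (\<forall>j<mdim S. e' ! j = tan_comb (mdim S) (\<lambda>i. a i j) e) \<longrightarrow>
        (e' \<in> orient S p \<longleftrightarrow> real_det (mdim S) a > 0)) \<and>
     (\<forall>p. \<exists>c. oriented_chart S c \<and> p \<in> fst c)"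

definition yang_mills_data ::
    "('m::{t2_space, second_countable_topology}, 'a::real_vector, 'x) ym_scheme \<Rightarrow> bool" where
  "yang_mills_data S \<longleftrightarrow> invariant_metric S \<and> riemannian_metric S \<and> orientation S"

definition orthonormal_basis ::
    "('m::topological_space, 'a::real_vector, 'x) ym_scheme \<Rightarrow> 'm \<Rightarrow> 'm tan list \<Rightarrow> bool" where
  "orthonormal_basis S p e \<longleftrightarrow> tangent_basis S p e \<and>
     (\<forall>i<mdim S. \<forall>j<mdim S. gmet S p (e ! i) (e ! j) = (if i = j then 1 else 0))"

text \<open>
  \<open>vol_form\<close> is the \<open>n\<close>-form with value \<open>1\<close> on positively oriented orthonormal bases, so that
  its value on any vectors is the determinant of their coefficients in such a basis.
  \<open>vol_measure\<close> is the Borel measure \<open>B \<mapsto> \<integral>\<^sub>B vol\<^sub>M\<close>, whose values on Borel subsets of the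
  domain of an oriented chart are integrals of the coordinate expression of \<open>vol\<^sub>M\<close>.
\<close>

definition vol_form ::
    "('m::topological_space, 'a::real_vector, 'x) ym_scheme \<Rightarrow> 'm \<Rightarrow> 'm tan list \<Rightarrow> real" where
  "vol_form S p vs = the_or 0 (\<lambda>d. \<forall>e. orthonormal_basis S p e \<and> e \<in> orient S p \<longrightarrow>
     d = real_det (mdim S) (\<lambda>i j. gmet S p (e ! i) (vs ! j)))"

definition vol_measure ::
    "('m::topological_space, 'a::real_vector, 'x) ym_scheme \<Rightarrow> 'm measure" where
  "vol_measure S = the_or (null_measure borel) (\<lambda>\<nu>. sets \<nu> = sets borel \<and>
     (\<forall>U x B. oriented_chart S (U, x) \<and> B \<in> sets borel \<and> B \<subseteq> U \<longrightarrow>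
        emeasure \<nu> B =
          (\<integral>\<^sup>+ z. ennreal (vol_form S (inv_into U x z) (coord_frame S (U, x) (inv_into U x z)))
                 * indicator (x ` B) z \<partial>(\<Pi>\<^sub>M i\<in>{..<mdim S}. lborel))))"


section \<open>Differential forms with values in the bundle of ideals\<close>

text \<open>
  A form assigns to each point a function on lists of tangent vectors. The value at \<open>p\<close> is
  alternating and multilinear on lists of \<open>q\<close> tangent vectors at \<open>p\<close>; as a convention it is \<open>0\<close> on
  all other lists, so that equality of forms is equality of functions.
\<close>

type_synonym ('m, 'a) form = "'m \<Rightarrow> 'm tan list \<Rightarrow> 'a"

definition alt_forms ::
    "('m::topological_space, 'a::real_vector, 'x) ym_scheme \<Rightarrow> nat \<Rightarrow> 'm \<Rightarrow> ('m tan list \<Rightarrow> 'a) set" where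
  "alt_forms S q p = {h.
     (\<forall>vs. \<not> (length vs = q \<and> set vs \<subseteq> tangent_space S p) \<longrightarrow> h vs = 0) \<and>
     (\<forall>vs. length vs = q \<and> set vs \<subseteq> tangent_space S p \<longrightarrow>
        h vs \<in> ideal S p \<and>
        (\<forall>i<q. \<forall>u\<in>tangent_space S p.
           h (vs[i := (\<lambda>f. (vs ! i) f + u f)]) = h vs + h (vs[i := u])) \<and>
        (\<forall>i<q. \<forall>r. h (vs[i := (\<lambda>f. r * (vs ! i) f)]) = r *\<^sub>R h vs) \<and>
        (\<forall>i<q. \<forall>j<q. i \<noteq> j \<and> vs ! i = vs ! j \<longrightarrow> h vs = 0))}"

definition eval_form :: "('m, 'a) form \<Rightarrow> ('m \<Rightarrow> 'm tan) list \<Rightarrow> 'm \<Rightarrow> 'a" where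
  "eval_form \<gamma> Xs = (\<lambda>p. \<gamma> p (map (\<lambda>X. X p) Xs))"

definition field_lists ::
    "('m::topological_space, 'x) smooth_mfd_scheme \<Rightarrow> nat \<Rightarrow> ('m \<Rightarrow> 'm tan) list set" where
  "field_lists S q = {Xs. length Xs = q \<and> (\<forall>X\<in>set Xs. vector_field S X)}"

definition forms ::
    "('m::topological_space, 'a::real_vector, 'x) ym_scheme \<Rightarrow> nat \<Rightarrow> ('m, 'a) form set" where
  "forms S q = {\<gamma>. (\<forall>p. \<gamma> p \<in> alt_forms S q p) \<and>
     (\<forall>Xs\<in>field_lists S q. eval_form \<gamma> Xs \<in> k_sections S)}"

text \<open>The form with prescribed values on vector fields.\<close>

definition form_of_fields ::
    "('m::topological_space, 'a::real_vector, 'x) ym_scheme \<Rightarrow> nat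
     \<Rightarrow> (('m \<Rightarrow> 'm tan) list \<Rightarrow> 'm \<Rightarrow> 'a) \<Rightarrow> ('m, 'a) form" where
  "form_of_fields S q \<Phi> = the_or (\<lambda>p vs. 0)
     (\<lambda>\<eta>. \<eta> \<in> forms S q \<and> (\<forall>Xs\<in>field_lists S q. eval_form \<eta> Xs = \<Phi> Xs))"

definition omit :: "nat \<Rightarrow> 'b list \<Rightarrow> 'b list" where
  "omit i xs = take i xs @ drop (Suc i) xs"

definition interior :: "('m, 'a) form \<Rightarrow> ('m \<Rightarrow> 'm tan) \<Rightarrow> ('m, 'a) form" where
  "interior \<gamma> X = (\<lambda>p vs. \<gamma> p (X p # vs))"

text \<open>The form \<open>df \<and> \<omega>\<close> of degree \<open>q\<close>.\<close>

definition d_wedge ::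
    "('m::topological_space, 'a::real_vector, 'x) ym_scheme \<Rightarrow> nat \<Rightarrow> ('m \<Rightarrow> real)
     \<Rightarrow> ('m, 'a) form \<Rightarrow> ('m, 'a) form" where
  "d_wedge S q f \<omega> = (\<lambda>p vs. if length vs = q \<and> set vs \<subseteq> tangent_space S p
     then \<Sum>j<q. ((- 1) ^ j * (vs ! j) f) *\<^sub>R \<omega> p (omit j vs) else 0)"

definition lieA ::
    "('m::topological_space, 'a::real_vector, 'x) ym_scheme \<Rightarrow> nat \<Rightarrow> ('m \<Rightarrow> 'a)
     \<Rightarrow> ('m, 'a) form \<Rightarrow> ('m, 'a) form" where
  "lieA S q \<alpha> \<gamma> = form_of_fields S q (\<lambda>Xs p. bracket S \<alpha> (eval_form \<gamma> Xs) p -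
     (\<Sum>j<q. eval_form \<gamma> (Xs[j := vf_bracket S (\<lambda>r. anchor S r (\<alpha> r)) (Xs ! j)]) p))"

text \<open>
  \<open>d\<^sup>\<nabla>\<close> on \<open>q\<close>-forms, by the Koszul formula, for the connection \<open>\<nabla>\<^sub>X \<xi> = \<C>(\<xi>)(X)\<close>.
\<close>

definition cov_d ::
    "('m::topological_space, 'a::real_vector, 'x) ym_scheme \<Rightarrow> (('m \<Rightarrow> 'a) \<Rightarrow> ('m, 'a) form) \<Rightarrow> nat
     \<Rightarrow> ('m, 'a) form \<Rightarrow> ('m, 'a) form" where
  "cov_d S C q \<gamma> = form_of_fields S (Suc q) (\<lambda>Xs p.
     (\<Sum>i<Suc q. (- 1) ^ i *\<^sub>R C (eval_form \<gamma> (omit i Xs)) p [(Xs ! i) p]) +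
     (\<Sum>j<Suc q. \<Sum>i<j. (- 1) ^ (i + j) *\<^sub>R
        eval_form \<gamma> (vf_bracket S (Xs ! i) (Xs ! j) # omit i (omit j Xs)) p))"

text \<open>\<open>[\<gamma>, \<gamma>](X, Y) = 2 [\<gamma>(X), \<gamma>(Y)]\<close>\<close>

definition form_bracket ::
    "('m::topological_space, 'a::real_vector, 'x) ym_scheme \<Rightarrow> ('m, 'a) form \<Rightarrow> ('m, 'a) form" where
  "form_bracket S \<gamma> = form_of_fields S 2 (\<lambda>Xs p.
     2 *\<^sub>R bracket S (eval_form \<gamma> [Xs ! 0]) (eval_form \<gamma> [Xs ! 1]) p)"

text \<open>
  The pointwise inner product of \<open>q\<close>-forms, normalised by \<open>\<langle>\<gamma> \<and> \<star>\<eta>\<rangle> = \<langle>\<gamma>, \<eta>\<rangle> vol\<^sub>M\<close>: the sum runs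
  over increasing multi-indices. \<open>nths e I\<close> lists the members of \<open>e\<close> with index in \<open>I\<close> in increasing order.
\<close>

definition form_inner ::
    "('m::topological_space, 'a::real_vector, 'x) ym_scheme \<Rightarrow> nat
     \<Rightarrow> ('m, 'a) form \<Rightarrow> ('m, 'a) form \<Rightarrow> 'm \<Rightarrow> real" where
  "form_inner S q \<gamma> \<eta> p = the_or 0 (\<lambda>d. \<forall>e. orthonormal_basis S p e \<longrightarrow>
     d = (\<Sum>I | I \<subseteq> {..<mdim S} \<and> card I = q. kmet S p (\<gamma> p (nths e I)) (\<eta> p (nths e I))))"

text \<open>The sign of the permutation of \<open>{..<n}\<close> listing first \<open>I\<close> and then its complement.\<close>

definition shuffle_sign :: "nat \<Rightarrow> nat set \<Rightarrow> real" where
  "shuffle_sign n I = (- 1) ^ card {(i, j). i \<in> I \<and> j \<in> {..<n} - I \<and> j < i}"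

text \<open>
  The Hodge star on \<open>q\<close>-forms. If \<open>q > n\<close>, the only \<open>q\<close>-form is \<open>0\<close> and its star is \<open>0\<close>.
\<close>

definition hodge ::
    "('m::topological_space, 'a::real_vector, 'x) ym_scheme \<Rightarrow> nat \<Rightarrow> ('m, 'a) form \<Rightarrow> ('m, 'a) form" where
  "hodge S q \<gamma> = the_or (\<lambda>p vs. 0) (\<lambda>\<eta>. \<eta> \<in> forms S (mdim S - q) \<and>
     (\<forall>p e I. orthonormal_basis S p e \<and> e \<in> orient S p \<and> I \<subseteq> {..<mdim S} \<and> card I = q \<longrightarrow>
        \<eta> p (nths e ({..<mdim S} - I)) = shuffle_sign (mdim S) I *\<^sub>R \<gamma> p (nths e I)))"

definition hodge_inv ::
    "('m::topological_space, 'a::real_vector, 'x) ym_scheme \<Rightarrow> nat \<Rightarrow> ('m, 'a) form \<Rightarrow> ('m, 'a) form" where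
  "hodge_inv S q \<omega> = the_or (\<lambda>p vs. 0) (\<lambda>\<eta>. \<eta> \<in> forms S q \<and> hodge S q \<eta> = \<omega>)"

text \<open>
  \<open>\<delta>\<^sup>\<nabla>\<close> on \<open>k\<close>-forms, \<open>k \<ge> 1\<close>. If \<open>k > n\<close> everything vanishes, so that the truncated difference is harmless.
\<close>

definition cov_delta ::
    "('m::topological_space, 'a::real_vector, 'x) ym_scheme \<Rightarrow> (('m \<Rightarrow> 'a) \<Rightarrow> ('m, 'a) form) \<Rightarrow> nat
     \<Rightarrow> ('m, 'a) form \<Rightarrow> ('m, 'a) form" where
  "cov_delta S C k \<gamma> = (\<lambda>p vs. (- 1) ^ k *\<^sub>R
     hodge_inv S (k - 1) (cov_d S C (mdim S - k) (hodge S k \<gamma>)) p vs)"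


section \<open>Infinitesimally multiplicative forms and connections\<close>

text \<open>
  The second component of an IM form is a bundle map, given fibrewise; \<open>on_sections\<close> is the
  induced map on sections.
\<close>

type_synonym ('m, 'a) im =
  "(('m \<Rightarrow> 'a) \<Rightarrow> ('m, 'a) form) \<times> ('m \<Rightarrow> 'a \<Rightarrow> 'm tan list \<Rightarrow> 'a)"

definition on_sections :: "('m \<Rightarrow> 'a \<Rightarrow> 'm tan list \<Rightarrow> 'a) \<Rightarrow> ('m \<Rightarrow> 'a) \<Rightarrow> ('m, 'a) form" where
  "on_sections c1 \<alpha> = (\<lambda>p. c1 p (\<alpha> p))"

definition anchored :: "('m, 'a, 'x) algebroid_scheme \<Rightarrow> ('m \<Rightarrow> 'a) \<Rightarrow> 'm \<Rightarrow> 'm tan" where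
  "anchored S \<alpha> = (\<lambda>p. anchor S p (\<alpha> p))"

definition im_form ::
    "('m::topological_space, 'a::real_vector, 'x) ym_scheme \<Rightarrow> nat \<Rightarrow> ('m, 'a) im \<Rightarrow> bool" where
  "im_form S q = (\<lambda>(c0, c1). 0 < q \<and>
     (\<forall>\<alpha>\<in>sections S. c0 \<alpha> \<in> forms S q \<and> on_sections c1 \<alpha> \<in> forms S (q - 1)) \<and>
     (\<forall>p. \<forall>a\<in>fib S p. \<forall>b\<in>fib S p. \<forall>r. c1 p a \<in> alt_forms S (q - 1) p \<and>
        c1 p (a + b) = (\<lambda>vs. c1 p a vs + c1 p b vs) \<and>
        c1 p (r *\<^sub>R a) = (\<lambda>vs. r *\<^sub>R c1 p a vs)) \<and>
     (\<forall>\<alpha>\<in>sections S. \<forall>\<beta>\<in>sections S.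
        c0 (\<lambda>p. \<alpha> p + \<beta> p) = (\<lambda>p vs. c0 \<alpha> p vs + c0 \<beta> p vs) \<and>
        (\<forall>r. c0 (\<lambda>p. r *\<^sub>R \<alpha> p) = (\<lambda>p vs. r *\<^sub>R c0 \<alpha> p vs)) \<and>
        (\<forall>f. smooth_fun S UNIV f \<longrightarrow> c0 (\<lambda>p. f p *\<^sub>R \<alpha> p) =
           (\<lambda>p vs. f p *\<^sub>R c0 \<alpha> p vs + d_wedge S q f (on_sections c1 \<alpha>) p vs)) \<and>
        c0 (bracket S \<alpha> \<beta>) =
          (\<lambda>p vs. lieA S q \<alpha> (c0 \<beta>) p vs - lieA S q \<beta> (c0 \<alpha>) p vs) \<and>
        on_sections c1 (bracket S \<alpha> \<beta>) =
          (\<lambda>p vs. lieA S (q - 1) \<alpha> (on_sections c1 \<beta>) p vs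
                  - interior (c0 \<alpha>) (anchored S \<beta>) p vs) \<and>
        interior (on_sections c1 \<beta>) (anchored S \<alpha>) =
          (\<lambda>p vs. - interior (on_sections c1 \<alpha>) (anchored S \<beta>) p vs)))"

definition delta0 ::
    "('m::topological_space, 'a::real_vector, 'x) ym_scheme \<Rightarrow> nat \<Rightarrow> ('m, 'a) form \<Rightarrow> ('m, 'a) im" where
  "delta0 S q \<gamma> = (\<lambda>\<alpha>. lieA S q \<alpha> \<gamma>, \<lambda>p b vs. \<gamma> p (anchor S p b # vs))"

definition invariant_forms ::
    "('m::topological_space, 'a::real_vector, 'x) ym_scheme \<Rightarrow> nat \<Rightarrow> ('m, 'a) form set" where
  "invariant_forms S q = {\<gamma> \<in> forms S q. \<forall>\<alpha>\<in>sections S.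
     fst (delta0 S q \<gamma>) \<alpha> = (\<lambda>p vs. 0) \<and> on_sections (snd (delta0 S q \<gamma>)) \<alpha> = (\<lambda>p vs. 0)}"

definition im_connection ::
    "('m::topological_space, 'a::real_vector, 'x) ym_scheme \<Rightarrow> ('m, 'a) im \<Rightarrow> bool" where
  "im_connection S c \<longleftrightarrow> im_form S 1 c \<and> (\<forall>p. \<forall>\<xi>\<in>ideal S p. snd c p \<xi> [] = \<xi>)"

definition curv0 ::
    "('m::topological_space, 'a::real_vector, 'x) ym_scheme \<Rightarrow> ('m, 'a) im
     \<Rightarrow> ('m \<Rightarrow> 'a) \<Rightarrow> ('m, 'a) form" where
  "curv0 S c \<alpha> = cov_d S (fst c) 1 (fst c \<alpha>)"

definition curv1 ::
    "('m, 'a::real_vector) im \<Rightarrow> ('m \<Rightarrow> 'a) \<Rightarrow> ('m, 'a) form" where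
  "curv1 c \<alpha> = fst c (\<lambda>p. \<alpha> p - snd c p (\<alpha> p) [])"

text \<open>
  \<open>delta0_curv S r c F\<close> states \<open>\<delta>\<^sup>0 F = r \<Omega>\<close> with \<open>\<Omega>\<close> the curvature of \<open>c\<close>. Pairs are compared on
  sections, which determine the bundle map in the second component.
\<close>

definition delta0_curv ::
    "('m::topological_space, 'a::real_vector, 'x) ym_scheme \<Rightarrow> real \<Rightarrow> ('m, 'a) im
     \<Rightarrow> ('m, 'a) form \<Rightarrow> bool" where
  "delta0_curv S r c F \<longleftrightarrow> (\<forall>\<alpha>\<in>sections S.
     fst (delta0 S 2 F) \<alpha> = (\<lambda>p vs. r *\<^sub>R curv0 S c \<alpha> p vs) \<and>
     on_sections (snd (delta0 S 2 F)) \<alpha> = (\<lambda>p vs. r *\<^sub>R curv1 c \<alpha> p vs))"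

definition conn_triples ::
    "('m::topological_space, 'a::real_vector, 'x) ym_scheme
     \<Rightarrow> (('m, 'a) im \<times> ('m, 'a) form) set" where
  "conn_triples S = {(c, F). im_connection S c \<and> F \<in> forms S 2 \<and> delta0_curv S 1 c F}"


section \<open>The action, criticality and adaptedness\<close>

definition ym_action ::
    "('m::topological_space, 'a::real_vector, 'x) ym_scheme \<Rightarrow> real \<Rightarrow> ('m, 'a) im
     \<Rightarrow> ('m, 'a) form \<Rightarrow> real" where
  "ym_action S \<mu> c F =
     (LINT p|vol_measure S. form_inner S 2 F F p) +
     \<mu> * (LINT p|vol_measure S. form_inner S 3 (cov_d S (fst c) 2 F) (cov_d S (fst c) 2 F) p)"

definition im_shift ::
    "('m, 'a::real_vector) im \<Rightarrow> real \<Rightarrow> ('m, 'a) im \<Rightarrow> ('m, 'a) im" where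
  "im_shift c r d = (\<lambda>\<alpha> p vs. fst c \<alpha> p vs + r *\<^sub>R fst d \<alpha> p vs,
                     \<lambda>p b vs. snd c p b vs + r *\<^sub>R snd d p b vs)"

definition longitudinally_critical ::
    "('m::topological_space, 'a::real_vector, 'x) ym_scheme \<Rightarrow> real \<Rightarrow> ('m, 'a) im
     \<Rightarrow> ('m, 'a) form \<Rightarrow> bool" where
  "longitudinally_critical S \<mu> c F \<longleftrightarrow> (\<forall>\<gamma>\<in>forms S 1.
     ((\<lambda>r. ym_action S \<mu> (im_shift c r (delta0 S 1 \<gamma>))
        (\<lambda>p vs. F p vs + r *\<^sub>R cov_d S (fst c) 1 \<gamma> p vs - (r\<^sup>2 / 2) *\<^sub>R form_bracket S \<gamma> p vs))
      has_real_derivative 0) (at 0))"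

definition transversally_critical ::
    "('m::topological_space, 'a::real_vector, 'x) ym_scheme \<Rightarrow> real \<Rightarrow> ('m, 'a) im
     \<Rightarrow> ('m, 'a) form \<Rightarrow> bool" where
  "transversally_critical S \<mu> c F \<longleftrightarrow> (\<forall>\<beta>\<in>invariant_forms S 2.
     ((\<lambda>r. ym_action S \<mu> c (\<lambda>p vs. F p vs + r *\<^sub>R \<beta> p vs)) has_real_derivative 0) (at 0))"

definition adapted ::
    "('m::topological_space, 'a::real_vector, 'x) ym_scheme \<Rightarrow> real \<Rightarrow> ('m, 'a) im
     \<Rightarrow> ('m, 'a) form \<Rightarrow> bool" where
  "adapted S \<mu> c F \<longleftrightarrow>
     delta0_curv S (- 1 / \<mu>) c (cov_delta S (fst c) 3 (cov_d S (fst c) 2 F))"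


section \<open>Gauge transformations\<close>

definition push_section :: "('m \<Rightarrow> 'a \<Rightarrow> 'a) \<Rightarrow> ('m \<Rightarrow> 'm) \<Rightarrow> ('m \<Rightarrow> 'a) \<Rightarrow> 'm \<Rightarrow> 'a" where
  "push_section \<phi> h \<alpha> = (\<lambda>p. \<phi> (inv_into UNIV h p) (\<alpha> (inv_into UNIV h p)))"

text \<open>
  \<open>\<phi> p\<close> is the restriction of the bundle map to the fibre over \<open>p\<close>, with values in the fibre over
  \<open>h p\<close>. Smoothness of the bundle map and of its inverse is expressed on local sections.
\<close>

definition algebroid_automorphism ::
    "('m::topological_space, 'a::real_vector, 'x) algebroid_scheme
     \<Rightarrow> ('m \<Rightarrow> 'a \<Rightarrow> 'a) \<Rightarrow> ('m \<Rightarrow> 'm) \<Rightarrow> bool" where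
  "algebroid_automorphism S \<phi> h \<longleftrightarrow> diffeomorphism S h \<and>
     (\<forall>p. bij_betw (\<phi> p) (fib S p) (fib S (h p)) \<and>
        (\<forall>a\<in>fib S p. \<forall>b\<in>fib S p. \<forall>r.
           \<phi> p (a + b) = \<phi> p a + \<phi> p b \<and> \<phi> p (r *\<^sub>R a) = r *\<^sub>R \<phi> p a \<and>
           anchor S (h p) (\<phi> p a) = differential h (anchor S p a))) \<and>
     (\<forall>U \<alpha>. open U \<and> (\<forall>p\<in>U. \<alpha> p \<in> fib S p) \<longrightarrow>
        (section_on S (h ` U) (push_section \<phi> h \<alpha>) \<longleftrightarrow> section_on S U \<alpha>)) \<and>
     (\<forall>\<alpha>\<in>sections S. \<forall>\<beta>\<in>sections S.
        push_section \<phi> h (bracket S \<alpha> \<beta>) = bracket S (push_section \<phi> h \<alpha>) (push_section \<phi> h \<beta>))"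

definition orientation_preserving_isometry ::
    "('m::topological_space, 'a::real_vector, 'x) ym_scheme \<Rightarrow> ('m \<Rightarrow> 'm) \<Rightarrow> bool" where
  "orientation_preserving_isometry S h \<longleftrightarrow> diffeomorphism S h \<and>
     (\<forall>p. \<forall>u\<in>tangent_space S p. \<forall>v\<in>tangent_space S p.
        gmet S (h p) (differential h u) (differential h v) = gmet S p u v) \<and>
     (\<forall>p. \<forall>e\<in>orient S p. map (differential h) e \<in> orient S (h p))"

text \<open>
  Compatibility of \<open>\<phi>\<close> with the fibrewise Lie brackets of \<open>\<kk>\<close> is contained in its compatibility
  with the bracket of sections of \<open>A\<close>.
\<close>

definition gauge_transformation ::
    "('m::topological_space, 'a::real_vector, 'x) ym_scheme
     \<Rightarrow> ('m \<Rightarrow> 'a \<Rightarrow> 'a) \<Rightarrow> ('m \<Rightarrow> 'm) \<Rightarrow> bool" where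
  "gauge_transformation S \<phi> h \<longleftrightarrow>
     algebroid_automorphism S \<phi> h \<and> orientation_preserving_isometry S h \<and>
     (\<forall>p. \<phi> p ` ideal S p = ideal S (h p) \<and>
        (\<forall>\<xi>\<in>ideal S p. \<forall>\<eta>\<in>ideal S p. kmet S (h p) (\<phi> p \<xi>) (\<phi> p \<eta>) = kmet S p \<xi> \<eta>))"

definition pull_at ::
    "('m::topological_space, 'a::real_vector, 'x) ym_scheme \<Rightarrow> ('m \<Rightarrow> 'a \<Rightarrow> 'a) \<Rightarrow> ('m \<Rightarrow> 'm)
     \<Rightarrow> 'm \<Rightarrow> ('m tan list \<Rightarrow> 'a) \<Rightarrow> 'm tan list \<Rightarrow> 'a" where
  "pull_at S \<phi> h p \<omega> vs = (if set vs \<subseteq> tangent_space S p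
     then the_inv_into (ideal S p) (\<phi> p) (\<omega> (map (differential h) vs)) else 0)"

definition pull_form ::
    "('m::topological_space, 'a::real_vector, 'x) ym_scheme \<Rightarrow> ('m \<Rightarrow> 'a \<Rightarrow> 'a) \<Rightarrow> ('m \<Rightarrow> 'm)
     \<Rightarrow> ('m, 'a) form \<Rightarrow> ('m, 'a) form" where
  "pull_form S \<phi> h \<gamma> = (\<lambda>p. pull_at S \<phi> h p (\<gamma> (h p)))"

definition pull_im ::
    "('m::topological_space, 'a::real_vector, 'x) ym_scheme \<Rightarrow> ('m \<Rightarrow> 'a \<Rightarrow> 'a) \<Rightarrow> ('m \<Rightarrow> 'm)
     \<Rightarrow> ('m, 'a) im \<Rightarrow> ('m, 'a) im" where
  "pull_im S \<phi> h c =
     (\<lambda>\<alpha>. pull_form S \<phi> h (fst c (push_section \<phi> h \<alpha>)),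
      \<lambda>p b. pull_at S \<phi> h p (snd c (h p) (\<phi> p b)))"

end

theory Submission
  imports Defs
begin

text \<open>
  A gauge transformation \<open>(\<phi>, h)\<close> is an automorphism of all the structure from which the action,
  criticality and adaptedness are built: the smooth structure, the algebroid, the ideal \<open>\<kk>\<close>, both
  metrics and the orientation. Everything defined from this structure is therefore natural, and
  the theorem is the sum of these naturality statements.

  Most of the operators are given by descriptions: \<open>d\<^sup>\<nabla>\<close>, the Lie derivative and \<open>[\<gamma>, \<gamma>]\<close> are \<^emph>\<open>the\<close>
  form with prescribed values on vector fields, \<open>\<star>\<close>, \<open>\<star>\<^sup>-\<^sup>1\<close>, the pointwise inner product and the
  volume are \<^emph>\<open>the\<close> objects with prescribed values on orthonormal bases or in charts. Instead of
  showing that these objects exist, one transports the describing conditions. Call \<open>\<gamma>'\<close> and \<open>\<gamma>\<close>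
  related (\<open>form_rel\<close>) if \<open>\<phi> (\<gamma>'(X, \<dots>)) = \<gamma> (dh X, \<dots>)\<close>. This relation is bi-unique and matches the
  \<open>q\<close>-forms with the \<open>q\<close>-forms. If two descriptions correspond under a bi-unique relation, then one is
  uniquely solvable if and only if the other is, and the described objects are related, default
  values included (\<open>the_or_transfer\<close>). Thus every operator respects the relation (\<open>cov_d_rel\<close>,
  \<open>lieA_rel\<close>, \<open>hodge_rel\<close>, \<open>cov_delta_rel\<close>), and equations between forms hold on one side if and only if
  they hold on the other (\<open>form_rel_eq_iff\<close>).

  Three points carry the rest. First, \<open>h\<close> acts on smooth functions, vectors and fields because the
  charts pulled back along \<open>h\<close> again belong to the maximal atlas (\<open>atlas_pullback\<close>). Second, the image
  of the volume measure under \<open>h\<close> solves the description of the volume measure (\<open>distr_vol\<close>), whence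
  the action of related data is the same (\<open>ym_action_natural\<close>). Third, the forms by which the data are
  varied are matched as well, and the varied data are related for every value of the parameter;
  so the functions whose derivatives define criticality coincide.
\<close>

section \<open>Iterated partial derivatives on open sets\<close>

lemma continuous_map_coordinate_line:
  assumes "y \<in> topspace (Rn n)" "i < n"
  shows "continuous_map euclideanreal (Rn n) (\<lambda>t. y(i := t))"
  using assms
  by (auto simp: continuous_map_componentwise PiE_def extensional_def)

lemma eventually_coordinate_line:
  assumes "openin (Rn n) O'" "y \<in> O'" "i < n"
  shows "\<forall>\<^sub>F t in nhds (y i). y(i := t) \<in> O'"
proof -
  have "y \<in> topspace (Rn n)" using assms openin_subset by blast
  then have "openin euclideanreal {t \<in> topspace euclideanreal. y(i := t) \<in> O'}"
    by (rule openin_continuous_map_preimage[OF continuous_map_coordinate_line[OF _ assms(3)] assms(1)])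
  then have "open {t. y(i := t) \<in> O'}" by simp
  then show ?thesis
    using assms(2) eventually_nhds_in_open[of "{t. y(i := t) \<in> O'}" "y i"] by simp
qed

lemma pderiv_at_cong:
  assumes "openin (Rn n) O'" "\<And>z. z \<in> O' \<Longrightarrow> f z = g z" "y \<in> O'" "i < n"
  shows "pderiv_at i f y = pderiv_at i g y"
  unfolding pderiv_at_def
proof (rule deriv_cong_ev)
  show "\<forall>\<^sub>F t in nhds (y i). f (y(i := t)) = g (y(i := t))"
    using eventually_coordinate_line[OF assms(1,3,4)] by eventually_elim (rule assms(2))
qed simp

text \<open>
  Partial derivatives see values next to the given point, hence agreement on \<open>W\<close> alone would not
  suffice for this congruence.
\<close>

lemma Ck_on_cong:
  assumes "openin (Rn n) O'" "W \<subseteq> O'" "\<And>z. z \<in> O' \<Longrightarrow> f z = g z" "Ck_on n k W f"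
  shows "Ck_on n k W g"
  using assms(3,4)
proof (induction k arbitrary: f g)
  case 0
  then show ?case
    using assms(2) by (auto intro!: continuous_map_eq[of _ _ f])
next
  case (Suc k)
  have "continuous_map (subtopology (Rn n) W) euclideanreal g"
    using assms(2) Suc.prems by (auto intro!: continuous_map_eq[of _ _ f])
  moreover have "(\<lambda>t. g (y(i := t))) field_differentiable (at (y i))" if iy: "i < n" "y \<in> W" for i y
  proof -
    have "\<forall>\<^sub>F t in nhds (y i). f (y(i := t)) = g (y(i := t))"
      using eventually_coordinate_line[OF assms(1) subsetD[OF assms(2) iy(2)] iy(1)]
      by eventually_elim (rule Suc.prems(1))
    note cong = DERIV_cong_ev[OF refl this refl]
    obtain D where "DERIV (\<lambda>t. f (y(i := t))) (y i) :> D"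
      using Suc.prems(2) iy unfolding Ck_on.simps field_differentiable_def by blast
    then have "DERIV (\<lambda>t. g (y(i := t))) (y i) :> D"
      by (simp only: cong)
    then show ?thesis
      unfolding field_differentiable_def ..
  qed
  moreover have "Ck_on n k W (pderiv_at i g)" if "i < n" for i
  proof (rule Suc.IH)
    show "pderiv_at i f z = pderiv_at i g z" if "z \<in> O'" for z
      using pderiv_at_cong[OF assms(1) Suc.prems(1) that \<open>i < n\<close>] .
    show "Ck_on n k W (pderiv_at i f)"
      using Suc.prems(2) \<open>i < n\<close> by simp
  qed
  ultimately show ?case by simp
qed

lemma smooth_on_cong:
  assumes "openin (Rn n) O'" "W \<subseteq> O'" "\<And>z. z \<in> O' \<Longrightarrow> f z = g z" "smooth_on n W f"
  shows "smooth_on n W g"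
  using assms Ck_on_cong unfolding smooth_on_def by metis

text \<open>
  This makes the sections and the forms into vector spaces, so that a varied curvature, and the
  difference of a section and its \<open>\<kk>\<close>-component, are again of their kind.
\<close>

lemma Ck_on_lincomb:
  assumes "openin (Rn n) W" "Ck_on n k W f" "Ck_on n k W g"
  shows "Ck_on n k W (\<lambda>z. a * f z + b * g z)"
  using assms(2,3)
proof (induction k arbitrary: f g)
  case 0
  then show ?case
    unfolding Ck_on.simps by (intro continuous_map_add continuous_map_real_mult_left)
next
  case (Suc k)
  have diff: "(\<lambda>t. a * f (y(i := t)) + b * g (y(i := t))) field_differentiable (at (y i))"
    if "i < n" "y \<in> W" for i y
    using Suc.prems that
    by (intro field_differentiable_add field_differentiable_mult field_differentiable_const) auto
  have "Ck_on n k W (pderiv_at i (\<lambda>z. a * f z + b * g z))" if "i < n" for i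
  proof (rule Ck_on_cong[OF assms(1) order_refl])
    show "Ck_on n k W (\<lambda>z. a * pderiv_at i f z + b * pderiv_at i g z)"
      using Suc that by auto
    fix z assume "z \<in> W"
    then have "(\<lambda>t. f (z(i := t))) field_differentiable (at (z i))"
      "(\<lambda>t. g (z(i := t))) field_differentiable (at (z i))"
      using Suc.prems that by auto
    then show "a * pderiv_at i f z + b * pderiv_at i g z =
        pderiv_at i (\<lambda>z. a * f z + b * g z) z"
      unfolding pderiv_at_def
      by (simp add: field_differentiable_add field_differentiable_mult field_differentiable_const)
  qed
  moreover have "continuous_map (subtopology (Rn n) W) euclideanreal (\<lambda>z. a * f z + b * g z)"
    using Suc.prems by (intro continuous_map_add continuous_map_real_mult_left) simp_all
  ultimately show ?case
    using diff by simp
qed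

lemma Ck_on_const: "Ck_on n k W (\<lambda>z. c)"
proof (induction k arbitrary: c)
  case (Suc k)
  have "pderiv_at i (\<lambda>z. c) = (\<lambda>z. 0)" for i
    by (simp add: pderiv_at_def fun_eq_iff)
  then show ?case using Suc by auto
qed auto

section \<open>Linear combinations of sections and of forms\<close>

lemma chart_image_openin:
  assumes "is_chart n (U, x)" "open W"
  shows "openin (Rn n) (x ` (W \<inter> U))"
proof -
  have "openin (top_of_set U) (W \<inter> U)" using assms by (auto simp: openin_subtopology)
  then have "openin (subtopology (Rn n) (x ` U)) (x ` (W \<inter> U))"
    using assms homeomorphic_map_openness_eq unfolding is_chart_def by fastforce
  then show ?thesis
    using assms openin_trans_full by (fastforce simp: is_chart_def)
qed

lemma chart_inj: "is_chart n (U, x) \<Longrightarrow> inj_on x U"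
  by (auto simp: is_chart_def homeomorphic_eq_everything_map)

lemma smooth_fun_lincomb:
  assumes "smooth_manifold S" "open U" "smooth_fun S U f" "smooth_fun S U g"
  shows "smooth_fun S U (\<lambda>p. a * f p + b * g p)"
proof -
  have "is_chart (mdim S) c" if "c \<in> atlas S" for c
    using assms(1) that by (auto simp: smooth_manifold_def)
  then show ?thesis
    using assms(2-4) chart_image_openin Ck_on_lincomb
    unfolding smooth_fun_def smooth_on_def by fast
qed

lemma smooth_fun_const: "smooth_fun S U (\<lambda>p. c)"
  by (auto simp: smooth_fun_def smooth_on_def Ck_on_const)

lemma fibre_basis_subspace: "fibre_basis E r b \<Longrightarrow> subspace E"
  by (auto simp: fibre_basis_def)

lemma fib_subspace:
  assumes "vector_bundle S"
  shows "subspace (fib S p)"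
proof -
  have "p \<in> (\<Union>(V, e)\<in>frames S. V)"
    using assms unfolding vector_bundle_def by simp
  then obtain V e where V: "(V, e) \<in> frames S" "p \<in> V"
    by auto
  have "fibre_basis (fib S p) (fib_rank S) (\<lambda>i. e i p)"
    using bspec[OF conjunct2[OF assms[unfolded vector_bundle_def]] V(1)] V(2) by simp
  then show ?thesis
    by (rule fibre_basis_subspace)
qed

lemma ideal_subspace:
  assumes "bundle_of_ideals S"
  shows "subspace (ideal S p)"
proof -
  obtain r where "\<forall>p. \<exists>U e. open U \<and> p \<in> U \<and> (\<forall>i<r. section_on S U (e i)) \<and>
        (\<forall>q\<in>U. fibre_basis (ideal S q) r (\<lambda>i. e i q))"
    using assms unfolding bundle_of_ideals_def by (elim conjE exE)
  then obtain U e where "p \<in> U" "\<forall>q\<in>U. fibre_basis (ideal S q) r (\<lambda>i. e i q)"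
    by meson
  then show ?thesis
    using fibre_basis_subspace[of "ideal S p" r "\<lambda>i. e i p"] by simp
qed

lemma section_lincomb:
  assumes "smooth_manifold S" "vector_bundle S" "s \<in> sections S" "t \<in> sections S"
  shows "(\<lambda>p. a *\<^sub>R s p + b *\<^sub>R t p) \<in> sections S"
  unfolding sections_def section_on_def mem_Collect_eq
proof (intro conjI ballI, goal_cases)
  case (1 p)
  then show ?case
    using assms(3,4) fib_subspace[OF assms(2), of p]
    unfolding sections_def section_on_def by (simp add: subspace_add subspace_scale)
next
  case (2 Ve)
  obtain V e where Ve: "Ve = (V, e)" by (cases Ve)
  obtain c where c: "\<forall>i<fib_rank S. smooth_fun S (UNIV \<inter> V) (c i)"
    "\<forall>p\<in>UNIV \<inter> V. s p = (\<Sum>i<fib_rank S. c i p *\<^sub>R e i p)"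
    using assms(3) 2 unfolding sections_def section_on_def Ve by blast
  obtain d where d: "\<forall>i<fib_rank S. smooth_fun S (UNIV \<inter> V) (d i)"
    "\<forall>p\<in>UNIV \<inter> V. t p = (\<Sum>i<fib_rank S. d i p *\<^sub>R e i p)"
    using assms(4) 2 unfolding sections_def section_on_def Ve by blast
  have "open (UNIV \<inter> V)" using assms(2) 2 by (auto simp: vector_bundle_def Ve)
  then have "smooth_fun S (UNIV \<inter> V) (\<lambda>p. a * c i p + b * d i p)" if "i < fib_rank S" for i
    using smooth_fun_lincomb[OF assms(1)] c(1) d(1) that by blast
  moreover have "a *\<^sub>R s p + b *\<^sub>R t p = (\<Sum>i<fib_rank S. (a * c i p + b * d i p) *\<^sub>R e i p)"
    if "p \<in> UNIV \<inter> V" for p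
    using that c(2) d(2) by (simp add: scaleR_sum_right sum.distrib scaleR_add_left)
  ultimately have "(\<forall>i<fib_rank S. smooth_fun S (UNIV \<inter> V) (\<lambda>p. a * c i p + b * d i p)) \<and>
      (\<forall>p\<in>UNIV \<inter> V. a *\<^sub>R s p + b *\<^sub>R t p = (\<Sum>i<fib_rank S. (a * c i p + b * d i p) *\<^sub>R e i p))"
    by simp
  then show ?case
    unfolding Ve prod.case by (rule exI[of _ "\<lambda>i p. a * c i p + b * d i p"])
qed

lemma zero_section:
  assumes "vector_bundle S"
  shows "(\<lambda>p. 0) \<in> sections S"
proof -
  have "\<exists>c. (\<forall>i<fib_rank S. smooth_fun S (UNIV \<inter> V) (c i)) \<and>
      (\<forall>p\<in>UNIV \<inter> V. 0 = (\<Sum>i<fib_rank S. c i p *\<^sub>R e i p))" for V and e :: "nat \<Rightarrow> 'a \<Rightarrow> 'b"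
    by (rule exI[of _ "\<lambda>i p. 0"]) (simp add: smooth_fun_const)
  then show ?thesis
    using subspace_0[OF fib_subspace[OF assms]]
    unfolding sections_def section_on_def mem_Collect_eq by blast
qed

lemma alt_formsD:
  assumes "g \<in> alt_forms S q p"
  shows alt_forms_off: "\<not> (length vs = q \<and> set vs \<subseteq> tangent_space S p) \<Longrightarrow> g vs = 0"
    and alt_forms_ideal: "length vs = q \<Longrightarrow> set vs \<subseteq> tangent_space S p \<Longrightarrow> g vs \<in> ideal S p"
    and alt_forms_add: "length vs = q \<Longrightarrow> set vs \<subseteq> tangent_space S p \<Longrightarrow> i < q \<Longrightarrow>
      u \<in> tangent_space S p \<Longrightarrow> g (vs[i := (\<lambda>f. (vs ! i) f + u f)]) = g vs + g (vs[i := u])"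
    and alt_forms_scale: "length vs = q \<Longrightarrow> set vs \<subseteq> tangent_space S p \<Longrightarrow> i < q \<Longrightarrow>
      g (vs[i := (\<lambda>f. r * (vs ! i) f)]) = r *\<^sub>R g vs"
    and alt_forms_alt: "length vs = q \<Longrightarrow> set vs \<subseteq> tangent_space S p \<Longrightarrow> i < q \<Longrightarrow> j < q \<Longrightarrow>
      i \<noteq> j \<Longrightarrow> vs ! i = vs ! j \<Longrightarrow> g vs = 0"
  using assms unfolding alt_forms_def mem_Collect_eq by simp_all

lemma alt_formsI:
  assumes "\<And>vs. \<not> (length vs = q \<and> set vs \<subseteq> tangent_space S p) \<Longrightarrow> g vs = 0"
    and "\<And>vs. length vs = q \<Longrightarrow> set vs \<subseteq> tangent_space S p \<Longrightarrow> g vs \<in> ideal S p"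
    and "\<And>vs i u. length vs = q \<Longrightarrow> set vs \<subseteq> tangent_space S p \<Longrightarrow> i < q \<Longrightarrow>
      u \<in> tangent_space S p \<Longrightarrow> g (vs[i := (\<lambda>f. (vs ! i) f + u f)]) = g vs + g (vs[i := u])"
    and "\<And>vs i r. length vs = q \<Longrightarrow> set vs \<subseteq> tangent_space S p \<Longrightarrow> i < q \<Longrightarrow>
      g (vs[i := (\<lambda>f. r * (vs ! i) f)]) = r *\<^sub>R g vs"
    and "\<And>vs i j. length vs = q \<Longrightarrow> set vs \<subseteq> tangent_space S p \<Longrightarrow> i < q \<Longrightarrow> j < q \<Longrightarrow>
      i \<noteq> j \<Longrightarrow> vs ! i = vs ! j \<Longrightarrow> g vs = 0"
  shows "g \<in> alt_forms S q p"
  using assms unfolding alt_forms_def mem_Collect_eq by simp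

lemma alt_forms_lincomb:
  assumes "subspace (ideal S p)" "g \<in> alt_forms S q p" "g' \<in> alt_forms S q p"
  shows "(\<lambda>vs. a *\<^sub>R g vs + b *\<^sub>R g' vs) \<in> alt_forms S q p"
proof -
  note D = alt_formsD[OF assms(2)] alt_formsD[OF assms(3)]
  show ?thesis
  proof (rule alt_formsI, goal_cases)
    case (2 vs)
    then show ?case
      using assms(1) D(2,7) by (simp add: subspace_add subspace_scale)
  next
    case (5 vs i j)
    then show ?case
      using D(5)[of vs i j] D(10)[of vs i j] by simp
  qed (simp_all add: D scaleR_add_right mult.commute)
qed

lemma k_section_lincomb:
  assumes "smooth_manifold S" "vector_bundle S" "bundle_of_ideals S"
    "s \<in> k_sections S" "t \<in> k_sections S"
  shows "(\<lambda>p. a *\<^sub>R s p + b *\<^sub>R t p) \<in> k_sections S"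
  using assms(4,5) section_lincomb[OF assms(1,2)] ideal_subspace[OF assms(3)]
  unfolding k_sections_def by (simp add: subspace_add subspace_scale)

lemma form_lincomb:
  assumes "smooth_manifold S" "vector_bundle S" "bundle_of_ideals S"
    "\<gamma> \<in> forms S q" "\<eta> \<in> forms S q"
  shows "(\<lambda>p vs. a *\<^sub>R \<gamma> p vs + b *\<^sub>R \<eta> p vs) \<in> forms S q"
  using assms(4,5) k_section_lincomb[OF assms(1-3)]
    alt_forms_lincomb[OF ideal_subspace[OF assms(3)]]
  unfolding forms_def eval_form_def by simp

lemma zero_form:
  assumes "vector_bundle S" "bundle_of_ideals S"
  shows "(\<lambda>p vs. 0) \<in> forms S q"
  using zero_section[OF assms(1)] subspace_0[OF ideal_subspace[OF assms(2)]]
  by (simp add: forms_def alt_forms_def eval_form_def k_sections_def)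

section \<open>Unique descriptions\<close>

text \<open>Any property of the default value and of all described objects holds for the described value.\<close>

lemma the_or_cases:
  assumes "R d" "\<And>x. P x \<Longrightarrow> R x"
  shows "R (the_or d P)"
  using assms theI'[of P] by (auto simp: the_or_def)

text \<open>
  A relation that matches the solutions of two descriptions one to one matches the objects
  described, be they solutions or default values: unique solvability of the two is equivalent.
\<close>

lemma the_or_transfer:
  assumes uniq_left: "\<And>x' y' x. R x' x \<Longrightarrow> R y' x \<Longrightarrow> x' = y'"
    and uniq_right: "\<And>x' x y. R x' x \<Longrightarrow> R x' y \<Longrightarrow> x = y"
    and default: "R d' d"
    and left: "\<And>x'. P' x' \<Longrightarrow> \<exists>x. R x' x \<and> P x"
    and right: "\<And>x. P x \<Longrightarrow> \<exists>x'. R x' x \<and> P' x'"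
  shows "R (the_or d' P') (the_or d P)"
proof (cases "\<exists>!x. P x")
  case True
  then obtain x where x: "P x" "\<And>y. P y \<Longrightarrow> y = x" by auto
  obtain x' where x': "R x' x" "P' x'" using right x by blast
  have uniq': "y' = x'" if "P' y'" for y'
    using left[OF that] x x' uniq_left by metis
  then have True': "\<exists>!x'. P' x'" using x' by blast
  have "the_or d P = x" "the_or d' P' = x'"
    using the1_equality[OF True x(1)] the1_equality[OF True' x'(2)] True True'
    by (simp_all add: the_or_def)
  then show ?thesis using x'(1) by simp
next
  case False
  have "\<not> (\<exists>!x'. P' x')"
  proof
    assume "\<exists>!x'. P' x'"
    then obtain x' where x': "P' x'" "\<And>y. P' y \<Longrightarrow> y = x'" by auto
    obtain x where "R x' x" "P x" using left x' by blast
    then show False using False right x' uniq_right by metis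
  qed
  then show ?thesis using False default by (simp add: the_or_def)
qed

section \<open>Diffeomorphisms\<close>

lemma manifold_chart: "smooth_manifold S \<Longrightarrow> c \<in> atlas S \<Longrightarrow> is_chart (mdim S) c"
  unfolding smooth_manifold_def by (elim conjE bspec)

lemma diffeomorphism_bij: "diffeomorphism S h \<Longrightarrow> bij h"
  unfolding diffeomorphism_def homeomorphism_def
  by (metis UNIV_I bij_def injI)

lemma diffeomorphism_continuous:
  assumes "diffeomorphism S h"
  shows "continuous_on UNIV h" "continuous_on UNIV (inv_into UNIV h)"
  using assms by (auto simp: diffeomorphism_def homeomorphism_def)

lemma diffeomorphism_homeo:
  assumes "diffeomorphism S h"
  shows "homeomorphic_map euclidean euclidean h"
proof -
  have "homeomorphic_maps euclidean euclidean h (inv_into UNIV h)"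
    unfolding homeomorphic_maps_def
    using diffeomorphism_continuous[OF assms] diffeomorphism_bij[OF assms]
    by (simp add: bij_is_inj bij_is_surj surj_f_inv_f)
  then show ?thesis
    by (simp add: homeomorphic_maps_map)
qed

lemma diffeomorphism_inv:
  assumes "diffeomorphism S h"
  shows "diffeomorphism S (inv_into UNIV h)"
  using assms inv_inv_eq[OF diffeomorphism_bij[OF assms]]
  unfolding diffeomorphism_def by (simp add: homeomorphism_symD)

lemma inv_into_pullback_chart:
  assumes "bij h" "inj_on x U" "z \<in> x ` U"
  shows "inv_into (h -` U) (x \<circ> h) z = inv_into UNIV h (inv_into U x z)"
proof -
  obtain u where u: "u \<in> U" "z = x u" using assms(3) by blast
  have "inj_on (x \<circ> h) (h -` U)"
    using bij_is_inj[OF assms(1)] assms(2) by (intro comp_inj_on) (auto simp: inj_on_def)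
  then have "inv_into (h -` U) (x \<circ> h) z = inv_into UNIV h u"
    using u assms(1) by (intro inv_into_f_eq) (simp_all add: bij_is_surj surj_f_inv_f)
  then show ?thesis using u assms(2) by simp
qed

text \<open>
  The transition maps between a pulled back chart and a chart of the atlas are the coordinate
  expressions of \<open>h\<close> and of its inverse, so the pulled back chart belongs to the maximal atlas.
  Consequently \<open>f \<circ> h\<close> and \<open>f\<close> have the same coordinate expressions in corresponding charts, and
  smoothness of one is smoothness of the other.
\<close>

lemma atlas_pullback:
  assumes S: "smooth_manifold S" and h: "diffeomorphism S h" and c: "(U, x) \<in> atlas S"
  shows "(h -` U, x \<circ> h) \<in> atlas S"
proof -
  have bij: "bij h" and cont: "continuous_on UNIV h"
    using h by (auto intro: diffeomorphism_bij diffeomorphism_continuous)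
  have img: "(x \<circ> h) ` (h -` U) = x ` U"
    by (simp only: image_comp[symmetric] surj_image_vimage_eq[OF bij_is_surj[OF bij]])
  have chart: "is_chart (mdim S) d" if "d \<in> atlas S" for d
    by (rule manifold_chart[OF S that])
  have trans: "smooth_on (mdim S) (y ` (V \<inter> k -` W)) (\<lambda>z. w (k (inv_into V y z)) i)"
    if "k = h \<or> k = inv_into UNIV h" "(V, y) \<in> atlas S" "(W, w) \<in> atlas S" "i < mdim S" for k V y W w i
  proof -
    have "k \<in> {h, inv_into UNIV h}" using that(1) by simp
    from bspec[OF conjunct2[OF h[unfolded diffeomorphism_def]] this]
    have "\<forall>(U, x)\<in>atlas S. \<forall>(V, y)\<in>atlas S. \<forall>i<mdim S.
        smooth_on (mdim S) (x ` (U \<inter> k -` V)) (\<lambda>z. y (k (inv_into U x z)) i)" .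
    from bspec[OF this that(2)]
    have "\<forall>(W, w)\<in>atlas S. \<forall>i<mdim S.
        smooth_on (mdim S) (y ` (V \<inter> k -` W)) (\<lambda>z. w (k (inv_into V y z)) i)"
      by (simp only: case_prod_conv)
    from bspec[OF this that(3)] show ?thesis using that(4) by simp
  qed
  have "homeomorphic_map (top_of_set (h -` U)) (top_of_set U) h"
  proof (rule homeomorphic_map_subtopologies[OF diffeomorphism_homeo[OF h]])
    show "h ` (topspace euclidean \<inter> h -` U) = topspace euclidean \<inter> U"
      using bij by (simp add: surj_image_vimage_eq bij_is_surj)
  qed
  then have "homeomorphic_map (top_of_set (h -` U)) (subtopology (Rn (mdim S)) (x ` U)) (x \<circ> h)"
    using homeomorphic_map_compose[of _ _ h _ x] chart[OF c] unfolding is_chart_def prod.case by simp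
  then have "is_chart (mdim S) (h -` U, x \<circ> h)"
    using chart[OF c] img open_vimage[OF _ cont, of U] unfolding is_chart_def prod.case by simp
  moreover have "smooth_transition (mdim S) (h -` U, x \<circ> h) d" if "d \<in> atlas S" for d
  proof -
    obtain V y where d: "d = (V, y)" by (cases d)
    have dom: "(x \<circ> h) ` (h -` U \<inter> V) = x ` (U \<inter> inv_into UNIV h -` V)"
      using bij by (force simp: bij_is_surj surj_f_inv_f bij_is_inj inv_f_f image_iff)
    have agree: "y (inv_into UNIV h (inv_into U x z)) i = y (inv_into (h -` U) (x \<circ> h) z) i"
      if z: "z \<in> x ` U" for z i
      using inv_into_pullback_chart[OF bij chart_inj[OF chart[OF c]] z] by simp
    have "openin (Rn (mdim S)) (x ` U)"
      using chart[OF c] by (simp add: is_chart_def)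
    moreover have "smooth_on (mdim S) (x ` (U \<inter> inv_into UNIV h -` V))
        (\<lambda>z. y (inv_into UNIV h (inv_into U x z)) i)" if "i < mdim S" for i
      using trans[OF _ c _ that] \<open>d \<in> atlas S\<close> by (simp add: d)
    ultimately have "smooth_on (mdim S) (x ` (U \<inter> inv_into UNIV h -` V))
        (\<lambda>z. y (inv_into (h -` U) (x \<circ> h) z) i)" if "i < mdim S" for i
      using smooth_on_cong[of "mdim S" "x ` U" "x ` (U \<inter> inv_into UNIV h -` V)"] agree that
      by (meson image_mono Int_lower1)
    then show ?thesis
      unfolding d smooth_transition_def prod.case dom by simp
  qed
  moreover have "smooth_transition (mdim S) d (h -` U, x \<circ> h)" if "d \<in> atlas S" for d
    using trans[of h _ _ U x] c that by (cases d) (simp add: smooth_transition_def)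
  ultimately show ?thesis
    using conjunct2[OF conjunct2[OF conjunct2[OF S[unfolded smooth_manifold_def]]]] by simp
qed

lemma smooth_fun_pullback:
  assumes S: "smooth_manifold S" and h: "diffeomorphism S h" and f: "smooth_fun S U f"
  shows "smooth_fun S (h -` U) (f \<circ> h)"
  unfolding smooth_fun_def
proof (safe)
  fix V y assume c: "(V, y) \<in> atlas S"
  define k where "k = inv_into UNIV h"
  have bij: "bij h" using h by (rule diffeomorphism_bij)
  have kh: "k (h p) = p" "h (k p) = p" for p
    using bij by (simp_all add: k_def bij_is_inj bij_is_surj surj_f_inv_f)
  have chart: "is_chart (mdim S) (V, y)"
    by (rule manifold_chart[OF S c])
  have "(k -` V, y \<circ> k) \<in> atlas S"
    using atlas_pullback[OF S diffeomorphism_inv[OF h] c] by (simp add: k_def)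
  then have smooth: "smooth_on (mdim S) ((y \<circ> k) ` (U \<inter> k -` V)) (\<lambda>z. f (inv_into (k -` V) (y \<circ> k) z))"
    using bspec[OF f[unfolded smooth_fun_def]] by fastforce
  have dom: "(y \<circ> k) ` (U \<inter> k -` V) = y ` (h -` U \<inter> V)"
    by (force simp: image_iff kh)
  have agree: "f (inv_into (k -` V) (y \<circ> k) z) = (f \<circ> h) (inv_into V y z)" if z: "z \<in> y ` V" for z
    using inv_into_pullback_chart[of k, OF _ chart_inj[OF chart] z]
      bij_imp_bij_inv[OF bij] inv_inv_eq[OF bij] by (simp add: k_def)
  show "smooth_on (mdim S) (y ` (h -` U \<inter> V)) (\<lambda>z. (f \<circ> h) (inv_into V y z))"
  proof (rule smooth_on_cong[OF _ _ agree smooth[unfolded dom]])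
    show "openin (Rn (mdim S)) (y ` V)" using chart by (simp add: is_chart_def)
    show "y ` (h -` U \<inter> V) \<subseteq> y ` V" by (rule image_mono) simp
  qed
qed

lemma diffeomorphism_apply_inv:
  assumes "diffeomorphism S h"
  shows "h (inv_into UNIV h p) = p" "inv_into UNIV h (h p) = p"
    "h \<circ> inv_into UNIV h = id" "inv_into UNIV h \<circ> h = id"
  using diffeomorphism_bij[OF assms]
  by (simp_all add: bij_is_inj bij_is_surj surj_f_inv_f surj_iff[symmetric])

lemma smooth_fun_comp_iff:
  assumes S: "smooth_manifold S" and h: "diffeomorphism S h"
  shows "smooth_fun S (h -` U) (f \<circ> h) \<longleftrightarrow> smooth_fun S U f"
proof
  assume "smooth_fun S (h -` U) (f \<circ> h)"
  then have "smooth_fun S (inv_into UNIV h -` h -` U) ((f \<circ> h) \<circ> inv_into UNIV h)"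
    by (rule smooth_fun_pullback[OF S diffeomorphism_inv[OF h]])
  moreover have "inv_into UNIV h -` h -` U = U"
    by (simp only: vimage_comp diffeomorphism_apply_inv(3)[OF h] vimage_id id_apply)
  moreover have "(f \<circ> h) \<circ> inv_into UNIV h = f"
    by (simp only: comp_assoc diffeomorphism_apply_inv(3)[OF h] comp_id)
  ultimately show "smooth_fun S U f"
    by (simp only:)
qed (rule smooth_fun_pullback[OF S h])

lemma smooth_near_comp_iff:
  assumes S: "smooth_manifold S" and h: "diffeomorphism S h"
  shows "smooth_near S p (f \<circ> h) \<longleftrightarrow> smooth_near S (h p) f"
proof
  assume "smooth_near S p (f \<circ> h)"
  then obtain U where U: "open U" "p \<in> U" "smooth_fun S U (f \<circ> h)"
    unfolding smooth_near_def by blast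
  define V where "V = inv_into UNIV h -` U"
  have V: "h -` V = U"
    by (simp only: V_def vimage_comp diffeomorphism_apply_inv(4)[OF h] vimage_id id_apply)
  have "open V"
    unfolding V_def by (rule open_vimage[OF U(1) diffeomorphism_continuous(2)[OF h]])
  moreover have "smooth_fun S V f"
    using U(3) smooth_fun_comp_iff[OF S h, of V f] by (simp add: V)
  ultimately show "smooth_near S (h p) f"
    using U(2) V unfolding smooth_near_def by blast
next
  assume "smooth_near S (h p) f"
  then obtain U where U: "open U" "h p \<in> U" "smooth_fun S U f"
    unfolding smooth_near_def by blast
  have "open (h -` U)" by (rule open_vimage[OF U(1) diffeomorphism_continuous(1)[OF h]])
  then show "smooth_near S p (f \<circ> h)"
    using U smooth_fun_pullback[OF S h U(3)] unfolding smooth_near_def by blast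
qed

lemma differential_inverse:
  assumes "diffeomorphism S h"
  shows "differential h (differential (inv_into UNIV h) v) = v"
    "differential (inv_into UNIV h) (differential h v) = v"
  using diffeomorphism_apply_inv(3,4)[OF assms] by (simp_all add: differential_def comp_assoc)

lemma differential_inj:
  assumes "diffeomorphism S h"
  shows "differential h v = differential h w \<longleftrightarrow> v = w"
  using differential_inverse(2)[OF assms] by metis

lemma differential_tangent:
  assumes S: "smooth_manifold S" and h: "diffeomorphism S h" and v: "v \<in> tangent_space S p"
  shows "differential h v \<in> tangent_space S (h p)"
  unfolding tangent_space_def mem_Collect_eq differential_def
proof (intro conjI allI impI, goal_cases)
  case (1 f)
  then have "\<not> smooth_near S p (f \<circ> h)" by (simp add: smooth_near_comp_iff[OF S h])
  then show ?case using v unfolding tangent_space_def by simp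
next
  case (2 f g)
  then obtain U where U: "open U" "h p \<in> U" "\<forall>q\<in>U. f q = g q" by blast
  have "open (h -` U) \<and> p \<in> h -` U \<and> (\<forall>q\<in>h -` U. (f \<circ> h) q = (g \<circ> h) q)"
    using U open_vimage[OF U(1) diffeomorphism_continuous(1)[OF h]] by simp
  then show ?case using v unfolding tangent_space_def mem_Collect_eq by blast
next
  case (3 f g)
  then have "smooth_near S p (f \<circ> h)" "smooth_near S p (g \<circ> h)"
    by (simp_all add: smooth_near_comp_iff[OF S h])
  then have "v (\<lambda>q. (f \<circ> h) q + (g \<circ> h) q) = v (f \<circ> h) + v (g \<circ> h)"
    using v unfolding tangent_space_def mem_Collect_eq by blast
  then show ?case by (simp add: comp_def)
next
  case (4 f g r)
  then have "smooth_near S p (f \<circ> h)" "smooth_near S p (g \<circ> h)"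
    by (simp_all add: smooth_near_comp_iff[OF S h])
  then have "v (\<lambda>q. r * (f \<circ> h) q) = r * v (f \<circ> h)"
    using v unfolding tangent_space_def mem_Collect_eq by blast
  then show ?case by (simp add: comp_def)
next
  case (5 f g)
  then have "smooth_near S p (f \<circ> h)" "smooth_near S p (g \<circ> h)"
    by (simp_all add: smooth_near_comp_iff[OF S h])
  then have "v (\<lambda>q. (f \<circ> h) q * (g \<circ> h) q) = (f \<circ> h) p * v (g \<circ> h) + v (f \<circ> h) * (g \<circ> h) p"
    using v unfolding tangent_space_def mem_Collect_eq by blast
  then show ?case by (simp add: comp_def)
qed

lemma differential_tangent_iff:
  assumes S: "smooth_manifold S" and h: "diffeomorphism S h"
  shows "differential h v \<in> tangent_space S (h p) \<longleftrightarrow> v \<in> tangent_space S p"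
proof
  assume "differential h v \<in> tangent_space S (h p)"
  from differential_tangent[OF S diffeomorphism_inv[OF h] this]
  show "v \<in> tangent_space S p"
    by (simp add: differential_inverse[OF h] diffeomorphism_apply_inv[OF h])
qed (rule differential_tangent[OF S h])

definition push_field :: "('m \<Rightarrow> 'm) \<Rightarrow> ('m \<Rightarrow> 'm tan) \<Rightarrow> 'm \<Rightarrow> 'm tan" where
  "push_field h X = (\<lambda>p. differential h (X (inv_into UNIV h p)))"

lemma push_field_at: "diffeomorphism S h \<Longrightarrow> push_field h X (h p) = differential h (X p)"
  by (simp add: push_field_def diffeomorphism_apply_inv)

lemma push_field_inverse:
  assumes "diffeomorphism S h"
  shows "push_field h (push_field (inv_into UNIV h) X) = X"
  by (simp add: push_field_def differential_inverse[OF assms] diffeomorphism_apply_inv[OF assms]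
      inv_inv_eq[OF diffeomorphism_bij[OF assms]])

lemma vector_field_push:
  assumes S: "smooth_manifold S" and h: "diffeomorphism S h" and X: "vector_field S X"
  shows "vector_field S (push_field h X)"
  unfolding vector_field_def
proof (intro conjI allI impI)
  fix p
  have "X (inv_into UNIV h p) \<in> tangent_space S (inv_into UNIV h p)"
    using X by (simp add: vector_field_def)
  from differential_tangent[OF S h this] show "push_field h X p \<in> tangent_space S p"
    by (simp add: push_field_def diffeomorphism_apply_inv[OF h])
next
  fix U f assume U: "open U \<and> smooth_fun S U f"
  then have "open (h -` U)" "smooth_fun S (h -` U) (f \<circ> h)"
    using open_vimage[OF _ diffeomorphism_continuous(1)[OF h]] smooth_fun_pullback[OF S h]
    by blast+
  then have "smooth_fun S (h -` U) (\<lambda>p. X p (f \<circ> h))"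
    using X unfolding vector_field_def by blast
  then have "smooth_fun S (h -` U) ((\<lambda>p. push_field h X p f) \<circ> h)"
    by (simp add: comp_def push_field_at[OF h] differential_def)
  then show "smooth_fun S U (\<lambda>p. push_field h X p f)"
    by (simp only: smooth_fun_comp_iff[OF S h])
qed

lemma field_lists_push:
  assumes S: "smooth_manifold S" and h: "diffeomorphism S h" and "Xs \<in> field_lists S q"
  shows "map (push_field h) Xs \<in> field_lists S q"
  using assms(3) vector_field_push[OF S h] by (auto simp: field_lists_def)

lemma field_lists_surj:
  assumes S: "smooth_manifold S" and h: "diffeomorphism S h" and Y: "Ys \<in> field_lists S q"
  obtains Xs where "Xs \<in> field_lists S q" "Ys = map (push_field h) Xs"
proof
  show "map (push_field (inv_into UNIV h)) Ys \<in> field_lists S q"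
    by (rule field_lists_push[OF S diffeomorphism_inv[OF h] Y])
  show "Ys = map (push_field h) (map (push_field (inv_into UNIV h)) Ys)"
    by (simp add: comp_def push_field_inverse[OF h])
qed

text \<open>
  An identity of functionals at every point, valid for arbitrary assignments of functionals
  to the points: \<open>(h\<^sub>* X) f = X (f \<circ> h)\<close> moves \<open>h\<close> through both terms of the commutator.
\<close>

lemma vf_bracket_push:
  assumes S: "smooth_manifold S" and h: "diffeomorphism S h"
  shows "vf_bracket S (push_field h X) (push_field h Y) = push_field h (vf_bracket S X Y)"
proof (intro ext)
  fix p f
  define p' where "p' = inv_into UNIV h p"
  have p: "p = h p'" by (simp add: p'_def diffeomorphism_apply_inv[OF h])
  have "(\<lambda>q. push_field h Z q f) \<circ> h = (\<lambda>q. Z q (f \<circ> h))" for Z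
    by (simp add: comp_def push_field_at[OF h] differential_def)
  then show "vf_bracket S (push_field h X) (push_field h Y) p f = push_field h (vf_bracket S X Y) p f"
    unfolding p push_field_at[OF h]
    by (simp add: vf_bracket_def push_field_at[OF h] differential_def smooth_near_comp_iff[OF S h])
qed

lemma tan_comb_differential:
  "length e = n \<Longrightarrow> tan_comb n c (map (differential h) e) = differential h (tan_comb n c e)"
  by (simp add: tan_comb_def differential_def)

lemma tangent_basis_differential:
  assumes S: "smooth_manifold S" and h: "diffeomorphism S h"
  shows "tangent_basis S (h p) (map (differential h) e) \<longleftrightarrow> tangent_basis S p e"
proof (cases "length e = mdim S")
  case True
  have zero: "differential h v = (\<lambda>f. 0) \<longleftrightarrow> v = (\<lambda>f. 0)" for v
    using differential_inj[OF h, of v "\<lambda>f. 0"] by (simp add: differential_def)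
  have sub: "set (map (differential h) e) \<subseteq> tangent_space S (h p) \<longleftrightarrow> set e \<subseteq> tangent_space S p"
    using differential_tangent_iff[OF S h] by auto
  have "(\<forall>w\<in>tangent_space S (h p). \<exists>c. w = differential h (tan_comb (mdim S) c e)) \<longleftrightarrow>
      (\<forall>v\<in>tangent_space S p. \<exists>c. v = tan_comb (mdim S) c e)" (is "?L \<longleftrightarrow> ?R")
  proof
    assume ?L
    then show ?R
      using differential_tangent[OF S h] differential_inj[OF h] by metis
  next
    assume ?R
    then show ?L
      using differential_tangent_iff[OF S h] differential_inverse(1)[OF h] by metis
  qed
  then show ?thesis
    unfolding tangent_basis_def tan_comb_differential[OF True] zero sub
    using True by simp
qed (simp add: tangent_basis_def)

section \<open>Gauge transformations as symmetries\<close>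

locale gauge =
  fixes S :: "('m::{t2_space, second_countable_topology}, 'a::real_vector) ym"
    and \<phi> :: "'m \<Rightarrow> 'a \<Rightarrow> 'a"
    and h :: "'m \<Rightarrow> 'm"
  assumes algebroid: "lie_algebroid S"
    and ideals: "bundle_of_ideals S"
    and data: "yang_mills_data S"
    and gauge: "gauge_transformation S \<phi> h"
begin

abbreviation inverse_map :: "'m \<Rightarrow> 'm" where
  "inverse_map \<equiv> inv_into UNIV h"

abbreviation push :: "('m \<Rightarrow> 'a) \<Rightarrow> 'm \<Rightarrow> 'a" where
  "push \<equiv> push_section \<phi> h"

lemma manifold: "smooth_manifold S" and vbundle: "vector_bundle S"
  using algebroid by (simp_all add: lie_algebroid_def)

lemma automorphism: "algebroid_automorphism S \<phi> h"
  and isometry: "orientation_preserving_isometry S h"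
  using gauge by (simp_all add: gauge_transformation_def)

lemma diffeo: "diffeomorphism S h"
  using isometry by (simp add: orientation_preserving_isometry_def)

lemmas h_inv [simp] = diffeomorphism_apply_inv(1,2)[OF diffeo]
lemmas dh_inverse [simp] = differential_inverse[OF diffeo]
lemmas dh_inj = differential_inj[OF diffeo]
lemmas dh_tangent [simp] = differential_tangent_iff[OF manifold diffeo]
lemmas push_field_h [simp] = push_field_at[OF diffeo]

lemma image_dh_tangent [simp]:
  "differential h ` A \<subseteq> tangent_space S (h p) \<longleftrightarrow> A \<subseteq> tangent_space S p"
  by auto

lemma map_dh_inverse [simp]: "map (differential h) (map (differential inverse_map) vs) = vs"
  by (simp add: comp_def)

lemma fib_sub: "subspace (fib S p)" and ideal_sub: "subspace (ideal S p)"
  by (rule fib_subspace[OF vbundle], rule ideal_subspace[OF ideals])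

lemma ideal_fib: "\<xi> \<in> ideal S p \<Longrightarrow> \<xi> \<in> fib S p"
  using ideals unfolding bundle_of_ideals_def by blast

lemma phi_bij: "bij_betw (\<phi> p) (fib S p) (fib S (h p))"
  using automorphism unfolding algebroid_automorphism_def by (elim conjE allE)

lemma phi_linear:
  assumes "a \<in> fib S p" "b \<in> fib S p"
  shows "\<phi> p (a + b) = \<phi> p a + \<phi> p b"
    and "\<phi> p (r *\<^sub>R a) = r *\<^sub>R \<phi> p a"
    and "anchor S (h p) (\<phi> p a) = differential h (anchor S p a)"
proof -
  have "\<forall>p. bij_betw (\<phi> p) (fib S p) (fib S (h p)) \<and>
        (\<forall>a\<in>fib S p. \<forall>b\<in>fib S p. \<forall>r.
           \<phi> p (a + b) = \<phi> p a + \<phi> p b \<and> \<phi> p (r *\<^sub>R a) = r *\<^sub>R \<phi> p a \<and>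
           anchor S (h p) (\<phi> p a) = differential h (anchor S p a))"
    using automorphism unfolding algebroid_automorphism_def by (elim conjE)
  then have "\<forall>a\<in>fib S p. \<forall>b\<in>fib S p. \<forall>r.
           \<phi> p (a + b) = \<phi> p a + \<phi> p b \<and> \<phi> p (r *\<^sub>R a) = r *\<^sub>R \<phi> p a \<and>
           anchor S (h p) (\<phi> p a) = differential h (anchor S p a)"
    by (elim allE conjE)
  from bspec[OF bspec[OF this assms(1)] assms(2)]
  show "\<phi> p (a + b) = \<phi> p a + \<phi> p b" "\<phi> p (r *\<^sub>R a) = r *\<^sub>R \<phi> p a"
    "anchor S (h p) (\<phi> p a) = differential h (anchor S p a)"
    by simp_all
qed

lemmas phi_add = phi_linear(1)

lemma phi_scale: "a \<in> fib S p \<Longrightarrow> \<phi> p (r *\<^sub>R a) = r *\<^sub>R \<phi> p a"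
  and phi_anchor: "a \<in> fib S p \<Longrightarrow> anchor S (h p) (\<phi> p a) = differential h (anchor S p a)"
  using phi_linear(2,3) by blast+

lemma phi_fib: "a \<in> fib S p \<Longrightarrow> \<phi> p a \<in> fib S (h p)"
  using phi_bij by (rule bij_betwE[THEN bspec])

lemma phi_inj: "a \<in> fib S p \<Longrightarrow> b \<in> fib S p \<Longrightarrow> \<phi> p a = \<phi> p b \<longleftrightarrow> a = b"
  using bij_betw_imp_inj_on[OF phi_bij] by (rule inj_on_eq_iff)

lemma phi_0 [simp]: "\<phi> p 0 = 0"
  using phi_scale[of 0 p 0] subspace_0[OF fib_sub] by simp

lemma phi_ideal_image: "\<phi> p ` ideal S p = ideal S (h p)"
  using gauge unfolding gauge_transformation_def by (elim conjE allE)

lemma phi_ideal: "\<xi> \<in> ideal S p \<Longrightarrow> \<phi> p \<xi> \<in> ideal S (h p)"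
  using phi_ideal_image by blast

lemma phi_ideal_inj: "inj_on (\<phi> p) (ideal S p)"
  using phi_inj ideal_fib by (simp add: inj_on_def)

lemma phi_kmet:
  assumes "\<xi> \<in> ideal S p" "\<eta> \<in> ideal S p"
  shows "kmet S (h p) (\<phi> p \<xi>) (\<phi> p \<eta>) = kmet S p \<xi> \<eta>"
proof -
  have "\<forall>p. \<phi> p ` ideal S p = ideal S (h p) \<and>
        (\<forall>\<xi>\<in>ideal S p. \<forall>\<eta>\<in>ideal S p. kmet S (h p) (\<phi> p \<xi>) (\<phi> p \<eta>) = kmet S p \<xi> \<eta>)"
    using gauge unfolding gauge_transformation_def by (elim conjE)
  then show ?thesis using assms by simp
qed

lemma phi_sum:
  assumes "\<And>i. i \<in> I \<Longrightarrow> x i \<in> fib S p"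
  shows "\<phi> p (\<Sum>i\<in>I. x i) = (\<Sum>i\<in>I. \<phi> p (x i))"
  using assms
proof (induction I rule: infinite_finite_induct)
  case (insert i I)
  then have "(\<Sum>i\<in>I. x i) \<in> fib S p"
    by (intro subspace_sum[OF fib_sub]) simp
  then show ?case using insert by (simp add: phi_add)
qed simp_all

lemma phi_minus:
  assumes "a \<in> fib S p" "b \<in> fib S p"
  shows "\<phi> p (a - b) = \<phi> p a - \<phi> p b"
  using phi_add[of "a - b" p b] subspace_diff[OF fib_sub assms] assms by simp

lemma push_h [simp]: "push \<alpha> (h p) = \<phi> p (\<alpha> p)"
  by (simp add: push_section_def)

lemma push_eqI:
  assumes "\<And>p. \<phi> p (\<alpha> p) = \<beta> (h p)"
  shows "push \<alpha> = \<beta>"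
proof
  fix p
  show "push \<alpha> p = \<beta> p" using assms[of "inverse_map p"] by (simp add: push_section_def)
qed

lemma push_inj:
  assumes "\<And>p. \<alpha> p \<in> fib S p" "\<And>p. \<beta> p \<in> fib S p"
  shows "push \<alpha> = push \<beta> \<longleftrightarrow> \<alpha> = \<beta>"
proof
  assume "push \<alpha> = push \<beta>"
  then have "\<phi> p (\<alpha> p) = \<phi> p (\<beta> p)" for p using push_h by metis
  then show "\<alpha> = \<beta>" using phi_inj assms by blast
qed simp

lemma section_fib: "\<alpha> \<in> sections S \<Longrightarrow> \<alpha> p \<in> fib S p"
  by (simp add: sections_def section_on_def)

lemma k_section_ideal: "\<alpha> \<in> k_sections S \<Longrightarrow> \<alpha> p \<in> ideal S p"
  by (simp add: k_sections_def)

lemma k_section_section: "\<alpha> \<in> k_sections S \<Longrightarrow> \<alpha> \<in> sections S"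
  by (simp add: k_sections_def)

lemma push_sections_iff:
  assumes "\<And>p. \<alpha> p \<in> fib S p"
  shows "push \<alpha> \<in> sections S \<longleftrightarrow> \<alpha> \<in> sections S"
proof -
  have "\<forall>U \<alpha>. open U \<and> (\<forall>p\<in>U. \<alpha> p \<in> fib S p) \<longrightarrow>
        (section_on S (h ` U) (push \<alpha>) \<longleftrightarrow> section_on S U \<alpha>)"
    using automorphism unfolding algebroid_automorphism_def by (elim conjE)
  from this[THEN spec, of UNIV, THEN spec, of \<alpha>] show ?thesis
    using assms bij_is_surj[OF diffeomorphism_bij[OF diffeo]] by (simp add: sections_def)
qed

lemma push_section_closed: "\<alpha> \<in> sections S \<Longrightarrow> push \<alpha> \<in> sections S"
  using push_sections_iff section_fib by blast

lemma push_sections_surj: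
  assumes "\<beta> \<in> sections S"
  obtains \<alpha> where "\<alpha> \<in> sections S" "\<beta> = push \<alpha>"
proof -
  define \<alpha> where "\<alpha> = (\<lambda>p. the_inv_into (fib S p) (\<phi> p) (\<beta> (h p)))"
  have \<alpha>: "\<alpha> p \<in> fib S p" "\<phi> p (\<alpha> p) = \<beta> (h p)" for p
    unfolding \<alpha>_def
    using bij_betw_the_inv_into[OF phi_bij, THEN bij_betwE] section_fib[OF assms]
      f_the_inv_into_f_bij_betw[OF phi_bij] by blast+
  have "push \<alpha> = \<beta>" by (rule push_eqI) (rule \<alpha>(2))
  then show ?thesis using that[of \<alpha>] push_sections_iff[of \<alpha>] \<alpha>(1) assms by simp
qed

lemma push_k_sections_iff:
  assumes "\<And>p. \<alpha> p \<in> ideal S p"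
  shows "push \<alpha> \<in> k_sections S \<longleftrightarrow> \<alpha> \<in> k_sections S"
proof -
  have "push \<alpha> p \<in> ideal S p" for p
    using phi_ideal[OF assms, of "inverse_map p"] by (simp add: push_section_def)
  then show ?thesis
    using push_sections_iff[of \<alpha>] ideal_fib[OF assms] assms by (simp add: k_sections_def)
qed

lemma push_bracket:
  assumes "\<alpha> \<in> sections S" "\<beta> \<in> sections S"
  shows "push (bracket S \<alpha> \<beta>) = bracket S (push \<alpha>) (push \<beta>)"
proof -
  have "\<forall>\<alpha>\<in>sections S. \<forall>\<beta>\<in>sections S.
        push (bracket S \<alpha> \<beta>) = bracket S (push \<alpha>) (push \<beta>)"
    using automorphism unfolding algebroid_automorphism_def by (elim conjE)
  then show ?thesis using assms by simp
qed

lemma bracket_section: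
  assumes "\<alpha> \<in> sections S" "\<beta> \<in> sections S"
  shows "bracket S \<alpha> \<beta> \<in> sections S"
proof -
  note axioms = algebroid[unfolded lie_algebroid_def, THEN conjunct2, THEN conjunct2,
      THEN conjunct2, THEN conjunct2]
  from bspec[OF bspec[OF bspec[OF axioms assms(1)] assms(2)] assms(1)] show ?thesis
    by (rule conjunct1)
qed

lemma push_anchored:
  assumes "\<alpha> \<in> sections S"
  shows "push_field h (anchored S \<alpha>) = anchored S (push \<alpha>)"
proof
  fix p
  have "anchor S (h (inverse_map p)) (\<phi> (inverse_map p) (\<alpha> (inverse_map p))) =
      differential h (anchor S (inverse_map p) (\<alpha> (inverse_map p)))"
    by (rule phi_anchor[OF section_fib[OF assms]])
  then show "push_field h (anchored S \<alpha>) p = anchored S (push \<alpha>) p"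
    by (simp add: push_field_def anchored_def push_section_def)
qed

section \<open>Related forms\<close>

text \<open>
  The relation of \<open>\<phi>\<^sup>*\<gamma>\<close> to \<open>\<gamma>\<close>, written as a condition on both forms so that properties can be
  carried over in either direction. All lists \<open>vs\<close> are admitted because the differential of \<open>h\<close> acts
  bijectively on arbitrary functionals and maps exactly the tangent vectors to tangent vectors;
  thus \<open>\<gamma>'\<close> determines \<open>\<gamma>\<close>.
\<close>

definition point_rel :: "'m \<Rightarrow> ('m tan list \<Rightarrow> 'a) \<Rightarrow> ('m tan list \<Rightarrow> 'a) \<Rightarrow> bool" where
  "point_rel p g' g \<longleftrightarrow> (\<forall>vs. g' vs \<in> ideal S p \<and> \<phi> p (g' vs) = g (map (differential h) vs))"

definition form_rel :: "('m, 'a) form \<Rightarrow> ('m, 'a) form \<Rightarrow> bool" where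
  "form_rel \<gamma>' \<gamma> \<longleftrightarrow> (\<forall>p. point_rel p (\<gamma>' p) (\<gamma> (h p)))"

lemma form_rel_ideal: "form_rel \<gamma>' \<gamma> \<Longrightarrow> \<gamma>' p vs \<in> ideal S p"
  and form_rel_apply: "form_rel \<gamma>' \<gamma> \<Longrightarrow> \<phi> p (\<gamma>' p vs) = \<gamma> (h p) (map (differential h) vs)"
  by (simp_all add: form_rel_def point_rel_def)

lemma form_relI:
  assumes "\<And>p vs. \<gamma>' p vs \<in> ideal S p"
    and "\<And>p vs. \<phi> p (\<gamma>' p vs) = \<gamma> (h p) (map (differential h) vs)"
  shows "form_rel \<gamma>' \<gamma>"
  using assms by (simp add: form_rel_def point_rel_def)

lemma form_rel_unique_left:
  assumes "form_rel \<gamma>' \<gamma>" "form_rel \<eta>' \<gamma>"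
  shows "\<gamma>' = \<eta>'"
proof (intro ext)
  fix p vs
  have "\<phi> p (\<gamma>' p vs) = \<phi> p (\<eta>' p vs)"
    using assms by (simp add: form_rel_apply)
  then show "\<gamma>' p vs = \<eta>' p vs"
    using phi_inj form_rel_ideal[THEN ideal_fib] assms by blast
qed

lemma form_rel_unique_right:
  assumes "form_rel \<gamma>' \<gamma>" "form_rel \<gamma>' \<eta>"
  shows "\<gamma> = \<eta>"
proof (intro ext)
  fix p vs
  have "\<gamma> (h (inverse_map p)) (map (differential h) (map (differential inverse_map) vs)) =
      \<eta> (h (inverse_map p)) (map (differential h) (map (differential inverse_map) vs))"
    using form_rel_apply[OF assms(1)] form_rel_apply[OF assms(2)] by metis
  then show "\<gamma> p vs = \<eta> p vs"
    unfolding map_dh_inverse by simp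
qed

lemma form_rel_eq_iff:
  assumes "form_rel \<gamma>' \<gamma>" "form_rel \<eta>' \<eta>"
  shows "\<gamma>' = \<eta>' \<longleftrightarrow> \<gamma> = \<eta>"
  using assms form_rel_unique_left form_rel_unique_right by blast

lemma form_rel_zero: "form_rel (\<lambda>p vs. 0) (\<lambda>p vs. 0)"
  by (rule form_relI) (simp_all add: subspace_0[OF ideal_sub])

text \<open>
  The coefficients are functions on \<open>M\<close>, transported by \<open>h\<close>, since the Leibniz rule for IM forms
  multiplies by functions.
\<close>

lemma form_rel_lincomb:
  assumes "form_rel \<gamma>' \<gamma>" "form_rel \<eta>' \<eta>"
  shows "form_rel (\<lambda>p vs. a p *\<^sub>R \<gamma>' p vs + b p *\<^sub>R \<eta>' p vs)
    (\<lambda>p vs. a (inverse_map p) *\<^sub>R \<gamma> p vs + b (inverse_map p) *\<^sub>R \<eta> p vs)"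
proof (rule form_relI)
  fix p vs
  have I: "\<gamma>' p vs \<in> ideal S p" "\<eta>' p vs \<in> ideal S p"
    using assms by (simp_all add: form_rel_ideal)
  then show J: "a p *\<^sub>R \<gamma>' p vs + b p *\<^sub>R \<eta>' p vs \<in> ideal S p"
    by (intro subspace_add subspace_scale ideal_sub)
  have "\<phi> p (a p *\<^sub>R \<gamma>' p vs + b p *\<^sub>R \<eta>' p vs) = a p *\<^sub>R \<phi> p (\<gamma>' p vs) + b p *\<^sub>R \<phi> p (\<eta>' p vs)"
    using I subspace_scale[OF fib_sub] ideal_fib by (simp add: phi_add phi_scale)
  then show "\<phi> p (a p *\<^sub>R \<gamma>' p vs + b p *\<^sub>R \<eta>' p vs) =
      a (inverse_map (h p)) *\<^sub>R \<gamma> (h p) (map (differential h) vs) +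
      b (inverse_map (h p)) *\<^sub>R \<eta> (h p) (map (differential h) vs)"
    using assms by (simp add: form_rel_apply)
qed

lemma form_rel_add:
  assumes "form_rel \<gamma>' \<gamma>" "form_rel \<eta>' \<eta>"
  shows "form_rel (\<lambda>p vs. \<gamma>' p vs + \<eta>' p vs) (\<lambda>p vs. \<gamma> p vs + \<eta> p vs)"
  using form_rel_lincomb[OF assms, of "\<lambda>p. 1" "\<lambda>p. 1"] by simp

lemma form_rel_diff:
  assumes "form_rel \<gamma>' \<gamma>" "form_rel \<eta>' \<eta>"
  shows "form_rel (\<lambda>p vs. \<gamma>' p vs - \<eta>' p vs) (\<lambda>p vs. \<gamma> p vs - \<eta> p vs)"
  using form_rel_lincomb[OF assms, of "\<lambda>p. 1" "\<lambda>p. - 1"] by simp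

lemma form_rel_scale:
  assumes "form_rel \<gamma>' \<gamma>"
  shows "form_rel (\<lambda>p vs. r *\<^sub>R \<gamma>' p vs) (\<lambda>p vs. r *\<^sub>R \<gamma> p vs)"
  using form_rel_lincomb[OF assms assms, of "\<lambda>p. r" "\<lambda>p. 0"] by simp

lemma form_rel_minus:
  assumes "form_rel \<gamma>' \<gamma>"
  shows "form_rel (\<lambda>p vs. - \<gamma>' p vs) (\<lambda>p vs. - \<gamma> p vs)"
  using form_rel_scale[OF assms, of "- 1"] by simp

lemma dh_lincomb:
  "differential h (\<lambda>f. v f + u f) = (\<lambda>f. differential h v f + differential h u f)"
  "differential h (\<lambda>f. r * v f) = (\<lambda>f. r * differential h v f)"
  by (simp_all add: differential_def)

lemma point_rel_alt_forms:
  assumes rel: "point_rel p g' g"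
  shows "g' \<in> alt_forms S q p \<longleftrightarrow> g \<in> alt_forms S q (h p)"
proof
  have g': "g' vs \<in> ideal S p" and eq: "g (map (differential h) vs) = \<phi> p (g' vs)" for vs
    using rel by (simp_all add: point_rel_def)
  note fib = ideal_fib[OF g']
  {
    assume g: "g \<in> alt_forms S q (h p)"
    show "g' \<in> alt_forms S q p"
    proof (rule alt_formsI, goal_cases)
      case (1 vs)
      then have "g (map (differential h) vs) = 0"
        using alt_forms_off[OF g, of "map (differential h) vs"] by simp
      then show ?case
        using phi_inj[OF fib subspace_0[OF fib_sub]] by (simp add: eq)
    next
      case (2 vs)
      show ?case by (rule g')
    next
      case (3 vs i u)
      then have "g ((map (differential h) vs)[i := (\<lambda>f. (map (differential h) vs ! i) f + differential h u f)])
          = g (map (differential h) vs) + g ((map (differential h) vs)[i := differential h u])"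
        by (intro alt_forms_add[OF g]) simp_all
      then have "g (map (differential h) (vs[i := (\<lambda>f. (vs ! i) f + u f)])) =
          g (map (differential h) vs) + g (map (differential h) (vs[i := u]))"
        using 3 by (simp add: map_update dh_lincomb)
      then have "\<phi> p (g' (vs[i := (\<lambda>f. (vs ! i) f + u f)])) = \<phi> p (g' vs + g' (vs[i := u]))"
        unfolding eq by (simp add: phi_add fib)
      then show ?case
        using phi_inj[OF fib subspace_add[OF fib_sub fib fib]] by simp
    next
      case (4 vs i r)
      then have "g ((map (differential h) vs)[i := (\<lambda>f. r * (map (differential h) vs ! i) f)])
          = r *\<^sub>R g (map (differential h) vs)"
        by (intro alt_forms_scale[OF g]) simp_all
      then have "g (map (differential h) (vs[i := (\<lambda>f. r * (vs ! i) f)])) =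
          r *\<^sub>R g (map (differential h) vs)"
        using 4 by (simp add: map_update dh_lincomb)
      then have "\<phi> p (g' (vs[i := (\<lambda>f. r * (vs ! i) f)])) = \<phi> p (r *\<^sub>R g' vs)"
        unfolding eq by (simp add: phi_scale[OF fib])
      then show ?case
        using phi_inj[OF fib subspace_scale[OF fib_sub fib]] by simp
    next
      case (5 vs i j)
      then have "g (map (differential h) vs) = 0"
        using alt_forms_alt[OF g, of "map (differential h) vs" i j] by simp
      then show ?case
        using phi_inj[OF fib subspace_0[OF fib_sub]] by (simp add: eq)
    qed
  }
  {
    assume g: "g' \<in> alt_forms S q p"
    have lift: "\<exists>ws. vs = map (differential h) ws" for vs
      using map_dh_inverse by metis
    show "g \<in> alt_forms S q (h p)"
    proof (rule alt_formsI, goal_cases)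
      case (1 vs)
      obtain ws where ws: "vs = map (differential h) ws" using lift by blast
      show ?case
        using 1 alt_forms_off[OF g, of ws] unfolding ws by (simp add: eq)
    next
      case (2 vs)
      obtain ws where ws: "vs = map (differential h) ws" using lift by blast
      show ?case unfolding ws eq by (rule phi_ideal[OF g'])
    next
      case (3 vs i u)
      obtain ws where ws: "vs = map (differential h) ws" using lift by blast
      obtain w where w: "u = differential h w" using dh_inverse(1) by metis
      have "g' (ws[i := (\<lambda>f. (ws ! i) f + w f)]) = g' ws + g' (ws[i := w])"
        using 3 unfolding ws w by (intro alt_forms_add[OF g]) (simp_all)
      then have "g (map (differential h) (ws[i := (\<lambda>f. (ws ! i) f + w f)])) =
          g (map (differential h) ws) + g (map (differential h) (ws[i := w]))"
        unfolding eq by (simp add: phi_add fib)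
      then show ?case
        using 3 by (simp add: ws w map_update dh_lincomb)
    next
      case (4 vs i r)
      obtain ws where ws: "vs = map (differential h) ws" using lift by blast
      have "g' (ws[i := (\<lambda>f. r * (ws ! i) f)]) = r *\<^sub>R g' ws"
        using 4 unfolding ws by (intro alt_forms_scale[OF g]) (simp_all)
      then have "g (map (differential h) (ws[i := (\<lambda>f. r * (ws ! i) f)])) =
          r *\<^sub>R g (map (differential h) ws)"
        unfolding eq by (simp add: phi_scale[OF fib])
      then show ?case
        using 4 by (simp add: ws map_update dh_lincomb)
    next
      case (5 vs i j)
      obtain ws where ws: "vs = map (differential h) ws" using lift by blast
      have "g' ws = 0"
        using 5 unfolding ws
        by (intro alt_forms_alt[OF g, of ws i j]) (simp_all add: dh_inj)
      then show ?case unfolding ws eq by simp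
    qed
  }
qed

lemma eval_form_push:
  assumes "form_rel \<gamma>' \<gamma>"
  shows "eval_form \<gamma> (map (push_field h) Xs) = push (eval_form \<gamma>' Xs)"
  by (rule push_eqI[symmetric]) (simp add: eval_form_def form_rel_apply[OF assms] comp_def)

lemma form_rel_forms:
  assumes rel: "form_rel \<gamma>' \<gamma>"
  shows "\<gamma>' \<in> forms S q \<longleftrightarrow> \<gamma> \<in> forms S q"
proof -
  have "\<gamma>' p \<in> alt_forms S q p \<longleftrightarrow> \<gamma> (h p) \<in> alt_forms S q (h p)" for p
    using rel point_rel_alt_forms by (simp add: form_rel_def)
  then have alt: "(\<forall>p. \<gamma>' p \<in> alt_forms S q p) \<longleftrightarrow> (\<forall>p. \<gamma> p \<in> alt_forms S q p)"
    by (metis h_inv(1))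
  have "eval_form \<gamma>' Xs \<in> k_sections S \<longleftrightarrow> eval_form \<gamma> (map (push_field h) Xs) \<in> k_sections S" for Xs
    unfolding eval_form_push[OF rel]
    by (rule push_k_sections_iff[symmetric]) (simp add: eval_form_def form_rel_ideal[OF rel])
  then have "(\<forall>Xs\<in>field_lists S q. eval_form \<gamma>' Xs \<in> k_sections S) \<longleftrightarrow>
      (\<forall>Xs\<in>field_lists S q. eval_form \<gamma> Xs \<in> k_sections S)"
    using field_lists_push[OF manifold diffeo] field_lists_surj[OF manifold diffeo] by metis
  with alt show ?thesis by (simp add: forms_def)
qed

lemma alt_form_value: "g \<in> alt_forms S q p \<Longrightarrow> g vs \<in> ideal S p"
  using alt_forms_ideal alt_forms_off subspace_0[OF ideal_sub] by metis

lemma pull_at_rel: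
  assumes "g \<in> alt_forms S q (h p)"
  shows "point_rel p (pull_at S \<phi> h p g) g"
  unfolding point_rel_def
proof (intro allI)
  fix vs
  show "pull_at S \<phi> h p g vs \<in> ideal S p \<and> \<phi> p (pull_at S \<phi> h p g vs) = g (map (differential h) vs)"
  proof (cases "set vs \<subseteq> tangent_space S p")
    case True
    have "g (map (differential h) vs) \<in> \<phi> p ` ideal S p"
      using alt_form_value[OF assms] phi_ideal_image by simp
    then show ?thesis
      using True f_the_inv_into_f[OF phi_ideal_inj] the_inv_into_into[OF phi_ideal_inj _ subset_refl]
      by (simp add: pull_at_def)
  next
    case False
    then show ?thesis
      using alt_forms_off[OF assms, of "map (differential h) vs"] subspace_0[OF ideal_sub]
      by (simp add: pull_at_def)
  qed
qed

lemma pull_form_rel: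
  assumes "\<gamma> \<in> forms S q"
  shows "form_rel (pull_form S \<phi> h \<gamma>) \<gamma>"
  unfolding form_rel_def pull_form_def
  using assms by (intro allI pull_at_rel[of _ q]) (simp add: forms_def)

lemma form_rel_surj:
  assumes "\<gamma>' \<in> forms S q"
  obtains \<gamma> where "\<gamma> \<in> forms S q" "form_rel \<gamma>' \<gamma>"
proof -
  define \<gamma> where
    "\<gamma> = (\<lambda>p vs. \<phi> (inverse_map p) (\<gamma>' (inverse_map p) (map (differential inverse_map) vs)))"
  have "form_rel \<gamma>' \<gamma>"
  proof (rule form_relI)
    show "\<gamma>' p vs \<in> ideal S p" for p vs
      using assms by (intro alt_form_value[of _ q]) (simp add: forms_def)
  qed (simp add: \<gamma>_def comp_def)
  then show ?thesis using that form_rel_forms assms by blast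
qed

text \<open>
  The transfer of descriptions for forms. Membership in \<open>forms S q\<close> provides each solution with a
  partner; that the partner is a solution is the equivalence of the two conditions.
\<close>

lemma form_rel_the_or:
  assumes eq: "\<And>\<gamma>' \<gamma>. form_rel \<gamma>' \<gamma> \<Longrightarrow> \<gamma> \<in> forms S q \<Longrightarrow> P' \<gamma>' \<longleftrightarrow> P \<gamma>"
    and "\<And>\<gamma>'. P' \<gamma>' \<Longrightarrow> \<gamma>' \<in> forms S q" "\<And>\<gamma>. P \<gamma> \<Longrightarrow> \<gamma> \<in> forms S q"
  shows "form_rel (the_or (\<lambda>p vs. 0) P') (the_or (\<lambda>p vs. 0) P)"
proof (rule the_or_transfer[of form_rel, OF form_rel_unique_left form_rel_unique_right form_rel_zero])
  fix \<gamma>'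
  assume P': "P' \<gamma>'"
  obtain \<gamma> where \<gamma>: "\<gamma> \<in> forms S q" "form_rel \<gamma>' \<gamma>"
    using form_rel_surj[OF assms(2)[OF P']] .
  then have "P \<gamma>" using P' by (simp only: eq)
  then show "\<exists>\<gamma>. form_rel \<gamma>' \<gamma> \<and> P \<gamma>" using \<gamma>(2) by (intro exI conjI)
next
  fix \<gamma>
  assume P: "P \<gamma>"
  then have \<gamma>: "\<gamma> \<in> forms S q" by (rule assms(3))
  then have "P' (pull_form S \<phi> h \<gamma>)"
    using P eq[OF pull_form_rel[OF \<gamma>]] by (simp only:)
  then show "\<exists>\<gamma>'. form_rel \<gamma>' \<gamma> \<and> P' \<gamma>'"
    using pull_form_rel[OF \<gamma>] by (intro exI[of _ "pull_form S \<phi> h \<gamma>"] conjI)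
qed

section \<open>Naturality of the operators on forms\<close>

lemma form_of_fields_forms: "form_of_fields S q \<Phi> \<in> forms S q"
  unfolding form_of_fields_def
  by (rule the_or_cases[where R = "\<lambda>\<eta>. \<eta> \<in> forms S q"]) (simp_all add: zero_form[OF vbundle ideals])

text \<open>
  Values on vector fields are transported along the bijection \<open>X \<mapsto> h\<^sub>* X\<close> of vector fields. The
  values \<open>\<Phi>'\<close> have to lie in \<open>\<kk>\<close>, because \<open>\<phi>\<close> is injective only on the fibres.
\<close>

lemma form_of_fields_rel:
  assumes ideal: "\<And>Xs p. Xs \<in> field_lists S q \<Longrightarrow> \<Phi>' Xs p \<in> ideal S p"
    and rel: "\<And>Xs p. Xs \<in> field_lists S q \<Longrightarrow> \<phi> p (\<Phi>' Xs p) = \<Phi> (map (push_field h) Xs) (h p)"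
  shows "form_rel (form_of_fields S q \<Phi>') (form_of_fields S q \<Phi>)"
  unfolding form_of_fields_def
proof (rule form_rel_the_or[of q])
  fix \<gamma>' \<gamma>
  assume r: "form_rel \<gamma>' \<gamma>"
  have eq: "eval_form \<gamma>' Xs = \<Phi>' Xs \<longleftrightarrow>
      eval_form \<gamma> (map (push_field h) Xs) = \<Phi> (map (push_field h) Xs)"
    if Xs: "Xs \<in> field_lists S q" for Xs
  proof -
    have "push (\<Phi>' Xs) = \<Phi> (map (push_field h) Xs)"
      by (rule push_eqI) (rule rel[OF Xs])
    moreover have "push (eval_form \<gamma>' Xs) = push (\<Phi>' Xs) \<longleftrightarrow> eval_form \<gamma>' Xs = \<Phi>' Xs"
      by (rule push_inj) (simp_all add: eval_form_def form_rel_ideal[OF r] ideal[OF Xs] ideal_fib)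
    ultimately show ?thesis by (simp only: eval_form_push[OF r])
  qed
  have "(\<forall>Xs\<in>field_lists S q. eval_form \<gamma>' Xs = \<Phi>' Xs) \<longleftrightarrow>
      (\<forall>Xs\<in>field_lists S q. eval_form \<gamma> Xs = \<Phi> Xs)" (is "?L \<longleftrightarrow> ?R")
  proof
    assume ?L
    show ?R
    proof
      fix Ys assume "Ys \<in> field_lists S q"
      then obtain Xs where Xs: "Xs \<in> field_lists S q" "Ys = map (push_field h) Xs"
        by (rule field_lists_surj[OF manifold diffeo])
      then show "eval_form \<gamma> Ys = \<Phi> Ys" using eq[OF Xs(1)] \<open>?L\<close> by simp
    qed
  next
    assume ?R
    then show ?L using eq field_lists_push[OF manifold diffeo] by simp
  qed
  then show "\<gamma>' \<in> forms S q \<and> (\<forall>Xs\<in>field_lists S q. eval_form \<gamma>' Xs = \<Phi>' Xs) \<longleftrightarrow>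
      \<gamma> \<in> forms S q \<and> (\<forall>Xs\<in>field_lists S q. eval_form \<gamma> Xs = \<Phi> Xs)"
    using form_rel_forms[OF r, of q] by simp
qed simp_all

lemma eval_form_k_section:
  "\<gamma> \<in> forms S q \<Longrightarrow> Xs \<in> field_lists S q \<Longrightarrow> eval_form \<gamma> Xs \<in> k_sections S"
  by (simp add: forms_def)

lemma bracket_k_section:
  assumes "\<alpha> \<in> sections S" "\<xi> \<in> k_sections S"
  shows "bracket S \<alpha> \<xi> \<in> k_sections S"
  using ideals assms unfolding bundle_of_ideals_def by blast

lemma sum_ideal: "(\<And>i. i \<in> I \<Longrightarrow> x i \<in> ideal S p) \<Longrightarrow> (\<Sum>i\<in>I. x i) \<in> ideal S p"
  by (rule subspace_sum[OF ideal_sub])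

lemma scale_ideal: "x \<in> ideal S p \<Longrightarrow> r *\<^sub>R x \<in> ideal S p"
  by (rule subspace_scale[OF ideal_sub])

lemma lieA_rel:
  assumes \<alpha>: "\<alpha> \<in> sections S" and rel: "form_rel \<gamma>' \<gamma>" and \<gamma>: "\<gamma> \<in> forms S q"
  shows "form_rel (lieA S q \<alpha> \<gamma>') (lieA S q (push \<alpha>) \<gamma>)"
  unfolding lieA_def anchored_def[symmetric]
proof (rule form_of_fields_rel)
  fix Xs p
  assume Xs: "Xs \<in> field_lists S q"
  have \<gamma>': "\<gamma>' \<in> forms S q" using form_rel_forms[OF rel] \<gamma> by simp
  define shifted where "shifted = (\<lambda>j. Xs[j := vf_bracket S (anchored S \<alpha>) (Xs ! j)])"
  have val: "eval_form \<gamma>' Ys p \<in> ideal S p" for Ys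
    by (simp add: eval_form_def form_rel_ideal[OF rel])
  have \<xi>: "eval_form \<gamma>' Xs \<in> k_sections S" by (rule eval_form_k_section[OF \<gamma>' Xs])
  have B: "bracket S \<alpha> (eval_form \<gamma>' Xs) p \<in> ideal S p"
    by (rule k_section_ideal[OF bracket_k_section[OF \<alpha> \<xi>]])
  have sum: "(\<Sum>j<q. eval_form \<gamma>' (shifted j) p) \<in> ideal S p"
    by (rule sum_ideal) (rule val)
  show "bracket S \<alpha> (eval_form \<gamma>' Xs) p -
      (\<Sum>j<q. eval_form \<gamma>' (Xs[j := vf_bracket S (anchored S \<alpha>) (Xs ! j)]) p) \<in> ideal S p"
    using subspace_diff[OF ideal_sub B sum] by (simp add: shifted_def)
  have shifted_push: "map (push_field h) (shifted j) = (map (push_field h) Xs)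
      [j := vf_bracket S (anchored S (push \<alpha>)) (map (push_field h) Xs ! j)]" if "j < q" for j
    using that Xs
    by (simp add: shifted_def map_update field_lists_def vf_bracket_push[OF manifold diffeo]
        push_anchored[OF \<alpha>, symmetric])
  have "\<phi> p (bracket S \<alpha> (eval_form \<gamma>' Xs) p) =
      bracket S (push \<alpha>) (eval_form \<gamma> (map (push_field h) Xs)) (h p)"
    unfolding eval_form_push[OF rel] push_bracket[OF \<alpha> k_section_section[OF \<xi>], symmetric] by simp
  moreover have "\<phi> p (\<Sum>j<q. eval_form \<gamma>' (shifted j) p) =
      (\<Sum>j<q. eval_form \<gamma> (map (push_field h) (shifted j)) (h p))"
    by (simp add: phi_sum ideal_fib val eval_form_push[OF rel])
  ultimately have "\<phi> p (bracket S \<alpha> (eval_form \<gamma>' Xs) p -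
      (\<Sum>j<q. eval_form \<gamma>' (shifted j) p)) =
      bracket S (push \<alpha>) (eval_form \<gamma> (map (push_field h) Xs)) (h p) -
      (\<Sum>j<q. eval_form \<gamma> ((map (push_field h) Xs)
        [j := vf_bracket S (anchored S (push \<alpha>)) (map (push_field h) Xs ! j)]) (h p))"
    using phi_minus[OF ideal_fib[OF B] ideal_fib[OF sum]]
    by (simp add: shifted_push)
  then show "\<phi> p (bracket S \<alpha> (eval_form \<gamma>' Xs) p -
      (\<Sum>j<q. eval_form \<gamma>' (Xs[j := vf_bracket S (anchored S \<alpha>) (Xs ! j)]) p)) =
      bracket S (push \<alpha>) (eval_form \<gamma> (map (push_field h) Xs)) (h p) -
      (\<Sum>j<q. eval_form \<gamma> ((map (push_field h) Xs)
        [j := vf_bracket S (anchored S (push \<alpha>)) (map (push_field h) Xs ! j)]) (h p))"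
    by (simp only: shifted_def)
qed

text \<open>
  A connection enters the covariant derivatives only through its values on sections, and only
  these are related: the Lie derivative along \<open>\<alpha>\<close>, by which a connection is varied, is natural for
  sections \<open>\<alpha>\<close>, where \<open>\<phi>\<close> is compatible with the bracket.
\<close>

definition conn_rel :: "(('m \<Rightarrow> 'a) \<Rightarrow> ('m, 'a) form) \<Rightarrow> (('m \<Rightarrow> 'a) \<Rightarrow> ('m, 'a) form) \<Rightarrow> bool" where
  "conn_rel C' C \<longleftrightarrow> (\<forall>\<alpha>\<in>sections S. form_rel (C' \<alpha>) (C (push \<alpha>)))"

lemma map_omit: "map f (omit i xs) = omit i (map f xs)"
  by (simp add: omit_def take_map drop_map)

lemma omit_field_lists:
  assumes "Xs \<in> field_lists S (Suc q)" "i < Suc q"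
  shows "omit i Xs \<in> field_lists S q"
  using assms set_take_subset[of i Xs] set_drop_subset[of "Suc i" Xs]
  by (auto simp: field_lists_def omit_def)

text \<open>
  The relation is applied to each term of the Koszul formula. Evaluating \<open>C'\<close> there is legitimate
  because a \<open>q\<close>-form takes vector fields to sections of \<open>\<kk>\<close>.
\<close>

lemma cov_d_rel:
  assumes C: "conn_rel C' C" and rel: "form_rel \<gamma>' \<gamma>" and \<gamma>: "\<gamma> \<in> forms S q"
  shows "form_rel (cov_d S C' q \<gamma>') (cov_d S C q \<gamma>)"
  unfolding cov_d_def
proof (rule form_of_fields_rel)
  fix Xs p
  assume Xs: "Xs \<in> field_lists S (Suc q)"
  have \<gamma>': "\<gamma>' \<in> forms S q" using form_rel_forms[OF rel] \<gamma> by simp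
  have len: "length Xs = Suc q" using Xs by (simp add: field_lists_def)
  define A' where "A' = (\<lambda>i. C' (eval_form \<gamma>' (omit i Xs)) p [(Xs ! i) p])"
  define B' where "B' = (\<lambda>i j. eval_form \<gamma>' (vf_bracket S (Xs ! i) (Xs ! j) # omit i (omit j Xs)) p)"
  define Ys where "Ys = map (push_field h) Xs"
  have crel: "form_rel (C' (eval_form \<gamma>' (omit i Xs))) (C (eval_form \<gamma> (omit i Ys)))"
    if "i < Suc q" for i
  proof -
    have "eval_form \<gamma>' (omit i Xs) \<in> sections S"
      by (rule k_section_section[OF eval_form_k_section[OF \<gamma>' omit_field_lists[OF Xs that]]])
    then show ?thesis
      using C unfolding conn_rel_def Ys_def map_omit[symmetric] eval_form_push[OF rel] by blast
  qed
  have A'_ideal: "A' i \<in> ideal S p" if "i < Suc q" for i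
    unfolding A'_def by (rule form_rel_ideal[OF crel[OF that]])
  have B'_ideal: "B' i j \<in> ideal S p" for i j
    by (simp add: B'_def eval_form_def form_rel_ideal[OF rel])
  have A: "\<phi> p (A' i) = C (eval_form \<gamma> (omit i Ys)) (h p) [(Ys ! i) (h p)]" if "i < Suc q" for i
    unfolding A'_def form_rel_apply[OF crel[OF that]] using that len by (simp add: Ys_def)
  have B: "\<phi> p (B' i j) = eval_form \<gamma> (vf_bracket S (Ys ! i) (Ys ! j) # omit i (omit j Ys)) (h p)"
    if "i < j" "j < Suc q" for i j
  proof -
    have "vf_bracket S (Ys ! i) (Ys ! j) # omit i (omit j Ys) =
        map (push_field h) (vf_bracket S (Xs ! i) (Xs ! j) # omit i (omit j Xs))"
      using that len by (simp add: Ys_def map_omit vf_bracket_push[OF manifold diffeo])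
    then show ?thesis by (simp only: B'_def eval_form_push[OF rel] push_h)
  qed
  have SA: "(\<Sum>i<Suc q. (- 1) ^ i *\<^sub>R A' i) \<in> ideal S p"
    by (rule sum_ideal) (simp only: lessThan_iff A'_ideal scale_ideal)
  have SB_inner: "(\<Sum>i<j. (- 1) ^ (i + j) *\<^sub>R B' i j) \<in> ideal S p" for j
    by (rule sum_ideal) (rule scale_ideal[OF B'_ideal])
  have SB: "(\<Sum>j<Suc q. \<Sum>i<j. (- 1) ^ (i + j) *\<^sub>R B' i j) \<in> ideal S p"
    by (rule sum_ideal) (rule SB_inner)
  show "(\<Sum>i<Suc q. (- 1) ^ i *\<^sub>R C' (eval_form \<gamma>' (omit i Xs)) p [(Xs ! i) p]) +
      (\<Sum>j<Suc q. \<Sum>i<j. (- 1) ^ (i + j) *\<^sub>R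
        eval_form \<gamma>' (vf_bracket S (Xs ! i) (Xs ! j) # omit i (omit j Xs)) p) \<in> ideal S p"
    using subspace_add[OF ideal_sub SA SB] unfolding A'_def B'_def .
  have "\<phi> p (\<Sum>i<Suc q. (- 1) ^ i *\<^sub>R A' i) = (\<Sum>i<Suc q. \<phi> p ((- 1) ^ i *\<^sub>R A' i))"
    by (rule phi_sum) (simp only: lessThan_iff A'_ideal scale_ideal ideal_fib)
  also have "\<dots> = (\<Sum>i<Suc q. (- 1) ^ i *\<^sub>R C (eval_form \<gamma> (omit i Ys)) (h p) [(Ys ! i) (h p)])"
    by (rule sum.cong[OF refl]) (simp only: lessThan_iff A'_ideal ideal_fib phi_scale A)
  finally have eqA: "\<phi> p (\<Sum>i<Suc q. (- 1) ^ i *\<^sub>R A' i) =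
      (\<Sum>i<Suc q. (- 1) ^ i *\<^sub>R C (eval_form \<gamma> (omit i Ys)) (h p) [(Ys ! i) (h p)])" .
  have "\<phi> p (\<Sum>j<Suc q. \<Sum>i<j. (- 1) ^ (i + j) *\<^sub>R B' i j) =
      (\<Sum>j<Suc q. \<phi> p (\<Sum>i<j. (- 1) ^ (i + j) *\<^sub>R B' i j))"
    by (rule phi_sum) (rule ideal_fib[OF SB_inner])
  also have "\<dots> = (\<Sum>j<Suc q. \<Sum>i<j. \<phi> p ((- 1) ^ (i + j) *\<^sub>R B' i j))"
    by (rule sum.cong[OF refl], rule phi_sum) (rule ideal_fib[OF scale_ideal[OF B'_ideal]])
  also have "\<dots> = (\<Sum>j<Suc q. \<Sum>i<j. (- 1) ^ (i + j) *\<^sub>R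
        eval_form \<gamma> (vf_bracket S (Ys ! i) (Ys ! j) # omit i (omit j Ys)) (h p))"
    by (intro sum.cong refl) (simp only: lessThan_iff B'_ideal ideal_fib phi_scale B)
  finally have "\<phi> p ((\<Sum>i<Suc q. (- 1) ^ i *\<^sub>R A' i) + (\<Sum>j<Suc q. \<Sum>i<j. (- 1) ^ (i + j) *\<^sub>R B' i j)) =
      (\<Sum>i<Suc q. (- 1) ^ i *\<^sub>R C (eval_form \<gamma> (omit i Ys)) (h p) [(Ys ! i) (h p)]) +
      (\<Sum>j<Suc q. \<Sum>i<j. (- 1) ^ (i + j) *\<^sub>R
        eval_form \<gamma> (vf_bracket S (Ys ! i) (Ys ! j) # omit i (omit j Ys)) (h p))"
    by (simp only: phi_add[OF ideal_fib[OF SA] ideal_fib[OF SB]] eqA)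
  then show "\<phi> p ((\<Sum>i<Suc q. (- 1) ^ i *\<^sub>R C' (eval_form \<gamma>' (omit i Xs)) p [(Xs ! i) p]) +
      (\<Sum>j<Suc q. \<Sum>i<j. (- 1) ^ (i + j) *\<^sub>R
        eval_form \<gamma>' (vf_bracket S (Xs ! i) (Xs ! j) # omit i (omit j Xs)) p)) =
      (\<Sum>i<Suc q. (- 1) ^ i *\<^sub>R C (eval_form \<gamma> (omit i (map (push_field h) Xs))) (h p)
        [(map (push_field h) Xs ! i) (h p)]) +
      (\<Sum>j<Suc q. \<Sum>i<j. (- 1) ^ (i + j) *\<^sub>R
        eval_form \<gamma> (vf_bracket S (map (push_field h) Xs ! i) (map (push_field h) Xs ! j) #
          omit i (omit j (map (push_field h) Xs))) (h p))"
    unfolding A'_def B'_def Ys_def .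
qed

lemma cov_d_forms: "cov_d S C q \<gamma> \<in> forms S (Suc q)"
  unfolding cov_d_def by (rule form_of_fields_forms)

lemma form_bracket_rel:
  assumes rel: "form_rel \<gamma>' \<gamma>" and \<gamma>: "\<gamma> \<in> forms S 1"
  shows "form_rel (form_bracket S \<gamma>') (form_bracket S \<gamma>)"
  unfolding form_bracket_def
proof (rule form_of_fields_rel)
  fix Xs p
  assume Xs: "Xs \<in> field_lists S 2"
  have \<gamma>': "\<gamma>' \<in> forms S 1" using form_rel_forms[OF rel] \<gamma> by simp
  have lt: "(0::nat) < 2" "(1::nat) < 2" by simp_all
  have len: "length Xs = 2" and "vector_field S (Xs ! i)" if "i < 2" for i
    using Xs that by (simp_all add: field_lists_def)
  then have k: "eval_form \<gamma>' [Xs ! i] \<in> k_sections S" if "i < 2" for i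
    using that by (intro eval_form_k_section[OF \<gamma>']) (simp add: field_lists_def)
  have b: "bracket S (eval_form \<gamma>' [Xs ! 0]) (eval_form \<gamma>' [Xs ! 1]) p \<in> ideal S p"
    by (intro k_section_ideal bracket_k_section k_section_section k) simp_all
  then show "2 *\<^sub>R bracket S (eval_form \<gamma>' [Xs ! 0]) (eval_form \<gamma>' [Xs ! 1]) p \<in> ideal S p"
    by (rule scale_ideal)
  have e: "eval_form \<gamma> [map (push_field h) Xs ! i] = push (eval_form \<gamma>' [Xs ! i])" if "i < 2" for i
    using eval_form_push[OF rel, of "[Xs ! i]"] len that by simp
  have "push (bracket S (eval_form \<gamma>' [Xs ! 0]) (eval_form \<gamma>' [Xs ! 1])) =
      bracket S (eval_form \<gamma> [map (push_field h) Xs ! 0]) (eval_form \<gamma> [map (push_field h) Xs ! 1])"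
    unfolding e[OF lt(1)] e[OF lt(2)]
    by (rule push_bracket[OF k_section_section[OF k[OF lt(1)]] k_section_section[OF k[OF lt(2)]]])
  then have "\<phi> p (bracket S (eval_form \<gamma>' [Xs ! 0]) (eval_form \<gamma>' [Xs ! 1]) p) =
      bracket S (eval_form \<gamma> [map (push_field h) Xs ! 0]) (eval_form \<gamma> [map (push_field h) Xs ! 1]) (h p)"
    using push_h by metis
  then show "\<phi> p (2 *\<^sub>R bracket S (eval_form \<gamma>' [Xs ! 0]) (eval_form \<gamma>' [Xs ! 1]) p) =
      2 *\<^sub>R bracket S (eval_form \<gamma> [map (push_field h) Xs ! 0])
        (eval_form \<gamma> [map (push_field h) Xs ! 1]) (h p)"
    by (simp only: phi_scale[OF ideal_fib[OF b]])
qed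

lemma form_bracket_forms: "form_bracket S \<gamma> \<in> forms S 2"
  unfolding form_bracket_def by (rule form_of_fields_forms)

lemma interior_rel:
  "form_rel \<gamma>' \<gamma> \<Longrightarrow> form_rel (interior \<gamma>' X) (interior \<gamma> (push_field h X))"
  by (simp add: form_rel_def point_rel_def interior_def)

lemma d_wedge_rel:
  assumes rel: "form_rel \<omega>' \<omega>"
  shows "form_rel (d_wedge S q (f \<circ> h) \<omega>') (d_wedge S q f \<omega>)"
proof (rule form_relI)
  fix p vs
  let ?s = "\<lambda>vs f j. (- 1) ^ j * (vs ! j) f :: real"
  have I: "?s vs (f \<circ> h) j *\<^sub>R \<omega>' p (omit j vs) \<in> ideal S p" for j
    by (rule scale_ideal[OF form_rel_ideal[OF rel]])
  have J: "(\<Sum>j<q. ?s vs (f \<circ> h) j *\<^sub>R \<omega>' p (omit j vs)) \<in> ideal S p"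
    by (rule sum_ideal) (rule I)
  show "d_wedge S q (f \<circ> h) \<omega>' p vs \<in> ideal S p"
    using J subspace_0[OF ideal_sub] by (simp add: d_wedge_def)
  have "\<phi> p (\<Sum>j<q. ?s vs (f \<circ> h) j *\<^sub>R \<omega>' p (omit j vs)) =
      (\<Sum>j<q. \<phi> p (?s vs (f \<circ> h) j *\<^sub>R \<omega>' p (omit j vs)))"
    by (rule phi_sum) (rule ideal_fib[OF I])
  also have "\<dots> = (\<Sum>j<q. ?s (map (differential h) vs) f j *\<^sub>R
      \<omega> (h p) (omit j (map (differential h) vs)))" if "length vs = q"
    using that by (intro sum.cong refl)
      (simp add: phi_scale[OF ideal_fib[OF form_rel_ideal[OF rel]]] form_rel_apply[OF rel]
        map_omit differential_def)
  finally show "\<phi> p (d_wedge S q (f \<circ> h) \<omega>' p vs) = d_wedge S q f \<omega> (h p) (map (differential h) vs)"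
    by (simp add: d_wedge_def)
qed

section \<open>Naturality of the metric operators\<close>

lemma gmet_dh:
  assumes "u \<in> tangent_space S p" "v \<in> tangent_space S p"
  shows "gmet S (h p) (differential h u) (differential h v) = gmet S p u v"
  using isometry assms unfolding orientation_preserving_isometry_def by blast

lemma orthonormal_basis_dh:
  "orthonormal_basis S (h p) (map (differential h) e) \<longleftrightarrow> orthonormal_basis S p e"
proof (cases "tangent_basis S p e")
  case True
  then have e: "length e = mdim S" "e ! i \<in> tangent_space S p" if "i < mdim S" for i
    using that by (auto simp: tangent_basis_def)
  then have "gmet S (h p) (map (differential h) e ! i) (map (differential h) e ! j) =
      gmet S p (e ! i) (e ! j)" if "i < mdim S" "j < mdim S" for i j
    using that by (simp add: gmet_dh)
  then show ?thesis
    unfolding orthonormal_basis_def tangent_basis_differential[OF manifold diffeo] by simp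
qed (simp add: orthonormal_basis_def tangent_basis_differential[OF manifold diffeo])

text \<open>
  A diffeomorphism that maps positive bases to positive bases maps no other basis to a positive
  one: the coefficients of a basis in a positive basis are preserved, so that the sign of their
  determinant decides on both sides.
\<close>

lemma orient_dh: "map (differential h) e \<in> orient S (h p) \<longleftrightarrow> e \<in> orient S p"
proof
  have orientation: "orientation S" using data by (simp add: yang_mills_data_def)
  have basis: "tangent_basis S q e'" if "e' \<in> orient S q" for q e'
    using orientation that unfolding orientation_def by blast
  have sign: "e'' \<in> orient S q \<longleftrightarrow> real_det (mdim S) a > 0"
    if "e' \<in> orient S q" "tangent_basis S q e''"
      "\<forall>j<mdim S. e'' ! j = tan_comb (mdim S) (\<lambda>i. a i j) e'" for q e' e'' a
    using orientation that unfolding orientation_def by blast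
  have forward: "map (differential h) e' \<in> orient S (h p)" if "e' \<in> orient S p" for e'
    using isometry that unfolding orientation_preserving_isometry_def by blast
  show "map (differential h) e \<in> orient S (h p)" if "e \<in> orient S p"
    by (rule forward[OF that])
  assume pos: "map (differential h) e \<in> orient S (h p)"
  then have e: "tangent_basis S p e"
    using basis tangent_basis_differential[OF manifold diffeo] by blast
  obtain c where c: "oriented_chart S c" "p \<in> fst c"
    using orientation unfolding orientation_def by blast
  define e0 where "e0 = coord_frame S c p"
  have e0: "e0 \<in> orient S p" using c by (simp add: oriented_chart_def e0_def)
  have "\<forall>j<mdim S. \<exists>b. e ! j = tan_comb (mdim S) b e0"
    using e basis[OF e0] unfolding tangent_basis_def by (metis nth_mem subsetD)
  then obtain b where b: "\<forall>j<mdim S. e ! j = tan_comb (mdim S) (b j) e0" by metis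
  have "length e0 = mdim S" "length e = mdim S"
    using basis[OF e0] e by (simp_all add: tangent_basis_def)
  then have "\<forall>j<mdim S. map (differential h) e ! j =
      tan_comb (mdim S) (b j) (map (differential h) e0)"
    using b by (simp add: tan_comb_differential)
  then have "real_det (mdim S) (\<lambda>i j. b j i) > 0"
    using sign[OF forward[OF e0] basis[OF pos], of "\<lambda>i j. b j i"] pos by simp
  then show "e \<in> orient S p"
    using sign[OF e0 e, of "\<lambda>i j. b j i"] b by simp
qed

lemma all_bases_dh: "(\<forall>e. P (map (differential h) e)) \<longleftrightarrow> (\<forall>e. P e)"
  by (metis map_dh_inverse)

lemma all_points_h: "(\<forall>p. P (h p)) \<longleftrightarrow> (\<forall>p. P p)"
  by (metis h_inv(1))

text \<open>
  Substituting the bases \<open>dh e\<close> for the bases at \<open>h p\<close> turns the defining conditions into each other.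
\<close>

lemma form_inner_natural:
  assumes "form_rel \<gamma>' \<gamma>" "form_rel \<eta>' \<eta>"
  shows "form_inner S q \<gamma>' \<eta>' p = form_inner S q \<gamma> \<eta> (h p)"
proof -
  have "kmet S (h p) (\<gamma> (h p) (nths (map (differential h) e) I)) (\<eta> (h p) (nths (map (differential h) e) I)) =
      kmet S p (\<gamma>' p (nths e I)) (\<eta>' p (nths e I))" for e I
    unfolding nths_map form_rel_apply[OF assms(1), symmetric] form_rel_apply[OF assms(2), symmetric]
    by (rule phi_kmet[OF form_rel_ideal[OF assms(1)] form_rel_ideal[OF assms(2)]])
  then have "(\<forall>e. orthonormal_basis S p e \<longrightarrow>
        d = (\<Sum>I | I \<subseteq> {..<mdim S} \<and> card I = q. kmet S p (\<gamma>' p (nths e I)) (\<eta>' p (nths e I)))) \<longleftrightarrow>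
      (\<forall>e. orthonormal_basis S (h p) e \<longrightarrow>
        d = (\<Sum>I | I \<subseteq> {..<mdim S} \<and> card I = q. kmet S (h p) (\<gamma> (h p) (nths e I)) (\<eta> (h p) (nths e I))))"
    for d
    by (subst all_bases_dh[symmetric]) (simp only: orthonormal_basis_dh)
  then show ?thesis unfolding form_inner_def by simp
qed

lemma hodge_rel:
  assumes rel: "form_rel \<gamma>' \<gamma>"
  shows "form_rel (hodge S q \<gamma>') (hodge S q \<gamma>)"
  unfolding hodge_def
proof (rule form_rel_the_or[of "mdim S - q"])
  fix \<eta>' \<eta>
  assume r: "form_rel \<eta>' \<eta>"
  let ?P' = "\<lambda>p e I. orthonormal_basis S p e \<and> e \<in> orient S p \<and> I \<subseteq> {..<mdim S} \<and> card I = q \<longrightarrow>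
    \<eta>' p (nths e ({..<mdim S} - I)) = shuffle_sign (mdim S) I *\<^sub>R \<gamma>' p (nths e I)"
  let ?P = "\<lambda>p e I. orthonormal_basis S p e \<and> e \<in> orient S p \<and> I \<subseteq> {..<mdim S} \<and> card I = q \<longrightarrow>
    \<eta> p (nths e ({..<mdim S} - I)) = shuffle_sign (mdim S) I *\<^sub>R \<gamma> p (nths e I)"
  have "?P (h p) (map (differential h) e) I \<longleftrightarrow> ?P' p e I" for p e I
  proof -
    have f: "\<gamma>' p (nths e I) \<in> fib S p" "\<eta>' p (nths e ({..<mdim S} - I)) \<in> fib S p"
      by (simp_all add: ideal_fib form_rel_ideal[OF rel] form_rel_ideal[OF r])
    show ?thesis
      unfolding nths_map form_rel_apply[OF rel, symmetric] form_rel_apply[OF r, symmetric]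
        phi_scale[OF f(1), symmetric] phi_inj[OF f(2) subspace_scale[OF fib_sub f(1)]]
        orthonormal_basis_dh orient_dh ..
  qed
  then have "(\<forall>p e I. ?P' p e I) \<longleftrightarrow> (\<forall>p e I. ?P (h p) (map (differential h) e) I)" by simp
  also have "\<dots> \<longleftrightarrow> (\<forall>p e I. ?P (h p) e I)"
    using all_bases_dh[of "\<lambda>e. \<forall>I. ?P (h p) e I" for p] by simp
  also have "\<dots> \<longleftrightarrow> (\<forall>p e I. ?P p e I)"
    by (rule all_points_h)
  finally show "\<eta>' \<in> forms S (mdim S - q) \<and> (\<forall>p e I. ?P' p e I) \<longleftrightarrow>
      \<eta> \<in> forms S (mdim S - q) \<and> (\<forall>p e I. ?P p e I)"
    by (simp only: form_rel_forms[OF r])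
qed simp_all

lemma hodge_forms: "hodge S q \<gamma> \<in> forms S (mdim S - q)"
  unfolding hodge_def
  by (rule the_or_cases[where R = "\<lambda>\<eta>. \<eta> \<in> forms S (mdim S - q)"])
     (simp_all add: zero_form[OF vbundle ideals])

lemma hodge_inv_rel:
  assumes "form_rel \<omega>' \<omega>"
  shows "form_rel (hodge_inv S q \<omega>') (hodge_inv S q \<omega>)"
  unfolding hodge_inv_def
proof (rule form_rel_the_or[of q])
  fix \<eta>' \<eta>
  assume r: "form_rel \<eta>' \<eta>"
  show "\<eta>' \<in> forms S q \<and> hodge S q \<eta>' = \<omega>' \<longleftrightarrow> \<eta> \<in> forms S q \<and> hodge S q \<eta> = \<omega>"
    by (simp only: form_rel_forms[OF r] form_rel_eq_iff[OF hodge_rel[OF r] assms])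
qed simp_all

lemma cov_delta_rel:
  assumes "conn_rel C' C" "form_rel \<gamma>' \<gamma>"
  shows "form_rel (cov_delta S C' k \<gamma>') (cov_delta S C k \<gamma>)"
  unfolding cov_delta_def
  by (intro form_rel_scale hodge_inv_rel cov_d_rel assms hodge_rel hodge_forms)

section \<open>Invariance of the volume and of the action\<close>

text \<open>
  Both frames differentiate \<open>f\<close> in the same coordinates: \<open>f \<circ> h\<close> in the pulled back chart is \<open>f\<close> in
  the given one, on the open image of the chart.
\<close>

lemma coord_frame_dh:
  assumes c: "(U, x) \<in> atlas S" and q: "h q \<in> U"
  shows "map (differential h) (coord_frame S (h -` U, x \<circ> h) q) = coord_frame S (U, x) (h q)"
proof -
  have chart: "is_chart (mdim S) (U, x)" by (rule manifold_chart[OF manifold c])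
  have "pderiv_at i (\<lambda>z. (f \<circ> h) (inv_into (h -` U) (x \<circ> h) z)) (x (h q)) =
      pderiv_at i (\<lambda>z. f (inv_into U x z)) (x (h q))" if "i < mdim S" for i f
  proof (rule pderiv_at_cong[OF _ _ _ that])
    show "openin (Rn (mdim S)) (x ` U)" using chart by (simp add: is_chart_def)
    show "x (h q) \<in> x ` U" using q by simp
    show "(f \<circ> h) (inv_into (h -` U) (x \<circ> h) z) = f (inv_into U x z)" if "z \<in> x ` U" for z
      using inv_into_pullback_chart[OF diffeomorphism_bij[OF diffeo] chart_inj[OF chart] that]
      by simp
  qed
  then show ?thesis
    by (auto simp: coord_frame_def differential_def smooth_near_comp_iff[OF manifold diffeo] fun_eq_iff)
qed

lemma oriented_chart_pullback:
  assumes "oriented_chart S (U, x)"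
  shows "oriented_chart S (h -` U, x \<circ> h)"
  using assms atlas_pullback[OF manifold diffeo] coord_frame_dh orient_dh
  unfolding oriented_chart_def fst_conv by (metis vimageE)

lemma orient_basis: "e \<in> orient S p \<Longrightarrow> tangent_basis S p e"
  using data unfolding yang_mills_data_def orientation_def by blast

lemma real_det_cong:
  "(\<And>i j. i < n \<Longrightarrow> j < n \<Longrightarrow> a i j = b i j) \<Longrightarrow> real_det n a = real_det n b"
  unfolding real_det_def by (rule arg_cong[where f = Determinant.det]) (rule eq_matI, simp_all)

lemma vol_form_natural:
  assumes "length vs = mdim S" "set vs \<subseteq> tangent_space S p"
  shows "vol_form S (h p) (map (differential h) vs) = vol_form S p vs"
proof -
  have "real_det (mdim S) (\<lambda>i j. gmet S (h p) (map (differential h) e ! i) (map (differential h) vs ! j)) =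
      real_det (mdim S) (\<lambda>i j. gmet S p (e ! i) (vs ! j))" if "orthonormal_basis S p e" for e
  proof (rule real_det_cong)
    fix i j assume ij: "i < mdim S" "j < mdim S"
    have e: "length e = mdim S" "set e \<subseteq> tangent_space S p"
      using that by (simp_all add: orthonormal_basis_def tangent_basis_def)
    then have "e ! i \<in> tangent_space S p" "vs ! j \<in> tangent_space S p"
      using ij assms by auto
    then show "gmet S (h p) (map (differential h) e ! i) (map (differential h) vs ! j) =
        gmet S p (e ! i) (vs ! j)"
      using ij e assms by (simp add: gmet_dh)
  qed
  then have "(\<forall>e. orthonormal_basis S (h p) e \<and> e \<in> orient S (h p) \<longrightarrow>
        d = real_det (mdim S) (\<lambda>i j. gmet S (h p) (e ! i) (map (differential h) vs ! j))) \<longleftrightarrow>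
      (\<forall>e. orthonormal_basis S p e \<and> e \<in> orient S p \<longrightarrow>
        d = real_det (mdim S) (\<lambda>i j. gmet S p (e ! i) (vs ! j)))" for d
    by (subst all_bases_dh[symmetric]) (simp add: orthonormal_basis_dh orient_dh cong: imp_cong)
  then show ?thesis unfolding vol_form_def by simp
qed

lemma h_borel: "sets \<nu> = sets borel \<Longrightarrow> h \<in> measurable \<nu> borel"
  using borel_measurable_continuous_onI[OF diffeomorphism_continuous(1)[OF diffeo]]
  by (simp cong: measurable_cong_sets)

definition is_volume :: "'m measure \<Rightarrow> bool" where
  "is_volume \<nu> \<longleftrightarrow> sets \<nu> = sets borel \<and>
     (\<forall>U x B. oriented_chart S (U, x) \<and> B \<in> sets borel \<and> B \<subseteq> U \<longrightarrow>
        emeasure \<nu> B =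
          (\<integral>\<^sup>+ z. ennreal (vol_form S (inv_into U x z) (coord_frame S (U, x) (inv_into U x z)))
                 * indicator (x ` B) z \<partial>(\<Pi>\<^sub>M i\<in>{..<mdim S}. lborel)))"

text \<open>
  The formula for \<open>h\<^sub>* \<nu>\<close> in a chart is the formula for \<open>\<nu>\<close> in the pulled back chart, since both charts
  have the same image and \<open>vol_form\<close> takes the same value on corresponding coordinate frames.
\<close>

lemma is_volume_distr:
  assumes \<nu>: "is_volume \<nu>"
  shows "is_volume (distr \<nu> borel h)"
  unfolding is_volume_def
proof (intro conjI allI impI)
  fix U x B
  assume A: "oriented_chart S (U, x) \<and> B \<in> sets borel \<and> B \<subseteq> U"
  have sets: "sets \<nu> = sets borel" using \<nu> by (simp add: is_volume_def)
  then have space: "space \<nu> = UNIV" using sets_eq_imp_space_eq[OF sets] by simp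
  have chart: "(U, x) \<in> atlas S" using A by (simp add: oriented_chart_def)
  have bij: "bij h" by (rule diffeomorphism_bij[OF diffeo])
  have inj: "inj_on x U" by (rule chart_inj[OF manifold_chart[OF manifold chart]])
  let ?U = "h -` U" and ?x = "x \<circ> h" and ?B = "h -` B"
  have B: "?B \<in> sets borel"
    using measurable_sets[OF h_borel[OF sets], of B] A by (simp add: space sets)
  have "emeasure (distr \<nu> borel h) B = emeasure \<nu> ?B"
    using A by (simp add: emeasure_distr[OF h_borel[OF sets]] space)
  also have "\<dots> = (\<integral>\<^sup>+ z. ennreal (vol_form S (inv_into ?U ?x z)
      (coord_frame S (?U, ?x) (inv_into ?U ?x z))) * indicator (?x ` ?B) z \<partial>(\<Pi>\<^sub>M i\<in>{..<mdim S}. lborel))"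
  proof -
    have "?B \<subseteq> ?U" using A by auto
    then show ?thesis
      using \<nu> oriented_chart_pullback B A unfolding is_volume_def by blast
  qed
  also have "?x ` ?B = x ` B"
    by (simp only: image_comp[symmetric] surj_image_vimage_eq[OF bij_is_surj[OF bij]])
  also have "(\<integral>\<^sup>+ z. ennreal (vol_form S (inv_into ?U ?x z)
      (coord_frame S (?U, ?x) (inv_into ?U ?x z))) * indicator (x ` B) z \<partial>(\<Pi>\<^sub>M i\<in>{..<mdim S}. lborel)) =
      (\<integral>\<^sup>+ z. ennreal (vol_form S (inv_into U x z) (coord_frame S (U, x) (inv_into U x z)))
                 * indicator (x ` B) z \<partial>(\<Pi>\<^sub>M i\<in>{..<mdim S}. lborel))"
  proof (rule nn_integral_cong)
    fix z
    show "ennreal (vol_form S (inv_into ?U ?x z)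
        (coord_frame S (?U, ?x) (inv_into ?U ?x z))) * indicator (x ` B) z =
      ennreal (vol_form S (inv_into U x z) (coord_frame S (U, x) (inv_into U x z))) * indicator (x ` B) z"
    proof (cases "z \<in> x ` B")
      case True
      then have z: "z \<in> x ` U" using A by auto
      define q where "q = inverse_map (inv_into U x z)"
      have hq: "h q = inv_into U x z" "h q \<in> U"
        using inv_into_into[OF z] by (simp_all add: q_def)
      have q: "inv_into ?U ?x z = q"
        unfolding q_def by (rule inv_into_pullback_chart[OF bij inj z])
      have "coord_frame S (?U, ?x) q \<in> orient S q"
        using oriented_chart_pullback A hq(2) by (simp add: oriented_chart_def)
      then have "tangent_basis S q (coord_frame S (?U, ?x) q)" by (rule orient_basis)
      then have "vol_form S (h q) (map (differential h) (coord_frame S (?U, ?x) q)) =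
          vol_form S q (coord_frame S (?U, ?x) q)"
        by (intro vol_form_natural) (simp_all add: tangent_basis_def)
      then show ?thesis
        unfolding q coord_frame_dh[OF chart hq(2)] by (simp add: hq(1))
    qed simp
  qed
  finally show "emeasure (distr \<nu> borel h) B =
      (\<integral>\<^sup>+ z. ennreal (vol_form S (inv_into U x z) (coord_frame S (U, x) (inv_into U x z)))
                 * indicator (x ` B) z \<partial>(\<Pi>\<^sub>M i\<in>{..<mdim S}. lborel))" .
qed simp

lemma vol_measure_eq: "vol_measure S = the_or (null_measure borel) is_volume"
  unfolding vol_measure_def is_volume_def by (rule refl)

lemma sets_vol: "sets (vol_measure S) = sets borel"
  unfolding vol_measure_eq
  by (rule the_or_cases[where R = "\<lambda>\<nu>. sets \<nu> = sets borel"]) (simp_all add: is_volume_def)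

text \<open>
  If the description has a unique solution, the image of this solution is a solution too, hence
  equal to it; the default value, the null measure, is invariant as well.
\<close>

lemma distr_vol: "distr (vol_measure S) borel h = vol_measure S"
proof (cases "\<exists>!\<nu>. is_volume \<nu>")
  case True
  then have v: "is_volume (vol_measure S)"
    unfolding vol_measure_eq the_or_def using theI'[OF True] by simp
  show ?thesis
    using True is_volume_distr[OF v] v by blast
next
  case False
  then have v: "vol_measure S = null_measure borel"
    by (simp add: vol_measure_eq the_or_def)
  show ?thesis
    unfolding v by (rule measure_eqI) (simp_all add: emeasure_distr h_borel)
qed

text \<open>
  For Borel functions this is the change of variables. As \<open>h\<close> is a homeomorphism, \<open>f \<circ> h\<close> is
  a Borel function only if \<open>f\<close> is one; for other \<open>f\<close> both integrals have the value \<open>0\<close>.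
\<close>

lemma integral_vol:
  fixes f :: "'m \<Rightarrow> real"
  shows "(LINT p|vol_measure S. f (h p)) = (LINT p|vol_measure S. f p)"
proof (cases "f \<in> borel_measurable borel")
  case True
  then have "(LINT p|distr (vol_measure S) borel h. f p) = (LINT p|vol_measure S. f (h p))"
    by (rule integral_distr[OF h_borel[OF sets_vol]])
  then show ?thesis by (simp add: distr_vol)
next
  case False
  have measurable: "g \<in> borel_measurable (vol_measure S) \<longleftrightarrow> g \<in> borel_measurable borel"
    for g :: "'m \<Rightarrow> real"
    by (simp add: sets_vol cong: measurable_cong_sets)
  have "(\<lambda>p. f (h p)) \<notin> borel_measurable borel"
  proof
    assume "(\<lambda>p. f (h p)) \<in> borel_measurable borel"
    from measurable_compose[OF
        borel_measurable_continuous_onI[OF diffeomorphism_continuous(2)[OF diffeo]] this]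
    show False using False by simp
  qed
  then have "\<not> integrable (vol_measure S) (\<lambda>p. f (h p))" "\<not> integrable (vol_measure S) f"
    using borel_measurable_integrable measurable False by blast+
  then show ?thesis by (simp add: not_integrable_integral_eq)
qed

lemma ym_action_natural:
  assumes C: "conn_rel (fst c') (fst c)" and rel: "form_rel F' F" and F: "F \<in> forms S 2"
  shows "ym_action S \<mu> c' F' = ym_action S \<mu> c F"
proof -
  have G: "form_rel (cov_d S (fst c') 2 F') (cov_d S (fst c) 2 F)"
    by (rule cov_d_rel[OF C rel F])
  show ?thesis
    unfolding ym_action_def form_inner_natural[OF rel rel] form_inner_natural[OF G G]
      integral_vol[of "form_inner S 2 F F"]
      integral_vol[of "form_inner S 3 (cov_d S (fst c) 2 F) (cov_d S (fst c) 2 F)"] ..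
qed

section \<open>Naturality of infinitesimally multiplicative forms\<close>

lemma delta0_rel:
  assumes "\<alpha> \<in> sections S" "form_rel \<gamma>' \<gamma>" "\<gamma> \<in> forms S q"
  shows "form_rel (fst (delta0 S q \<gamma>') \<alpha>) (fst (delta0 S q \<gamma>) (push \<alpha>))"
    and "form_rel (on_sections (snd (delta0 S q \<gamma>')) \<alpha>) (on_sections (snd (delta0 S q \<gamma>)) (push \<alpha>))"
proof -
  have eq: "on_sections (snd (delta0 S q \<eta>)) \<beta> = interior \<eta> (anchored S \<beta>)" for \<eta> and \<beta> :: "'m \<Rightarrow> 'a"
    by (simp add: on_sections_def delta0_def interior_def anchored_def)
  show "form_rel (fst (delta0 S q \<gamma>') \<alpha>) (fst (delta0 S q \<gamma>) (push \<alpha>))"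
    using lieA_rel[OF assms] by (simp add: delta0_def)
  show "form_rel (on_sections (snd (delta0 S q \<gamma>')) \<alpha>) (on_sections (snd (delta0 S q \<gamma>)) (push \<alpha>))"
    unfolding eq push_anchored[OF assms(1), symmetric] by (rule interior_rel[OF assms(2)])
qed

lemma im_formD:
  assumes "im_form S q c"
  shows im_form_degree: "0 < q"
    and im_form_fst: "\<alpha> \<in> sections S \<Longrightarrow> fst c \<alpha> \<in> forms S q"
    and im_form_snd: "\<alpha> \<in> sections S \<Longrightarrow> on_sections (snd c) \<alpha> \<in> forms S (q - 1)"
    and im_form_bundle: "a \<in> fib S p \<Longrightarrow> snd c p a \<in> alt_forms S (q - 1) p"
    and im_form_bundle_add: "a \<in> fib S p \<Longrightarrow> b \<in> fib S p \<Longrightarrow>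
      snd c p (a + b) vs = snd c p a vs + snd c p b vs"
    and im_form_bundle_scale: "a \<in> fib S p \<Longrightarrow> snd c p (r *\<^sub>R a) vs = r *\<^sub>R snd c p a vs"
    and im_form_add: "\<alpha> \<in> sections S \<Longrightarrow> \<beta> \<in> sections S \<Longrightarrow>
      fst c (\<lambda>p. \<alpha> p + \<beta> p) = (\<lambda>p vs. fst c \<alpha> p vs + fst c \<beta> p vs)"
    and im_form_scale: "\<alpha> \<in> sections S \<Longrightarrow>
      fst c (\<lambda>p. r *\<^sub>R \<alpha> p) = (\<lambda>p vs. r *\<^sub>R fst c \<alpha> p vs)"
    and im_form_leibniz: "\<alpha> \<in> sections S \<Longrightarrow> smooth_fun S UNIV f \<Longrightarrow>
      fst c (\<lambda>p. f p *\<^sub>R \<alpha> p) =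
        (\<lambda>p vs. f p *\<^sub>R fst c \<alpha> p vs + d_wedge S q f (on_sections (snd c) \<alpha>) p vs)"
    and im_form_bracket_fst: "\<alpha> \<in> sections S \<Longrightarrow> \<beta> \<in> sections S \<Longrightarrow>
      fst c (bracket S \<alpha> \<beta>) = (\<lambda>p vs. lieA S q \<alpha> (fst c \<beta>) p vs - lieA S q \<beta> (fst c \<alpha>) p vs)"
    and im_form_bracket_snd: "\<alpha> \<in> sections S \<Longrightarrow> \<beta> \<in> sections S \<Longrightarrow>
      on_sections (snd c) (bracket S \<alpha> \<beta>) =
        (\<lambda>p vs. lieA S (q - 1) \<alpha> (on_sections (snd c) \<beta>) p vs
                - interior (fst c \<alpha>) (anchored S \<beta>) p vs)"
    and im_form_interior: "\<alpha> \<in> sections S \<Longrightarrow> \<beta> \<in> sections S \<Longrightarrow>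
      interior (on_sections (snd c) \<beta>) (anchored S \<alpha>) =
        (\<lambda>p vs. - interior (on_sections (snd c) \<alpha>) (anchored S \<beta>) p vs)"
proof -
  obtain c0 c1 where c: "c = (c0, c1)" by (cases c)
  note all = assms[unfolded c im_form_def prod.case]
  note sec = conjunct1[OF conjunct2[OF all]]
    and bun = conjunct1[OF conjunct2[OF conjunct2[OF all]]]
    and eqs = conjunct2[OF conjunct2[OF conjunct2[OF all]]]
  show "0 < q" by (rule conjunct1[OF all])
  show "\<alpha> \<in> sections S \<Longrightarrow> fst c \<alpha> \<in> forms S q"
    "\<alpha> \<in> sections S \<Longrightarrow> on_sections (snd c) \<alpha> \<in> forms S (q - 1)"
    using sec unfolding c by simp_all
  show "a \<in> fib S p \<Longrightarrow> snd c p a \<in> alt_forms S (q - 1) p"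
    "a \<in> fib S p \<Longrightarrow> b \<in> fib S p \<Longrightarrow> snd c p (a + b) vs = snd c p a vs + snd c p b vs"
    "a \<in> fib S p \<Longrightarrow> snd c p (r *\<^sub>R a) vs = r *\<^sub>R snd c p a vs"
    using bspec[OF bspec[OF spec[OF bun, of p], of a], of b]
      bspec[OF bspec[OF spec[OF bun, of p], of a], of a] unfolding c by simp_all
  show "\<alpha> \<in> sections S \<Longrightarrow> \<beta> \<in> sections S \<Longrightarrow>
      fst c (\<lambda>p. \<alpha> p + \<beta> p) = (\<lambda>p vs. fst c \<alpha> p vs + fst c \<beta> p vs)"
    "\<alpha> \<in> sections S \<Longrightarrow> fst c (\<lambda>p. r *\<^sub>R \<alpha> p) = (\<lambda>p vs. r *\<^sub>R fst c \<alpha> p vs)"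
    "\<alpha> \<in> sections S \<Longrightarrow> smooth_fun S UNIV f \<Longrightarrow>
      fst c (\<lambda>p. f p *\<^sub>R \<alpha> p) =
        (\<lambda>p vs. f p *\<^sub>R fst c \<alpha> p vs + d_wedge S q f (on_sections (snd c) \<alpha>) p vs)"
    "\<alpha> \<in> sections S \<Longrightarrow> \<beta> \<in> sections S \<Longrightarrow>
      fst c (bracket S \<alpha> \<beta>) = (\<lambda>p vs. lieA S q \<alpha> (fst c \<beta>) p vs - lieA S q \<beta> (fst c \<alpha>) p vs)"
    "\<alpha> \<in> sections S \<Longrightarrow> \<beta> \<in> sections S \<Longrightarrow>
      on_sections (snd c) (bracket S \<alpha> \<beta>) =
        (\<lambda>p vs. lieA S (q - 1) \<alpha> (on_sections (snd c) \<beta>) p vs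
                - interior (fst c \<alpha>) (anchored S \<beta>) p vs)"
    "\<alpha> \<in> sections S \<Longrightarrow> \<beta> \<in> sections S \<Longrightarrow>
      interior (on_sections (snd c) \<beta>) (anchored S \<alpha>) =
        (\<lambda>p vs. - interior (on_sections (snd c) \<alpha>) (anchored S \<beta>) p vs)"
    using eqs[rule_format, of \<alpha> \<beta>] eqs[rule_format, of \<alpha> \<alpha>] unfolding c fst_conv snd_conv by blast+
qed

lemma pull_im_fst:
  assumes "im_form S q c"
  shows "conn_rel (fst (pull_im S \<phi> h c)) (fst c)"
  unfolding conn_rel_def pull_im_def fst_conv
  using pull_form_rel im_form_fst[OF assms push_section_closed] by blast

lemma pull_im_snd_point:
  assumes "im_form S q c" "a \<in> fib S p"
  shows "point_rel p (snd (pull_im S \<phi> h c) p a) (snd c (h p) (\<phi> p a))"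
  unfolding pull_im_def snd_conv by (rule pull_at_rel[OF im_form_bundle[OF assms(1) phi_fib[OF assms(2)]]])

lemma pull_im_snd:
  assumes "im_form S q c" "\<alpha> \<in> sections S"
  shows "form_rel (on_sections (snd (pull_im S \<phi> h c)) \<alpha>) (on_sections (snd c) (push \<alpha>))"
  unfolding form_rel_def on_sections_def push_h
  using pull_im_snd_point[OF assms(1) section_fib[OF assms(2)]] by blast

text \<open>
  Identifies a pullback without knowing beforehand that the given form is smooth: it is enough that
  a candidate vanishes outside the tangent spaces, as a pullback does by convention.
\<close>

lemma pull_form_unique:
  assumes rel: "form_rel \<gamma>' \<gamma>" and off: "\<And>p vs. \<not> set vs \<subseteq> tangent_space S p \<Longrightarrow> \<gamma>' p vs = 0"
  shows "pull_form S \<phi> h \<gamma> = \<gamma>'"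
proof (intro ext)
  fix p vs
  show "pull_form S \<phi> h \<gamma> p vs = \<gamma>' p vs"
    unfolding pull_form_def pull_at_def form_rel_apply[OF rel, symmetric]
      the_inv_into_f_f[OF phi_ideal_inj form_rel_ideal[OF rel]]
    using off by simp
qed

lemma form_off: "\<gamma> \<in> forms S q \<Longrightarrow> \<not> set vs \<subseteq> tangent_space S p \<Longrightarrow> \<gamma> p vs = 0"
  using alt_forms_off[of "\<gamma> p" S q p vs] by (simp add: forms_def)

lemma sections_add:
  "\<alpha> \<in> sections S \<Longrightarrow> \<beta> \<in> sections S \<Longrightarrow> (\<lambda>p. \<alpha> p + \<beta> p) \<in> sections S"
  using section_lincomb[OF manifold vbundle, of \<alpha> \<beta> 1 1] by simp

lemma sections_scale: "\<alpha> \<in> sections S \<Longrightarrow> (\<lambda>p. r *\<^sub>R \<alpha> p) \<in> sections S"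
  using section_lincomb[OF manifold vbundle, of \<alpha> \<alpha> r 0] by simp

lemma sections_diff:
  "\<alpha> \<in> sections S \<Longrightarrow> \<beta> \<in> sections S \<Longrightarrow> (\<lambda>p. \<alpha> p - \<beta> p) \<in> sections S"
  using section_lincomb[OF manifold vbundle, of \<alpha> \<beta> 1 "- 1"] by simp

text \<open>
  Each identity between forms required of the pullback is related to the corresponding identity
  for the given form, and the relation is bi-unique.
\<close>

lemma pull_im_form:
  assumes c: "im_form S q c"
  shows "im_form S q (pull_im S \<phi> h c)"
proof -
  define c0 where "c0 = fst (pull_im S \<phi> h c)"
  define c1 where "c1 = snd (pull_im S \<phi> h c)"
  have R0: "form_rel (c0 \<alpha>) (fst c (push \<alpha>))" if "\<alpha> \<in> sections S" for \<alpha>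
    using pull_im_fst[OF c] that by (simp add: conn_rel_def c0_def)
  have R1: "form_rel (on_sections c1 \<alpha>) (on_sections (snd c) (push \<alpha>))" if "\<alpha> \<in> sections S" for \<alpha>
    unfolding c1_def by (rule pull_im_snd[OF c that])
  have P1: "point_rel p (c1 p a) (snd c (h p) (\<phi> p a))" if "a \<in> fib S p" for p a
    unfolding c1_def by (rule pull_im_snd_point[OF c that])
  have I1: "c1 p a vs \<in> ideal S p" and A1: "\<phi> p (c1 p a vs) = snd c (h p) (\<phi> p a) (map (differential h) vs)"
    if "a \<in> fib S p" for p a vs
    using P1[OF that] by (simp_all add: point_rel_def)
  have F0: "c0 \<alpha> \<in> forms S q" if "\<alpha> \<in> sections S" for \<alpha>
    using form_rel_forms[OF R0[OF that]] im_form_fst[OF c push_section_closed[OF that]] by simp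
  have F1: "on_sections c1 \<alpha> \<in> forms S (q - 1)" if "\<alpha> \<in> sections S" for \<alpha>
    using form_rel_forms[OF R1[OF that]] im_form_snd[OF c push_section_closed[OF that]] by simp
  have "im_form S q (c0, c1)"
    unfolding im_form_def prod.case
  proof (intro conjI ballI allI impI)
    show "0 < q" by (rule im_form_degree[OF c])
  next
    fix \<alpha> assume \<alpha>: "\<alpha> \<in> sections S"
    show "c0 \<alpha> \<in> forms S q" by (rule F0[OF \<alpha>])
    show "on_sections c1 \<alpha> \<in> forms S (q - 1)" by (rule F1[OF \<alpha>])
  next
    fix p a b and r :: real
    assume a: "a \<in> fib S p" and b: "b \<in> fib S p"
    show "c1 p a \<in> alt_forms S (q - 1) p"
      using point_rel_alt_forms[OF P1[OF a]] im_form_bundle[OF c phi_fib[OF a]] by simp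
    show "c1 p (a + b) = (\<lambda>vs. c1 p a vs + c1 p b vs)"
    proof
      fix vs
      note ab = subspace_add[OF fib_sub a b]
      have "\<phi> p (c1 p (a + b) vs) = \<phi> p (c1 p a vs + c1 p b vs)"
        unfolding phi_add[OF ideal_fib[OF I1[OF a]] ideal_fib[OF I1[OF b]]]
          A1[OF a] A1[OF b] A1[OF ab] phi_add[OF a b]
        by (rule im_form_bundle_add[OF c phi_fib[OF a] phi_fib[OF b]])
      then show "c1 p (a + b) vs = c1 p a vs + c1 p b vs"
        using phi_inj[OF ideal_fib[OF I1[OF ab]]
            ideal_fib[OF subspace_add[OF ideal_sub I1[OF a] I1[OF b]]]] by simp
    qed
    show "c1 p (r *\<^sub>R a) = (\<lambda>vs. r *\<^sub>R c1 p a vs)"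
    proof
      fix vs
      note ra = subspace_scale[OF fib_sub a, of r]
      have "\<phi> p (c1 p (r *\<^sub>R a) vs) = \<phi> p (r *\<^sub>R c1 p a vs)"
        unfolding phi_scale[OF ideal_fib[OF I1[OF a]]] A1[OF a] A1[OF ra] phi_scale[OF a]
        by (rule im_form_bundle_scale[OF c phi_fib[OF a]])
      then show "c1 p (r *\<^sub>R a) vs = r *\<^sub>R c1 p a vs"
        using phi_inj[OF ideal_fib[OF I1[OF ra]] ideal_fib[OF scale_ideal[OF I1[OF a]]]] by simp
    qed
  next
    fix \<alpha> \<beta>
    assume \<alpha>: "\<alpha> \<in> sections S" and \<beta>: "\<beta> \<in> sections S"
    note \<alpha>' = push_section_closed[OF \<alpha>] and \<beta>' = push_section_closed[OF \<beta>]
    have "push (\<lambda>p. \<alpha> p + \<beta> p) = (\<lambda>p. push \<alpha> p + push \<beta> p)"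
      by (rule push_eqI) (simp add: phi_add section_fib \<alpha> \<beta>)
    then show "c0 (\<lambda>p. \<alpha> p + \<beta> p) = (\<lambda>p vs. c0 \<alpha> p vs + c0 \<beta> p vs)"
      using form_rel_eq_iff[OF R0[OF sections_add[OF \<alpha> \<beta>]] form_rel_add[OF R0[OF \<alpha>] R0[OF \<beta>]]]
        im_form_add[OF c \<alpha>' \<beta>'] by simp
    show "c0 (\<lambda>p. r *\<^sub>R \<alpha> p) = (\<lambda>p vs. r *\<^sub>R c0 \<alpha> p vs)" for r
    proof -
      have "push (\<lambda>p. r *\<^sub>R \<alpha> p) = (\<lambda>p. r *\<^sub>R push \<alpha> p)"
        by (rule push_eqI) (simp add: phi_scale section_fib \<alpha>)
      then show ?thesis
        using form_rel_eq_iff[OF R0[OF sections_scale[OF \<alpha>]] form_rel_scale[OF R0[OF \<alpha>]]]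
          im_form_scale[OF c \<alpha>'] by simp
    qed
    show "c0 (\<lambda>p. f p *\<^sub>R \<alpha> p) =
        (\<lambda>p vs. f p *\<^sub>R c0 \<alpha> p vs + d_wedge S q f (on_sections c1 \<alpha>) p vs)"
      if f: "smooth_fun S UNIV f" for f
    proof -
      define f' where "f' = f \<circ> inverse_map"
      have f'h: "f' \<circ> h = f" by (simp add: f'_def comp_def)
      have f': "smooth_fun S UNIV f'"
        using smooth_fun_pullback[OF manifold diffeomorphism_inv[OF diffeo] f] by (simp add: f'_def)
      have "push (\<lambda>p. f p *\<^sub>R \<alpha> p) = (\<lambda>p. f' p *\<^sub>R push \<alpha> p)"
        by (rule push_eqI) (simp add: phi_scale section_fib \<alpha> f'_def)
      moreover have "form_rel
          (\<lambda>p vs. f p *\<^sub>R c0 \<alpha> p vs + d_wedge S q f (on_sections c1 \<alpha>) p vs)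
          (\<lambda>p vs. f' p *\<^sub>R fst c (push \<alpha>) p vs + d_wedge S q f' (on_sections (snd c) (push \<alpha>)) p vs)"
        using form_rel_lincomb[OF R0[OF \<alpha>] d_wedge_rel[OF R1[OF \<alpha>], of q f'], of f "\<lambda>p. 1"]
        by (simp add: f'h) (simp add: f'_def)
      \<comment> \<open>\<open>R0\<close> speaks of sections; at \<open>f \<alpha>\<close> the pullback is found from the Leibniz rule by uniqueness\<close>
      ultimately have "pull_form S \<phi> h (fst c (push (\<lambda>p. f p *\<^sub>R \<alpha> p))) =
          (\<lambda>p vs. f p *\<^sub>R c0 \<alpha> p vs + d_wedge S q f (on_sections c1 \<alpha>) p vs)"
        unfolding im_form_leibniz[OF c \<alpha>' f', symmetric]
        by (intro pull_form_unique) (simp_all add: form_off[OF F0[OF \<alpha>]] d_wedge_def)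
      then show ?thesis by (simp add: c0_def pull_im_def)
    qed
    have L0: "form_rel (lieA S q \<alpha> (c0 \<beta>)) (lieA S q (push \<alpha>) (fst c (push \<beta>)))"
      "form_rel (lieA S q \<beta> (c0 \<alpha>)) (lieA S q (push \<beta>) (fst c (push \<alpha>)))"
      by (intro lieA_rel \<alpha> \<beta> R0 im_form_fst[OF c] \<alpha>' \<beta>')+
    show "c0 (bracket S \<alpha> \<beta>) = (\<lambda>p vs. lieA S q \<alpha> (c0 \<beta>) p vs - lieA S q \<beta> (c0 \<alpha>) p vs)"
      using form_rel_eq_iff[OF R0[OF bracket_section[OF \<alpha> \<beta>]] form_rel_diff[OF L0]]
        im_form_bracket_fst[OF c \<alpha>' \<beta>'] by (simp add: push_bracket[OF \<alpha> \<beta>])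
    have L1: "form_rel (lieA S (q - 1) \<alpha> (on_sections c1 \<beta>))
        (lieA S (q - 1) (push \<alpha>) (on_sections (snd c) (push \<beta>)))"
      by (rule lieA_rel[OF \<alpha> R1[OF \<beta>] im_form_snd[OF c \<beta>']])
    have N: "form_rel (interior \<gamma>' (anchored S \<delta>)) (interior \<gamma> (anchored S (push \<delta>)))"
      if "form_rel \<gamma>' \<gamma>" "\<delta> \<in> sections S" for \<gamma>' \<gamma> \<delta>
      using interior_rel[OF that(1), of "anchored S \<delta>"] by (simp only: push_anchored[OF that(2)])
    show "on_sections c1 (bracket S \<alpha> \<beta>) =
          (\<lambda>p vs. lieA S (q - 1) \<alpha> (on_sections c1 \<beta>) p vs - interior (c0 \<alpha>) (anchored S \<beta>) p vs)"
      using form_rel_eq_iff[OF R1[OF bracket_section[OF \<alpha> \<beta>]]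
          form_rel_diff[OF L1 N[OF R0[OF \<alpha>] \<beta>]]]
        im_form_bracket_snd[OF c \<alpha>' \<beta>'] by (simp add: push_bracket[OF \<alpha> \<beta>])
    show "interior (on_sections c1 \<beta>) (anchored S \<alpha>) =
          (\<lambda>p vs. - interior (on_sections c1 \<alpha>) (anchored S \<beta>) p vs)"
      using form_rel_eq_iff[OF N[OF R1[OF \<beta>] \<alpha>] form_rel_minus[OF N[OF R1[OF \<alpha>] \<beta>]]]
        im_form_interior[OF c \<alpha>' \<beta>'] by simp
  qed
  then show ?thesis by (simp add: c0_def c1_def)
qed

lemma pull_im_connection:
  assumes "im_connection S c"
  shows "im_connection S (pull_im S \<phi> h c)"
proof -
  have c: "im_form S 1 c" "snd c p \<xi> [] = \<xi>" if "\<xi> \<in> ideal S p" for p \<xi>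
    using assms that by (simp_all add: im_connection_def)
  have "snd (pull_im S \<phi> h c) p \<xi> [] = \<xi>" if "\<xi> \<in> ideal S p" for p \<xi>
    using c(2)[OF phi_ideal[OF that]] the_inv_into_f_f[OF phi_ideal_inj that]
    by (simp add: pull_im_def pull_at_def)
  then show ?thesis
    using assms pull_im_form by (simp add: im_connection_def)
qed

section \<open>Invariance under gauge transformations\<close>

text \<open>
  The section \<open>\<alpha> - v(\<alpha>)\<close> in \<open>\<Omega>\<^sub>1(\<alpha>) = \<C>(\<alpha> - v(\<alpha>))\<close> of the pulled back connection is pushed forward to
  the corresponding section for the given connection.
\<close>

lemma curv_rel:
  assumes c: "im_form S 1 c" and \<alpha>: "\<alpha> \<in> sections S"
  shows "form_rel (curv0 S (pull_im S \<phi> h c) \<alpha>) (curv0 S c (push \<alpha>))"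
    and "form_rel (curv1 (pull_im S \<phi> h c) \<alpha>) (curv1 c (push \<alpha>))"
proof -
  let ?c = "pull_im S \<phi> h c"
  have R: "form_rel (fst ?c \<beta>) (fst c (push \<beta>))" if "\<beta> \<in> sections S" for \<beta>
    using pull_im_fst[OF c] that by (simp add: conn_rel_def)
  show "form_rel (curv0 S ?c \<alpha>) (curv0 S c (push \<alpha>))"
    unfolding curv0_def
    by (rule cov_d_rel[OF pull_im_fst[OF c] R[OF \<alpha>] im_form_fst[OF c push_section_closed[OF \<alpha>]]])
  define v where "v = eval_form (on_sections (snd ?c) \<alpha>) []"
  have v: "v p = snd ?c p (\<alpha> p) []" for p
    by (simp add: v_def eval_form_def on_sections_def)
  have "on_sections (snd ?c) \<alpha> \<in> forms S 0"
    using im_form_snd[OF pull_im_form[OF c] \<alpha>] by simp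
  then have v_section: "v \<in> k_sections S"
    unfolding v_def by (rule eval_form_k_section) (simp add: field_lists_def)
  have "push (\<lambda>p. \<alpha> p - v p) = (\<lambda>p. push \<alpha> p - snd c p (push \<alpha> p) [])"
  proof (rule push_eqI)
    fix p
    have "\<phi> p (v p) = snd c (h p) (\<phi> p (\<alpha> p)) []"
      using pull_im_snd_point[OF c section_fib[OF \<alpha>], of p] unfolding v point_rel_def
      by (metis list.map_disc_iff)
    then show "\<phi> p (\<alpha> p - v p) = push \<alpha> (h p) - snd c (h p) (push \<alpha> (h p)) []"
      by (simp add: phi_minus section_fib[OF \<alpha>] ideal_fib[OF k_section_ideal[OF v_section]])
  qed
  then show "form_rel (curv1 ?c \<alpha>) (curv1 c (push \<alpha>))"
    using R[OF sections_diff[OF \<alpha> k_section_section[OF v_section]]] by (simp add: curv1_def v)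
qed

lemma ball_push: "(\<forall>\<alpha>\<in>sections S. P (push \<alpha>)) \<longleftrightarrow> (\<forall>\<alpha>\<in>sections S. P \<alpha>)"
  using push_section_closed push_sections_surj by metis

lemma ball_form_rel:
  assumes "\<And>\<gamma>' \<gamma>. form_rel \<gamma>' \<gamma> \<Longrightarrow> \<gamma>' \<in> forms S q \<Longrightarrow> \<gamma> \<in> forms S q \<Longrightarrow> P' \<gamma>' \<longleftrightarrow> P \<gamma>"
  shows "(\<forall>\<gamma>'\<in>forms S q. P' \<gamma>') \<longleftrightarrow> (\<forall>\<gamma>\<in>forms S q. P \<gamma>)"
proof (intro iffI ballI)
  fix \<gamma> assume L: "\<forall>\<gamma>'\<in>forms S q. P' \<gamma>'" and \<gamma>: "\<gamma> \<in> forms S q"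
  note rel = pull_form_rel[OF \<gamma>]
  have "pull_form S \<phi> h \<gamma> \<in> forms S q" using form_rel_forms[OF rel] \<gamma> by simp
  then show "P \<gamma>" using assms[OF rel] L \<gamma> by simp
next
  fix \<gamma>' assume R: "\<forall>\<gamma>\<in>forms S q. P \<gamma>" and \<gamma>': "\<gamma>' \<in> forms S q"
  obtain \<gamma> where "\<gamma> \<in> forms S q" "form_rel \<gamma>' \<gamma>" by (rule form_rel_surj[OF \<gamma>'])
  then show "P' \<gamma>'" using assms R \<gamma>' by simp
qed

lemma delta0_curv_natural:
  assumes c: "im_form S 1 c" and rel: "form_rel F' F" and F: "F \<in> forms S 2"
  shows "delta0_curv S r (pull_im S \<phi> h c) F' \<longleftrightarrow> delta0_curv S r c F"
proof -
  let ?P = "\<lambda>c F \<alpha>. fst (delta0 S 2 F) \<alpha> = (\<lambda>p vs. r *\<^sub>R curv0 S c \<alpha> p vs) \<and>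
     on_sections (snd (delta0 S 2 F)) \<alpha> = (\<lambda>p vs. r *\<^sub>R curv1 c \<alpha> p vs)"
  have "?P (pull_im S \<phi> h c) F' \<alpha> \<longleftrightarrow> ?P c F (push \<alpha>)" if \<alpha>: "\<alpha> \<in> sections S" for \<alpha>
    unfolding form_rel_eq_iff[OF delta0_rel(1)[OF \<alpha> rel F] form_rel_scale[OF curv_rel(1)[OF c \<alpha>]]]
      form_rel_eq_iff[OF delta0_rel(2)[OF \<alpha> rel F] form_rel_scale[OF curv_rel(2)[OF c \<alpha>]]] ..
  then have "(\<forall>\<alpha>\<in>sections S. ?P (pull_im S \<phi> h c) F' \<alpha>) \<longleftrightarrow> (\<forall>\<alpha>\<in>sections S. ?P c F (push \<alpha>))"
    by (rule ball_cong[OF refl])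
  also have "\<dots> \<longleftrightarrow> (\<forall>\<alpha>\<in>sections S. ?P c F \<alpha>)"
    by (rule ball_push)
  finally show ?thesis unfolding delta0_curv_def .
qed

text \<open>
  For related \<open>\<gamma>'\<close> and \<open>\<gamma>\<close> the varied data are related for every parameter \<open>r\<close>, so the two functions
  of \<open>r\<close> are equal and not merely their derivatives at \<open>0\<close>.
\<close>

lemma longitudinally_critical_natural:
  assumes c: "im_form S 1 c" and rel: "form_rel F' F" and F: "F \<in> forms S 2"
  shows "longitudinally_critical S \<mu> (pull_im S \<phi> h c) F' \<longleftrightarrow> longitudinally_critical S \<mu> c F"
  unfolding longitudinally_critical_def
proof (rule ball_form_rel)
  fix \<gamma>' \<gamma>
  assume r: "form_rel \<gamma>' \<gamma>" and \<gamma>: "\<gamma> \<in> forms S 1"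
  let ?c = "pull_im S \<phi> h c"
  note C = pull_im_fst[OF c]
  have "ym_action S \<mu> (im_shift ?c r (delta0 S 1 \<gamma>'))
        (\<lambda>p vs. F' p vs + r *\<^sub>R cov_d S (fst ?c) 1 \<gamma>' p vs - (r\<^sup>2 / 2) *\<^sub>R form_bracket S \<gamma>' p vs) =
      ym_action S \<mu> (im_shift c r (delta0 S 1 \<gamma>))
        (\<lambda>p vs. F p vs + r *\<^sub>R cov_d S (fst c) 1 \<gamma> p vs - (r\<^sup>2 / 2) *\<^sub>R form_bracket S \<gamma> p vs)" for r
  proof (rule ym_action_natural)
    show "conn_rel (fst (im_shift ?c r (delta0 S 1 \<gamma>'))) (fst (im_shift c r (delta0 S 1 \<gamma>)))"
      unfolding conn_rel_def im_shift_def fst_conv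
    proof
      fix \<alpha> assume \<alpha>: "\<alpha> \<in> sections S"
      have "form_rel (fst ?c \<alpha>) (fst c (push \<alpha>))" using C \<alpha> by (simp add: conn_rel_def)
      then show "form_rel (\<lambda>p vs. fst ?c \<alpha> p vs + r *\<^sub>R fst (delta0 S 1 \<gamma>') \<alpha> p vs)
          (\<lambda>p vs. fst c (push \<alpha>) p vs + r *\<^sub>R fst (delta0 S 1 \<gamma>) (push \<alpha>) p vs)"
        by (intro form_rel_add form_rel_scale delta0_rel(1)[OF \<alpha> \<open>form_rel \<gamma>' \<gamma>\<close> \<gamma>])
    qed
    show "form_rel
        (\<lambda>p vs. F' p vs + r *\<^sub>R cov_d S (fst ?c) 1 \<gamma>' p vs - (r\<^sup>2 / 2) *\<^sub>R form_bracket S \<gamma>' p vs)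
        (\<lambda>p vs. F p vs + r *\<^sub>R cov_d S (fst c) 1 \<gamma> p vs - (r\<^sup>2 / 2) *\<^sub>R form_bracket S \<gamma> p vs)"
      by (intro form_rel_diff form_rel_add form_rel_scale rel cov_d_rel[OF C \<open>form_rel \<gamma>' \<gamma>\<close> \<gamma>]
          form_bracket_rel[OF \<open>form_rel \<gamma>' \<gamma>\<close> \<gamma>])
    have d: "cov_d S (fst c) 1 \<gamma> \<in> forms S 2"
      using cov_d_forms[of "fst c" 1 \<gamma>] by (simp add: numeral_2_eq_2)
    note lincomb = form_lincomb[OF manifold vbundle ideals]
    show "(\<lambda>p vs. F p vs + r *\<^sub>R cov_d S (fst c) 1 \<gamma> p vs - (r\<^sup>2 / 2) *\<^sub>R form_bracket S \<gamma> p vs)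
        \<in> forms S 2"
      using lincomb[OF lincomb[OF F d, of 1 r] form_bracket_forms[of \<gamma>], of 1 "- (r\<^sup>2 / 2)"] by simp
  qed
  then show "((\<lambda>r. ym_action S \<mu> (im_shift ?c r (delta0 S 1 \<gamma>'))
        (\<lambda>p vs. F' p vs + r *\<^sub>R cov_d S (fst ?c) 1 \<gamma>' p vs - (r\<^sup>2 / 2) *\<^sub>R form_bracket S \<gamma>' p vs))
      has_real_derivative 0) (at 0) \<longleftrightarrow>
    ((\<lambda>r. ym_action S \<mu> (im_shift c r (delta0 S 1 \<gamma>))
        (\<lambda>p vs. F p vs + r *\<^sub>R cov_d S (fst c) 1 \<gamma> p vs - (r\<^sup>2 / 2) *\<^sub>R form_bracket S \<gamma> p vs))
      has_real_derivative 0) (at 0)"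
    by (simp only:)
qed

lemma invariant_forms_natural:
  assumes rel: "form_rel \<beta>' \<beta>" and \<beta>: "\<beta> \<in> forms S q"
  shows "\<beta>' \<in> invariant_forms S q \<longleftrightarrow> \<beta> \<in> invariant_forms S q"
proof -
  let ?P = "\<lambda>\<beta> \<alpha>. fst (delta0 S q \<beta>) \<alpha> = (\<lambda>p vs. 0) \<and> on_sections (snd (delta0 S q \<beta>)) \<alpha> = (\<lambda>p vs. 0)"
  have "?P \<beta>' \<alpha> \<longleftrightarrow> ?P \<beta> (push \<alpha>)" if \<alpha>: "\<alpha> \<in> sections S" for \<alpha>
    unfolding form_rel_eq_iff[OF delta0_rel(1)[OF \<alpha> rel \<beta>] form_rel_zero]
      form_rel_eq_iff[OF delta0_rel(2)[OF \<alpha> rel \<beta>] form_rel_zero] ..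
  then have "(\<forall>\<alpha>\<in>sections S. ?P \<beta>' \<alpha>) \<longleftrightarrow> (\<forall>\<alpha>\<in>sections S. ?P \<beta> (push \<alpha>))"
    by (rule ball_cong[OF refl])
  also have "\<dots> \<longleftrightarrow> (\<forall>\<alpha>\<in>sections S. ?P \<beta> \<alpha>)"
    by (rule ball_push)
  finally show ?thesis
    unfolding invariant_forms_def mem_Collect_eq form_rel_forms[OF rel] by (simp only:)
qed

text \<open>
  As in the longitudinal case; here the variations that are matched are the invariant \<open>2\<close>-forms.
\<close>

lemma transversally_critical_natural:
  assumes c: "im_form S 1 c" and rel: "form_rel F' F" and F: "F \<in> forms S 2"
  shows "transversally_critical S \<mu> (pull_im S \<phi> h c) F' \<longleftrightarrow> transversally_critical S \<mu> c F"
proof -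
  let ?c = "pull_im S \<phi> h c"
  let ?D = "\<lambda>c F \<beta>. ((\<lambda>r. ym_action S \<mu> c (\<lambda>p vs. F p vs + r *\<^sub>R \<beta> p vs)) has_real_derivative 0) (at 0)"
  have crit: "transversally_critical S \<mu> c F \<longleftrightarrow>
      (\<forall>\<beta>\<in>forms S 2. \<beta> \<in> invariant_forms S 2 \<longrightarrow> ?D c F \<beta>)" for c F
    unfolding transversally_critical_def invariant_forms_def by blast
  show ?thesis
    unfolding crit
  proof (rule ball_form_rel)
    fix \<beta>' \<beta>
    assume r: "form_rel \<beta>' \<beta>" and \<beta>: "\<beta> \<in> forms S 2"
    have "ym_action S \<mu> ?c (\<lambda>p vs. F' p vs + r *\<^sub>R \<beta>' p vs) =
        ym_action S \<mu> c (\<lambda>p vs. F p vs + r *\<^sub>R \<beta> p vs)" for r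
    proof (rule ym_action_natural[OF pull_im_fst[OF c]])
      show "form_rel (\<lambda>p vs. F' p vs + r *\<^sub>R \<beta>' p vs) (\<lambda>p vs. F p vs + r *\<^sub>R \<beta> p vs)"
        by (intro form_rel_add form_rel_scale rel \<open>form_rel \<beta>' \<beta>\<close>)
      show "(\<lambda>p vs. F p vs + r *\<^sub>R \<beta> p vs) \<in> forms S 2"
        using form_lincomb[OF manifold vbundle ideals F \<beta>, of 1 r] by simp
    qed
    then show "(\<beta>' \<in> invariant_forms S 2 \<longrightarrow> ?D ?c F' \<beta>') \<longleftrightarrow>
        (\<beta> \<in> invariant_forms S 2 \<longrightarrow> ?D c F \<beta>)"
      by (simp only: invariant_forms_natural[OF r \<beta>])
  qed
qed

lemma cov_delta_forms: "cov_delta S C k \<gamma> \<in> forms S (k - 1)"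
proof -
  have "hodge_inv S (k - 1) \<omega> \<in> forms S (k - 1)" for \<omega>
    unfolding hodge_inv_def
    by (rule the_or_cases[where R = "\<lambda>\<eta>. \<eta> \<in> forms S (k - 1)"])
       (simp_all add: zero_form[OF vbundle ideals])
  then show ?thesis
    using form_lincomb[OF manifold vbundle ideals, where a = "(- 1) ^ k" and b = 0]
    unfolding cov_delta_def by fastforce
qed

lemma adapted_natural:
  assumes c: "im_form S 1 c" and rel: "form_rel F' F" and F: "F \<in> forms S 2"
  shows "adapted S \<mu> (pull_im S \<phi> h c) F' \<longleftrightarrow> adapted S \<mu> c F"
  unfolding adapted_def
proof (rule delta0_curv_natural[OF c])
  show "form_rel (cov_delta S (fst (pull_im S \<phi> h c)) 3 (cov_d S (fst (pull_im S \<phi> h c)) 2 F'))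
      (cov_delta S (fst c) 3 (cov_d S (fst c) 2 F))"
    by (intro cov_delta_rel cov_d_rel pull_im_fst[OF c] rel F)
  show "cov_delta S (fst c) 3 (cov_d S (fst c) 2 F) \<in> forms S 2"
    using cov_delta_forms[of "fst c" 3] by simp
qed

lemma conn_triples_natural:
  assumes "(c, F) \<in> conn_triples S"
  shows "(pull_im S \<phi> h c, pull_form S \<phi> h F) \<in> conn_triples S"
proof -
  have c: "im_connection S c" "im_form S 1 c" and F: "F \<in> forms S 2" and eq: "delta0_curv S 1 c F"
    using assms by (simp_all add: conn_triples_def im_connection_def)
  note rel = pull_form_rel[OF F]
  show ?thesis
    unfolding conn_triples_def
    using pull_im_connection[OF c(1)] form_rel_forms[OF rel] F
      delta0_curv_natural[OF c(2) rel F] eq by simp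
qed

end

theorem theorem5p60:
  fixes S :: "('m::{t2_space, second_countable_topology}, 'a::real_vector) ym"
    and \<mu> :: real
    and \<phi> :: "'m \<Rightarrow> 'a \<Rightarrow> 'a"
    and h :: "'m \<Rightarrow> 'm"
  assumes "lie_algebroid S"
    and "bundle_of_ideals S"
    and "yang_mills_data S"
    and "compact (UNIV :: 'm set)"
    and "\<mu> \<noteq> 0"
    and "gauge_transformation S \<phi> h"
  shows "\<forall>(c, F)\<in>conn_triples S.
    (pull_im S \<phi> h c, pull_form S \<phi> h F) \<in> conn_triples S \<and>
    ym_action S \<mu> (pull_im S \<phi> h c) (pull_form S \<phi> h F) = ym_action S \<mu> c F \<and>
    (longitudinally_critical S \<mu> (pull_im S \<phi> h c) (pull_form S \<phi> h F) \<longleftrightarrow>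
       longitudinally_critical S \<mu> c F) \<and>
    (transversally_critical S \<mu> (pull_im S \<phi> h c) (pull_form S \<phi> h F) \<longleftrightarrow>
       transversally_critical S \<mu> c F) \<and>
    (adapted S \<mu> (pull_im S \<phi> h c) (pull_form S \<phi> h F) \<longleftrightarrow>
       adapted S \<mu> c F)"
proof -
  interpret gauge S \<phi> h
    using assms by unfold_locales
  have "(pull_im S \<phi> h c, pull_form S \<phi> h F) \<in> conn_triples S \<and>
    ym_action S \<mu> (pull_im S \<phi> h c) (pull_form S \<phi> h F) = ym_action S \<mu> c F \<and>
    (longitudinally_critical S \<mu> (pull_im S \<phi> h c) (pull_form S \<phi> h F) \<longleftrightarrow>
       longitudinally_critical S \<mu> c F) \<and>
    (transversally_critical S \<mu> (pull_im S \<phi> h c) (pull_form S \<phi> h F) \<longleftrightarrow>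
       transversally_critical S \<mu> c F) \<and>
    (adapted S \<mu> (pull_im S \<phi> h c) (pull_form S \<phi> h F) \<longleftrightarrow> adapted S \<mu> c F)"
    if cF: "(c, F) \<in> conn_triples S" for c F
  proof -
    have c: "im_form S 1 c" and F: "F \<in> forms S 2"
      using cF by (simp_all add: conn_triples_def im_connection_def)
    note rel = pull_form_rel[OF F]
    show ?thesis
      by (intro conjI conn_triples_natural[OF cF] ym_action_natural[OF pull_im_fst[OF c] rel F]
          longitudinally_critical_natural[OF c rel F] transversally_critical_natural[OF c rel F]
          adapted_natural[OF c rel F])
  qed
  then show ?thesis by auto
qed

end
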